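(* Let $g$ be a positive integer. If $p:M(\mathbb{C})^g\to M(\mathbb{C})^g$ is an injective free polynomial mapping, then there is a free polynomial mapping $q$ such that $p\circ q(x)=x=q\circ p(x)$; that is, $p$ has a free polynomial inverse.
   Context: Let $x=(x_1,\dots,x_g)$ be freely noncommuting indeterminates. A free polynomial is an element of the free associative algebra $\mathbb{C}\langle x_1,\dots,x_g\rangle$, i.e. a finite $\mathbb{C}$-linear combination of words in $x_1,\dots,x_g$ (including the empty word). For each $n\ge 1$, a free polynomial $f$ induces a map $f[n]:M_n(\mathbb{C})^g\to M_n(\mathbb{C})$ by evaluation $X\mapsto f(X)$. $M(\mathbb{C})^g$ denotes the sequence $(M_n(\mathbb{C})^g)_{n\ge1}$. A free polynomial mapping $p:M(\mathbb{C})^g\to M(\mathbb{C})^g$ is a $g$-tuple $p=(p^1,\dots,p^g)$ of free polynomials, together with the induced maps $p[n]:M_n(\mathbb{C})^g\to M_n(\mathbb{C})^g$, $n\ge 1$. It is injective (resp. surjective, bijective) if $p[n]$ is injective (resp. surjective, bijective) for every $n\ge1$. The composition $p\circ q$ is the $g$-tuple of polynomials obtained by substituting $q^i$ for $x_i$ in $p$. *)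

theory Defs
  imports "HOL-Library.Poly_Mapping" "HOL-Library.FuncSet" "Jordan_Normal_Form.Matrix" Complex_Main
begin

(* The free monoid: with concatenation as monoid operation on words, the convolution product of
   'g list \<Rightarrow>\<^sub>0 complex is the multiplication of the free associative algebra. *)

instantiation list :: (type) monoid_add
begin

definition zero_list :: "'a list" where "zero_list = []"

definition plus_list :: "'a list \<Rightarrow> 'a list \<Rightarrow> 'a list" where "plus_list = append"

instance by standard (simp_all add: zero_list_def plus_list_def)

end

(* Free polynomials over the complex numbers in the indeterminates x_i, i :: 'g,
   as finitely supported coefficient functions on words. *)

type_synonym 'g free_poly = "'g list \<Rightarrow>\<^sub>0 complex"

type_synonym 'g free_map = "'g \<Rightarrow> 'g free_poly"

definition indet :: "'g \<Rightarrow> 'g free_poly" where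
  "indet i = Poly_Mapping.single [i] 1"

definition subst :: "'g free_map \<Rightarrow> 'g free_poly \<Rightarrow> 'g free_poly" where
  "subst q f = (\<Sum>w\<in>Poly_Mapping.keys f.
     Poly_Mapping.single [] (Poly_Mapping.lookup f w) * prod_list (map q w))"

definition free_comp :: "'g free_map \<Rightarrow> 'g free_map \<Rightarrow> 'g free_map" where
  "free_comp p q = (\<lambda>i. subst q (p i))"

definition word_eval :: "nat \<Rightarrow> ('g \<Rightarrow> complex mat) \<Rightarrow> 'g list \<Rightarrow> complex mat" where
  "word_eval n X w = foldr (\<lambda>i M. X i * M) w (1\<^sub>m n)"

(* The sum is written out entrywise because the matrix type carries no zero element of fixed
   dimension, so that the big operator for sums is not available on it. *)

definition poly_eval :: "nat \<Rightarrow> 'g free_poly \<Rightarrow> ('g \<Rightarrow> complex mat) \<Rightarrow> complex mat" where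
  "poly_eval n f X = mat n n (\<lambda>(r, c).
     \<Sum>w\<in>Poly_Mapping.keys f. Poly_Mapping.lookup f w * (word_eval n X w $$ (r, c)))"

definition map_eval :: "nat \<Rightarrow> 'g free_map \<Rightarrow> ('g \<Rightarrow> complex mat) \<Rightarrow> ('g \<Rightarrow> complex mat)" where
  "map_eval n p X = (\<lambda>i. poly_eval n (p i) X)"

definition mat_tuples :: "nat \<Rightarrow> ('g \<Rightarrow> complex mat) set" where
  "mat_tuples n = UNIV \<rightarrow> carrier_mat n n"

definition free_injective :: "'g free_map \<Rightarrow> bool" where
  "free_injective p \<longleftrightarrow> (\<forall>n\<ge>1. inj_on (map_eval n p) (mat_tuples n))"

end

theory Submission
  imports
    Defs
    "HOL-Computational_Algebra.Fundamental_Theorem_Algebra"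
    "HOL-Library.Product_Plus"
    "Jordan_Normal_Form.Determinant"
begin

text \<open>Write \<open>S\<close> for the free algebra. The proof studies the Jacobian matrix \<open>J\<close> of \<open>p\<close>, whose entries, the free
difference quotients of the \<open>p i\<close>, lie in the tensor square of \<open>S\<close>. At a block upper triangular tuple with
diagonal blocks \<open>X\<close>, \<open>Y\<close> and corner \<open>H\<close> the map \<open>p\<close> has the corner \<open>J(X, Y) H\<close>, so injectivity of \<open>p\<close> makes
\<open>J(X, Y)\<close> injective for all matrix tuples \<open>X\<close> and \<open>Y\<close> of all sizes (\<open>derivative_bi_injective\<close>). This pointwise
information is turned first into a polynomial inverse of \<open>J\<close> and then into a polynomial inverse of \<open>p\<close>.

For the first step, after a normalization, \<open>J = 1 - \<Sum>u \<otimes> C u\<close> with nonempty words \<open>u\<close> in the left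
variables and coefficients \<open>C u\<close> over \<open>S\<close>, and its companion pencil \<open>1 - \<Sum>x i \<otimes> A i\<close> is injective at all
points as well. Take for the left variables the conjugates of the matrices \<open>A i\<close> evaluated at \<open>Y\<close>, divided by
a number \<open>l\<close>: injectivity then says that \<open>l\<close> is not an eigenvalue of the completely positive map
\<open>T \<mapsto> \<Sum>A i(Y) T A i(Y)*\<close>. A linear map without nonzero eigenvalues is nilpotent, and
positivity forces every long word in the \<open>A i(Y)\<close> to vanish (\<open>completely_positive_nilpotent\<close>). The length depends on the
size \<open>m\<close> of \<open>Y\<close>; this is the main obstacle, and the dependence has to be removed. Weighted cyclic shifts of size \<open>m\<close> with
indeterminate weights generate a skew polynomial ring, which is a right Ore domain, and over such a domain a nil
semigroup of \<open>N \<times> N\<close> matrices is nilpotent of index \<open>N\<close> (\<open>nil_matrix_semigroup_index\<close>). As \<open>m\<close> grows, these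
representations separate the elements of \<open>S\<close>. Hence words of length \<open>N\<close> in the \<open>A i\<close> vanish over \<open>S\<close> itself
(\<open>free_matrix_nil_index\<close>), the Neumann series of \<open>J\<close> is finite, and \<open>J\<close> has an inverse \<open>K\<close> with polynomial entries
(\<open>bi_inverse\<close>).

For the second step, assume \<open>p(0) = 0\<close>. The derivations \<open>D i = \<Sum>j. \<partial>j(_) K j i\<close> satisfy \<open>D i (p k) = \<delta>\<close>: they
behave like the difference quotients with respect to \<open>p\<close> instead of the indeterminates. Setting the left
variables to zero gives operators \<open>L i\<close> with \<open>f = f(0) + \<Sum>p i L i f\<close>, which read off the first letter of an expansion of \<open>f\<close> in
words in \<open>p\<close>. As \<open>K\<close> is a polynomial, the indeterminates generate a finite-dimensional space under the \<open>L i\<close>. Let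
\<open>A i\<close> be the matrices of \<open>L i\<close> on generators \<open>gen\<close> of this space, so that \<open>(1 - \<Sum>p i A i) gen = gen(0)\<close>. The
indeterminates are polynomials in \<open>p\<close> as soon as the \<open>A i\<close> are jointly nilpotent.

The matrix \<open>\<Lambda> = 1 - \<Sum>p i A i\<close> has a right inverse over \<open>S\<close>, assembled from the \<open>D k gen\<close> (\<open>\<Lambda>_\<Psi>\<close>). So its
determinant at any matrix tuple with entries in \<open>\<complex>[t]\<close> is a unit, that is, a constant. Substituting a truncated compositional
inverse of \<open>p\<close> at \<open>t X\<close> shows \<open>det(1 - t\<Sum>X i \<otimes> A i) = 1\<close> modulo arbitrarily high powers of \<open>t\<close>. For
\<open>X\<close> the conjugate of \<open>A\<close> the positivity argument applies again and gives nilpotency (\<open>A_nilpotent\<close>), hence some \<open>q\<close> with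
\<open>q \<circ> p = x\<close>. This \<open>q\<close> is also a right inverse, because substituting \<open>p\<close> is injective: the operators \<open>L i\<close> recover
the coefficients of \<open>h\<close> from \<open>h(p)\<close>.\<close>

alias lookup = Poly_Mapping.lookup
alias keys = Poly_Mapping.keys
alias single = Poly_Mapping.single
alias map_key = Poly_Mapping.map_key

section \<open>Linear systems over integral domains\<close>

text \<open>Gaussian elimination without division: one equation is used to eliminate one unknown, after cross-multiplying
with the pivot. The statement is used in place of dimension counts, both over \<open>\<complex>\<close> and over the coefficient ring of the
skew polynomials.\<close>
lemma homogeneous_system_nontrivial:
  fixes F :: "'e \<Rightarrow> 'u \<Rightarrow> 'a::idom"
  assumes "finite E" "finite U" "card E < card U"
  shows "\<exists>x. (\<exists>u\<in>U. x u \<noteq> 0) \<and> (\<forall>e\<in>E. (\<Sum>u\<in>U. F e u * x u) = 0)"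
  using assms
proof (induction E arbitrary: U F rule: finite_induct)
  case empty
  then have "U \<noteq> {}" by auto
  then show ?case by (intro exI[of _ "\<lambda>_. 1"]) auto
next
  case (insert e E)
  show ?case
  proof (cases "\<forall>u\<in>U. F e u = 0")
    case True
    from insert.IH[of U F] insert.prems insert.hyps
    obtain x where "\<exists>u\<in>U. x u \<noteq> 0" "\<forall>e\<in>E. (\<Sum>u\<in>U. F e u * x u) = 0" by auto
    with True show ?thesis by (intro exI[of _ x]) auto
  next
    case False
    then obtain u0 where u0: "u0 \<in> U" "F e u0 \<noteq> 0" by auto
    define V where "V = U - {u0}"
    define G where "G e' u = F e u0 * F e' u - F e' u0 * F e u" for e' u
    have fin: "finite V" and U: "U = insert u0 V" "u0 \<notin> V"
      using insert.prems u0 by (auto simp: V_def)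
    have "card E < card V" using insert.prems insert.hyps fin unfolding U by (simp add: U(2))
    from insert.IH[OF fin this, of G] obtain y where
      y: "\<exists>u\<in>V. y u \<noteq> 0" "\<And>e'. e' \<in> E \<Longrightarrow> (\<Sum>u\<in>V. G e' u * y u) = 0" by auto
    define x where "x u = (if u = u0 then - (\<Sum>v\<in>V. F e v * y v) else F e u0 * y u)" for u
    have sumx: "(\<Sum>u\<in>U. F e' u * x u) = - F e' u0 * (\<Sum>v\<in>V. F e v * y v) + (\<Sum>u\<in>V. F e' u * (F e u0 * y u))" for e'
    proof -
      have "(\<Sum>u\<in>V. F e' u * x u) = (\<Sum>u\<in>V. F e' u * (F e u0 * y u))"
        using U(2) by (intro sum.cong) (auto simp: x_def)
      then show ?thesis unfolding U(1) using fin U(2) by (simp add: x_def)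
    qed
    have "(\<Sum>u\<in>U. F e' u * x u) = 0" if "e' \<in> insert e E" for e'
    proof (cases "e' = e")
      case True
      then show ?thesis unfolding sumx by (simp add: sum_distrib_left algebra_simps sum_negf)
    next
      case False
      then have "(\<Sum>u\<in>V. G e' u * y u) = 0" using that y(2) by auto
      then show ?thesis unfolding sumx
        by (simp add: G_def sum_distrib_left algebra_simps sum_subtractf sum_negf)
    qed
    moreover have "\<exists>u\<in>U. x u \<noteq> 0" using y(1) u0 U by (auto simp: x_def)
    ultimately show ?thesis by blast
  qed
qed

section \<open>Nil semigroups of matrices over a right Ore domain\<close>

text \<open>Matrices are functions on an index set \<open>I\<close>; only the entries with indices in \<open>I\<close> matter. The empty word gives
the identity matrix.\<close>
primrec mat_word :: "'i set \<Rightarrow> ('g \<Rightarrow> 'i \<Rightarrow> 'i \<Rightarrow> 'r::semiring_1) \<Rightarrow> 'g list \<Rightarrow> 'i \<Rightarrow> 'i \<Rightarrow> 'r" where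
  "mat_word I A [] = (\<lambda>r s. of_bool (r = s))"
| "mat_word I A (i # u) = (\<lambda>r s. \<Sum>t\<in>I. A i r t * mat_word I A u t s)"

lemma mat_word_append:
  assumes "finite I" "r \<in> I"
  shows "mat_word I A (u @ v) r s = (\<Sum>t\<in>I. mat_word I A u r t * mat_word I A v t s)"
  using assms(2)
proof (induction u arbitrary: r)
  case Nil
  then show ?case using assms(1) by (simp add: if_distrib[of "\<lambda>x. x * _"] of_bool_def cong: if_cong)
next
  case (Cons i u)
  have "mat_word I A ((i # u) @ v) r s = (\<Sum>t\<in>I. A i r t * (\<Sum>t'\<in>I. mat_word I A u t t' * mat_word I A v t' s))"
    using Cons.IH by simp
  also have "\<dots> = (\<Sum>t'\<in>I. \<Sum>t\<in>I. A i r t * mat_word I A u t t' * mat_word I A v t' s)"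
    by (subst sum.swap) (simp add: sum_distrib_left mult.assoc)
  finally show ?case by (simp add: sum_distrib_right)
qed

lemma mat_word_snoc:
  assumes "finite I" "r \<in> I" "s \<in> I"
  shows "mat_word I A (u @ [i]) r s = (\<Sum>t\<in>I. mat_word I A u r t * A i t s)"
proof -
  have "mat_word I A [i] t s = A i t s" for t
    using assms by (simp add: of_bool_def if_distrib[of "\<lambda>x. _ * x"] cong: if_cong)
  then show ?thesis using mat_word_append[OF assms(1,2), of A u "[i]" s] by simp
qed

text \<open>\<open>word_module I A k\<close> is the right submodule \<open>\<Sum>|u| = k. A^u R^I\<close> of \<open>R^I\<close>, defined one letter at a time. These submodules
decrease with \<open>k\<close>.\<close>
primrec word_module :: "'i set \<Rightarrow> ('g::finite \<Rightarrow> 'i \<Rightarrow> 'i \<Rightarrow> 'r::semiring_1) \<Rightarrow> nat \<Rightarrow> ('i \<Rightarrow> 'r) set" where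
  "word_module I A 0 = {v. \<forall>r. r \<notin> I \<longrightarrow> v r = 0}"
| "word_module I A (Suc k) = {v. \<exists>f. (\<forall>i. f i \<in> word_module I A k) \<and>
     v = (\<lambda>r. if r \<in> I then \<Sum>i\<in>UNIV. \<Sum>t\<in>I. A i r t * f i t else 0)}"

declare word_module.simps(2) [simp del]

lemma word_module_SucI:
  "(\<And>i. f i \<in> word_module I A k) \<Longrightarrow> (\<And>r. r \<in> I \<Longrightarrow> v r = (\<Sum>i\<in>UNIV. \<Sum>t\<in>I. A i r t * f i t)) \<Longrightarrow>
    (\<And>r. r \<notin> I \<Longrightarrow> v r = 0) \<Longrightarrow> v \<in> word_module I A (Suc k)"
  unfolding word_module.simps by (auto intro!: exI[of _ f])

lemma word_module_SucE:
  assumes "v \<in> word_module I A (Suc k)"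
  obtains f where "\<And>i. f i \<in> word_module I A k" "v = (\<lambda>r. if r \<in> I then \<Sum>i\<in>UNIV. \<Sum>t\<in>I. A i r t * f i t else 0)"
  using assms unfolding word_module.simps by blast

lemma word_module_zero: "(\<lambda>_. 0) \<in> word_module I A k"
proof (induction k)
  case (Suc k)
  then show ?case by (intro word_module_SucI[of "\<lambda>_ _. 0"]) auto
qed simp

lemma word_module_add:
  "v \<in> word_module I A k \<Longrightarrow> w \<in> word_module I A k \<Longrightarrow> (\<lambda>r. v r + w r) \<in> word_module I A k"
proof (induction k arbitrary: v w)
  case (Suc k)
  obtain f where f: "\<And>i. f i \<in> word_module I A k" "v = (\<lambda>r. if r \<in> I then \<Sum>i\<in>UNIV. \<Sum>t\<in>I. A i r t * f i t else 0)"
    using Suc.prems(1) by (rule word_module_SucE) blast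
  obtain h where h: "\<And>i. h i \<in> word_module I A k" "w = (\<lambda>r. if r \<in> I then \<Sum>i\<in>UNIV. \<Sum>t\<in>I. A i r t * h i t else 0)"
    using Suc.prems(2) by (rule word_module_SucE) blast
  show ?case
    by (rule word_module_SucI[of "\<lambda>i t. f i t + h i t"]) (use Suc.IH f h in \<open>auto simp: sum.distrib distrib_left\<close>)
qed auto

lemma word_module_scale:
  "v \<in> word_module I A k \<Longrightarrow> (\<lambda>r. v r * c) \<in> word_module I A k"
proof (induction k arbitrary: v)
  case (Suc k)
  obtain f where f: "\<And>i. f i \<in> word_module I A k" "v = (\<lambda>r. if r \<in> I then \<Sum>i\<in>UNIV. \<Sum>t\<in>I. A i r t * f i t else 0)"
    using Suc.prems by (rule word_module_SucE) blast
  show ?case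
    by (rule word_module_SucI[of "\<lambda>i t. f i t * c"]) (use Suc.IH f in \<open>auto simp: sum_distrib_right mult.assoc\<close>)
qed auto

lemma word_module_sum:
  "finite K \<Longrightarrow> (\<And>k. k \<in> K \<Longrightarrow> v k \<in> word_module I A n) \<Longrightarrow> (\<lambda>r. \<Sum>k\<in>K. v k r) \<in> word_module I A n"
  by (induction K rule: finite_induct) (auto intro: word_module_zero word_module_add)

lemma word_module_mono: "word_module I A (Suc k) \<subseteq> word_module I A k"
proof (induction k)
  case (Suc k)
  show ?case
  proof (rule subsetI)
    fix v assume "v \<in> word_module I A (Suc (Suc k))"
    then obtain f where f: "\<And>i. f i \<in> word_module I A (Suc k)" "v = (\<lambda>r. if r \<in> I then \<Sum>i\<in>UNIV. \<Sum>t\<in>I. A i r t * f i t else 0)"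
      by (rule word_module_SucE) blast
    show "v \<in> word_module I A (Suc k)" by (rule word_module_SucI[of f]) (use f Suc in auto)
  qed
qed (auto elim!: word_module_SucE)

lemma word_module_antimono: "j \<le> k \<Longrightarrow> word_module I A k \<subseteq> word_module I A j"
  using lift_Suc_antimono_le[of "word_module I A" j k] word_module_mono by blast

lemma word_module_outside: "v \<in> word_module I A k \<Longrightarrow> r \<notin> I \<Longrightarrow> v r = 0"
  using word_module_antimono[of 0 k I A] by auto

text \<open>With \<open>u\<close> empty and \<open>k = M\<close> this says that \<open>word_module I A M = 0\<close>; the word \<open>u\<close> makes the induction on \<open>k\<close> work.\<close>
lemma word_module_annihilated:
  assumes "finite I" and van: "\<And>u r s. M \<le> length u \<Longrightarrow> r \<in> I \<Longrightarrow> s \<in> I \<Longrightarrow> mat_word I A u r s = 0"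
  shows "v \<in> word_module I A k \<Longrightarrow> M \<le> length u + k \<Longrightarrow> r \<in> I \<Longrightarrow> (\<Sum>s\<in>I. mat_word I A u r s * v s) = 0"
proof (induction k arbitrary: u v)
  case 0
  then show ?case using van by simp
next
  case (Suc k)
  obtain f where f: "\<And>i. f i \<in> word_module I A k" "v = (\<lambda>r. if r \<in> I then \<Sum>i\<in>UNIV. \<Sum>t\<in>I. A i r t * f i t else 0)"
    using Suc.prems(1) by (rule word_module_SucE) blast
  have "(\<Sum>s\<in>I. mat_word I A u r s * v s) = (\<Sum>s\<in>I. \<Sum>i\<in>UNIV. \<Sum>t\<in>I. mat_word I A u r s * A i s t * f i t)"
    by (simp add: f(2) sum_distrib_left mult.assoc)
  also have "\<dots> = (\<Sum>i\<in>UNIV. \<Sum>s\<in>I. \<Sum>t\<in>I. mat_word I A u r s * A i s t * f i t)"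
    by (rule sum.swap)
  also have "\<dots> = (\<Sum>i\<in>UNIV. \<Sum>t\<in>I. \<Sum>s\<in>I. mat_word I A u r s * A i s t * f i t)"
    by (intro sum.cong refl sum.swap)
  also have "\<dots> = (\<Sum>i\<in>UNIV. \<Sum>t\<in>I. mat_word I A (u @ [i]) r t * f i t)"
    using Suc.prems assms(1) by (intro sum.cong refl) (simp add: mat_word_snoc sum_distrib_right)
  also have "\<dots> = 0" using Suc.IH[OF f(1)] Suc.prems by simp
  finally show ?case .
qed

lemma mat_word_column_in_word_module:
  assumes "finite I" "s \<in> I"
  shows "(\<lambda>r. if r \<in> I then mat_word I A u r s else 0) \<in> word_module I A (length u)"
proof (induction u)
  case (Cons i u)
  let ?f = "\<lambda>j r. if j = i then (if r \<in> I then mat_word I A u r s else 0) else 0"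
  have f: "?f j \<in> word_module I A (length u)" for j
    using Cons word_module_zero[of I A "length u"] by (cases "j = i") auto
  have *: "(\<Sum>j\<in>UNIV. \<Sum>t\<in>I. A j r t * ?f j t) = (\<Sum>t\<in>I. A i r t * mat_word I A u t s)" for r
  proof -
    have "(\<Sum>j\<in>UNIV. \<Sum>t\<in>I. A j r t * ?f j t) = (\<Sum>j\<in>UNIV. if j = i then \<Sum>t\<in>I. A i r t * mat_word I A u t s else 0)"
      by (intro sum.cong refl) auto
    then show ?thesis by simp
  qed
  show ?case unfolding list.size add_0_right add_Suc_right
    by (rule word_module_SucI[of ?f, OF f]) (use * in auto)
qed (use assms in auto)

text \<open>The Ore condition for two elements extends to finite families, which is needed because an element of
\<open>word_module I A (Suc k)\<close> involves one vector for every letter.\<close>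
lemma right_common_multiple_family:
  fixes c :: "'x \<Rightarrow> 'r::ring_1_no_zero_divisors"
  assumes ore: "\<And>a b :: 'r. a \<noteq> 0 \<Longrightarrow> b \<noteq> 0 \<Longrightarrow> \<exists>a' b'. a' \<noteq> 0 \<and> b' \<noteq> 0 \<and> a * a' = b * b'"
  assumes "finite X" "\<And>x. x \<in> X \<Longrightarrow> c x \<noteq> 0"
  shows "\<exists>m d. m \<noteq> 0 \<and> (\<forall>x\<in>X. m = c x * d x)"
  using assms(2,3)
proof (induction X rule: finite_induct)
  case (insert x X)
  then obtain m d where m: "m \<noteq> 0" "\<forall>y\<in>X. m = c y * d y" by auto
  from ore[of "c x" m] insert m obtain a b where ab: "a \<noteq> 0" "b \<noteq> 0" "c x * a = m * b" by auto
  have "m * b \<noteq> 0" using m ab by simp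
  moreover have "\<forall>y\<in>insert x X. m * b = c y * (if y = x then a else d y * b)"
  proof
    fix y assume "y \<in> insert x X"
    show "m * b = c y * (if y = x then a else d y * b)"
    proof (cases "y = x")
      case True
      then show ?thesis using ab by simp
    next
      case False
      then have "m = c y * d y" using m \<open>y \<in> insert x X\<close> by simp
      then have "m * b = c y * d y * b" by simp
      then show ?thesis using False by (simp add: mult.assoc)
    qed
  qed
  ultimately show ?case by (intro exI[of _ "m * b"] exI[of _ "\<lambda>y. if y = x then a else d y * b"]) blast
qed (auto intro: exI[of _ 1])

text \<open>Over a division ring this is the observation that the subspaces \<open>U k = \<Sum>|u| = k. A^u D^N\<close> decrease strictly until
they vanish, so that \<open>U N = 0\<close>. Over a right Ore domain, strictness is replaced by \<open>U k / U (k + 1)\<close> not being torsion: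
if one of these quotients is torsion, then so are all later ones, and \<open>U k\<close> itself is torsion because \<open>U M = 0\<close>, hence zero.
If \<open>U N\<close> were nonzero, vectors \<open>w k \<in> U k\<close> that are not torsion modulo \<open>U (k + 1)\<close>, for \<open>k < N\<close>, and a nonzero vector
of \<open>U N\<close> would be \<open>N + 1\<close> independent vectors in a module of rank \<open>N\<close>.\<close>
theorem nil_matrix_semigroup_index:
  fixes A :: "'g::finite \<Rightarrow> 'i \<Rightarrow> 'i \<Rightarrow> 'r::ring_1_no_zero_divisors"
  assumes fin: "finite I"
  assumes ore: "\<And>a b :: 'r. a \<noteq> 0 \<Longrightarrow> b \<noteq> 0 \<Longrightarrow> \<exists>a' b'. a' \<noteq> 0 \<and> b' \<noteq> 0 \<and> a * a' = b * b'"
  assumes dep: "\<And>w :: nat \<Rightarrow> 'i \<Rightarrow> 'r. \<exists>c. (\<exists>k\<le>card I. c k \<noteq> 0) \<and> (\<forall>r\<in>I. (\<Sum>k\<le>card I. w k r * c k) = 0)"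
  assumes van: "\<And>u r s. M \<le> length u \<Longrightarrow> r \<in> I \<Longrightarrow> s \<in> I \<Longrightarrow> mat_word I A u r s = 0"
  assumes u: "card I \<le> length u" and rs: "r \<in> I" "s \<in> I"
  shows "mat_word I A u r s = 0"
proof (rule ccontr)
  assume nz: "mat_word I A u r s \<noteq> 0"
  let ?U = "word_module I A"
  define N where "N = card I"
  have step: "\<forall>v\<in>?U (Suc k). \<exists>c. c \<noteq> 0 \<and> (\<lambda>r. v r * c) \<in> ?U (Suc (Suc k))"
    if t: "\<forall>v\<in>?U k. \<exists>c. c \<noteq> 0 \<and> (\<lambda>r. v r * c) \<in> ?U (Suc k)" for k
  proof
    fix v assume "v \<in> ?U (Suc k)"
    then obtain f where f: "\<And>i. f i \<in> ?U k" "v = (\<lambda>r. if r \<in> I then \<Sum>i\<in>UNIV. \<Sum>t\<in>I. A i r t * f i t else 0)"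
      by (rule word_module_SucE) blast
    from t f(1) have "\<forall>i. \<exists>c. c \<noteq> 0 \<and> (\<lambda>r. f i r * c) \<in> ?U (Suc k)" by auto
    then obtain c where c: "\<And>i. c i \<noteq> 0" "\<And>i. (\<lambda>r. f i r * c i) \<in> ?U (Suc k)" by metis
    obtain m d where m: "m \<noteq> 0" "\<forall>i. m = c i * d i"
      using right_common_multiple_family[OF ore, of UNIV c] c(1) by auto
    have fm: "(\<lambda>r. f i r * m) \<in> ?U (Suc k)" for i
      using word_module_scale[OF c(2)[of i], of "d i"] m(2) by (simp add: mult.assoc)
    have "(\<lambda>r. v r * m) \<in> ?U (Suc (Suc k))"
      by (rule word_module_SucI[of "\<lambda>i t. f i t * m", OF fm]) (auto simp: f(2) sum_distrib_right mult.assoc)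
    with m(1) show "\<exists>c. c \<noteq> 0 \<and> (\<lambda>r. v r * c) \<in> ?U (Suc (Suc k))" by blast
  qed
  have torsion: "v = (\<lambda>_. 0)"
    if t: "\<forall>v\<in>?U k. \<exists>c. c \<noteq> 0 \<and> (\<lambda>r. v r * c) \<in> ?U (Suc k)" and v: "v \<in> ?U k" for k v
  proof -
    have t': "\<forall>v\<in>?U (k + j). \<exists>c. c \<noteq> 0 \<and> (\<lambda>r. v r * c) \<in> ?U (Suc (k + j))" for j
      by (induction j) (use t step in auto)
    have "\<exists>c. c \<noteq> 0 \<and> (\<lambda>r. v r * c) \<in> ?U (k + j)" for j
    proof (induction j)
      case 0
      then show ?case using v by (intro exI[of _ 1]) simp
    next
      case (Suc j)
      then obtain c where c: "c \<noteq> 0" "(\<lambda>r. v r * c) \<in> ?U (k + j)" by auto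
      with t'[of j] obtain d where "d \<noteq> 0" "(\<lambda>r. v r * c * d) \<in> ?U (Suc (k + j))" by auto
      with c show ?case by (intro exI[of _ "c * d"]) (simp add: mult.assoc)
    qed
    from this[of M] obtain c where c: "c \<noteq> 0" "(\<lambda>r. v r * c) \<in> ?U (k + M)" by auto
    have "v r * c = 0" for r
    proof (cases "r \<in> I")
      case True
      then show ?thesis using word_module_annihilated[OF fin van c(2), of M "[]" r] fin
        by (simp add: of_bool_def if_distrib[of "\<lambda>x. x * _"] cong: if_cong)
    next
      case False
      then show ?thesis using word_module_outside[OF c(2)] by auto
    qed
    then show ?thesis using c(1) by auto
  qed
  have col: "(\<lambda>r. if r \<in> I then mat_word I A u r s else 0) \<in> ?U N"
    using mat_word_column_in_word_module[OF fin rs(2), of A u] word_module_antimono[OF u, of I A]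
    by (auto simp: N_def)
  define w0 where "w0 = (\<lambda>r. if r \<in> I then mat_word I A u r s else 0)"
  have w0: "w0 \<in> ?U N" "w0 r \<noteq> 0" using col nz rs by (auto simp: w0_def)
  have "\<exists>v. v \<in> ?U k \<and> (\<forall>c. c \<noteq> 0 \<longrightarrow> (\<lambda>r. v r * c) \<notin> ?U (Suc k))" if "k < N" for k
  proof (rule ccontr)
    assume "\<not> ?thesis"
    then have "\<forall>v\<in>?U k. \<exists>c. c \<noteq> 0 \<and> (\<lambda>r. v r * c) \<in> ?U (Suc k)" by blast
    moreover have "w0 \<in> ?U k" using w0(1) that word_module_antimono[of k N I A] by auto
    ultimately have "w0 = (\<lambda>_. 0)" by (rule torsion)
    with w0(2) show False by simp
  qed
  then obtain w1 where w1: "\<And>k. k < N \<Longrightarrow> w1 k \<in> ?U k"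
      "\<And>k c. k < N \<Longrightarrow> c \<noteq> 0 \<Longrightarrow> (\<lambda>r. w1 k r * c) \<notin> ?U (Suc k)" by metis
  \<comment> \<open>the least index with nonzero coefficient in a relation among the \<open>w k\<close> contradicts their choice\<close>
  define w where "w k = (if k < N then w1 k else w0)" for k
  have wU: "w k \<in> ?U k" if "k \<le> N" for k
    using that w1(1) w0(1) by (cases "k = N") (auto simp: w_def)
  from dep[of w] obtain c where c: "\<exists>k\<le>N. c k \<noteq> 0" "\<And>r. r \<in> I \<Longrightarrow> (\<Sum>k\<le>N. w k r * c k) = 0"
    by (auto simp: N_def)
  define j where "j = (LEAST k. k \<le> N \<and> c k \<noteq> 0)"
  have j: "j \<le> N" "c j \<noteq> 0" using LeastI_ex[of "\<lambda>k. k \<le> N \<and> c k \<noteq> 0"] c(1) by (auto simp: j_def)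
  have least: "c k = 0" if "k < j" for k
    using not_less_Least[of k "\<lambda>k. k \<le> N \<and> c k \<noteq> 0"] that j by (auto simp: j_def)
  have rel: "w j r * c j = (\<Sum>k\<in>{Suc j..N}. w k r * (- c k))" for r
  proof (cases "r \<in> I")
    case True
    have "0 = (\<Sum>k\<le>N. w k r * c k)" using c(2) True by simp
    also have "\<dots> = (\<Sum>k\<in>{j..N}. w k r * c k)"
      by (rule sum.mono_neutral_right) (auto simp: least)
    also have "\<dots> = w j r * c j + (\<Sum>k\<in>{Suc j..N}. w k r * c k)"
      using j(1) by (simp add: sum.atLeast_Suc_atMost)
    finally show ?thesis by (simp add: sum_negf eq_neg_iff_add_eq_0)
  next
    case False
    then show ?thesis using word_module_outside[OF wU] j(1) by (simp add: sum.neutral)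
  qed
  have mem: "(\<lambda>r. w j r * c j) \<in> ?U (Suc j)"
    unfolding rel
  proof (rule word_module_sum)
    fix k assume k: "k \<in> {Suc j..N}"
    then have "w k \<in> ?U (Suc j)" using wU[of k] word_module_antimono[of "Suc j" k I A] by auto
    then show "(\<lambda>r. w k r * - c k) \<in> ?U (Suc j)" by (rule word_module_scale)
  qed simp
  show False
  proof (cases "j < N")
    case True
    then show ?thesis using w1(2)[OF True j(2)] mem by (simp add: w_def)
  next
    case False
    then have "w0 r * c j = 0" using rel[of r] j(1) by (simp add: w_def)
    with w0(2) j(2) show False by simp
  qed
qed

section \<open>Skew polynomials with rotating coefficients\<close>

text \<open>A model of polynomial functions of arbitrarily many variables: it suffices to know that a function is polynomial along every
complex line. This makes the absence of zero divisors a statement about polynomials in one variable, and identities can be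
checked at points.\<close>
typedef 'x line_poly = "{F :: ('x \<Rightarrow> complex) \<Rightarrow> complex.
    \<forall>a b. \<exists>P. \<forall>t. F (\<lambda>x. a x + t * b x) = poly P t}"
  morphisms line_eval Line_poly
  by (intro exI[of _ "\<lambda>_. 0"]) (auto intro: exI[of _ 0])

setup_lifting type_definition_line_poly

instantiation line_poly :: (type) comm_ring_1
begin

lift_definition zero_line_poly :: "'x line_poly" is "\<lambda>_. 0"
  by (auto intro: exI[of _ 0])

lift_definition one_line_poly :: "'x line_poly" is "\<lambda>_. 1"
  by (auto intro: exI[of _ 1])

lift_definition plus_line_poly :: "'x line_poly \<Rightarrow> 'x line_poly \<Rightarrow> 'x line_poly"
  is "\<lambda>F G v. F v + G v"
  by (metis poly_add)

lift_definition minus_line_poly :: "'x line_poly \<Rightarrow> 'x line_poly \<Rightarrow> 'x line_poly"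
  is "\<lambda>F G v. F v - G v"
  by (metis poly_diff)

lift_definition uminus_line_poly :: "'x line_poly \<Rightarrow> 'x line_poly"
  is "\<lambda>F v. - F v"
  by (metis poly_minus)

lift_definition times_line_poly :: "'x line_poly \<Rightarrow> 'x line_poly \<Rightarrow> 'x line_poly"
  is "\<lambda>F G v. F v * G v"
  by (metis poly_mult)

instance
  by standard (transfer; simp add: algebra_simps fun_eq_iff)+

end

instance line_poly :: (type) idom
proof
  fix F G :: "'a line_poly"
  assume "F \<noteq> 0" "G \<noteq> 0"
  then show "F * G \<noteq> 0"
  proof transfer
    fix F G :: "('a \<Rightarrow> complex) \<Rightarrow> complex"
    assume F: "\<forall>a b. \<exists>P. \<forall>t. F (\<lambda>x. a x + t * b x) = poly P t" "F \<noteq> (\<lambda>_. 0)"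
      and G: "\<forall>a b. \<exists>P. \<forall>t. G (\<lambda>x. a x + t * b x) = poly P t" "G \<noteq> (\<lambda>_. 0)"
    then obtain a c where ac: "F a \<noteq> 0" "G c \<noteq> 0" by (metis ext)
    obtain P where P: "\<And>t. F (\<lambda>x. a x + t * (c x - a x)) = poly P t" using F(1)[rule_format, of a "\<lambda>x. c x - a x"] by auto
    obtain Q where Q: "\<And>t. G (\<lambda>x. a x + t * (c x - a x)) = poly Q t" using G(1)[rule_format, of a "\<lambda>x. c x - a x"] by auto
    have "poly P 0 \<noteq> 0" "poly Q 1 \<noteq> 0" using ac P[of 0] Q[of 1] by auto
    then have "P * Q \<noteq> 0" by auto
    then obtain t where "poly (P * Q) t \<noteq> 0" using poly_eq_poly_eq_iff[of "P * Q" 0] by (auto simp: fun_eq_iff)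
    then have "F (\<lambda>x. a x + t * (c x - a x)) * G (\<lambda>x. a x + t * (c x - a x)) \<noteq> 0" by (simp add: P Q)
    then show "(\<lambda>v. F v * G v) \<noteq> (\<lambda>_. 0)" by metis
  qed
qed

lemma line_eval_sum: "line_eval (\<Sum>k\<in>K. f k) v = (\<Sum>k\<in>K. line_eval (f k) v)"
  by (induction K rule: infinite_finite_induct) (auto simp: zero_line_poly.rep_eq plus_line_poly.rep_eq)

lift_definition line_const :: "complex \<Rightarrow> 'x line_poly" is "\<lambda>c _. c"
  by (metis poly_const_conv)

lemma linear_is_poly: "\<exists>P. \<forall>t. a + t * b = poly P (t :: complex)"
  by (intro exI[of _ "[:a, b:]"]) auto

lift_definition line_var :: "'x \<Rightarrow> 'x line_poly" is "\<lambda>x v. v x"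
  by (intro allI linear_is_poly)

text \<open>The variable \<open>(m, k, i)\<close> is the weight of the \<open>i\<close>-th cyclic shift of size \<open>m\<close> at position \<open>k\<close>. Keeping all sizes \<open>m\<close> in one
ring allows a single rotation automorphism, and hence a single type of skew polynomials, to serve for all sizes.\<close>
type_synonym 'g cyclic_var = "nat \<times> nat \<times> 'g"

text \<open>Positions \<open>k \<ge> m\<close> never occur; fixing them makes the rotation invertible.\<close>
definition rotate_var :: "'g cyclic_var \<Rightarrow> 'g cyclic_var" where
  "rotate_var = (\<lambda>(m, k, i). (m, if k < m then Suc k mod m else k, i))"

definition rotate_var_inv :: "'g cyclic_var \<Rightarrow> 'g cyclic_var" where
  "rotate_var_inv = (\<lambda>(m, k, i). (m, if k < m then (k + m - 1) mod m else k, i))"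

lemma rotate_var_inverse: "rotate_var_inv (rotate_var x) = x"
proof -
  obtain m k i where x: "x = (m, k, i)" by (cases x)
  show ?thesis
  proof (cases "k < m")
    case True
    then show ?thesis
    proof (cases "Suc k = m")
      case True
      then show ?thesis by (auto simp: x rotate_var_def rotate_var_inv_def)
    next
      case False
      then have "Suc k < m" using True by simp
      then show ?thesis by (auto simp: x rotate_var_def rotate_var_inv_def)
    qed
  qed (auto simp: x rotate_var_def rotate_var_inv_def)
qed

lift_definition rotation :: "'g cyclic_var line_poly \<Rightarrow> 'g cyclic_var line_poly"
  is "\<lambda>F v. F (v \<circ> rotate_var)"
  by (simp add: o_def)

lemma rotation_simps [simp]:
  "rotation 0 = 0" "rotation 1 = 1" "rotation (F + G) = rotation F + rotation G"
  "rotation (F * G) = rotation F * rotation G" "rotation (line_const c) = line_const c"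
  by (transfer; simp)+

lemma inj_rotation: "rotation F = 0 \<longleftrightarrow> F = 0"
proof transfer
  fix F :: "('g cyclic_var \<Rightarrow> complex) \<Rightarrow> complex"
  have "F v = F ((v \<circ> rotate_var_inv) \<circ> rotate_var)" for v
    by (simp add: o_def rotate_var_inverse)
  then show "((\<lambda>v. F (v \<circ> rotate_var)) = (\<lambda>_. 0)) = (F = (\<lambda>_. 0))" by (auto simp: fun_eq_iff)
qed

lemma funpow_rotation_simps [simp]:
  "(rotation ^^ n) 0 = 0" "(rotation ^^ n) 1 = 1" "(rotation ^^ n) (F + G) = (rotation ^^ n) F + (rotation ^^ n) G"
  "(rotation ^^ n) (F * G) = (rotation ^^ n) F * (rotation ^^ n) G" "(rotation ^^ n) (line_const c) = line_const c"
  "(rotation ^^ n) F = 0 \<longleftrightarrow> F = 0"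
  by (induction n arbitrary: F G) (simp_all add: inj_rotation)

lemma funpow_rotation_sum: "(rotation ^^ n) (\<Sum>k\<in>K. f k) = (\<Sum>k\<in>K. (rotation ^^ n) (f k))"
  by (induction K rule: infinite_finite_induct) auto

lemma funpow_rotation_eval: "line_eval ((rotation ^^ n) F) v = line_eval F (v \<circ> (rotate_var ^^ n))"
proof (induction n arbitrary: v)
  case (Suc n)
  show ?case using Suc by (simp add: rotation.rep_eq o_def funpow_swap1[of rotate_var])
qed simp

lemma funpow_rotate_var: "0 < m \<Longrightarrow> (rotate_var ^^ n) (m, 0, i) = (m, n mod m, i)"
proof (induction n)
  case (Suc n)
  then show ?case by (simp add: rotate_var_def mod_Suc_eq)
qed simp

text \<open>Skew polynomials \<open>\<Sum>t^n f n\<close> with coefficients on the right and the rule \<open>f t = t \<sigma>(f)\<close>, where \<open>\<sigma>\<close> is the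
rotation of the variables.\<close>
typedef 'g skew_poly = "{f :: nat \<Rightarrow> 'g cyclic_var line_poly. \<exists>n. \<forall>m>n. f m = 0}"
  morphisms skew_coeff Skew_poly
  by (intro exI[of _ "\<lambda>_. 0"]) auto

setup_lifting type_definition_skew_poly

lemma skew_poly_eqI: "(\<And>n. skew_coeff f n = skew_coeff g n) \<Longrightarrow> f = g"
  by (metis skew_coeff_inject ext)

lemma skew_convolution_assoc:
  fixes f g h :: "nat \<Rightarrow> 'g cyclic_var line_poly"
  shows "(\<Sum>k\<le>n. (rotation ^^ k) (\<Sum>j\<le>n-k. (rotation ^^ j) (f (n - k - j)) * g j) * h k) =
         (\<Sum>l\<le>n. (rotation ^^ l) (f (n - l)) * (\<Sum>k\<le>l. (rotation ^^ k) (g (l - k)) * h k))"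
proof -
  have "(\<Sum>k\<le>n. (rotation ^^ k) (\<Sum>j\<le>n-k. (rotation ^^ j) (f (n - k - j)) * g j) * h k) =
     (\<Sum>k\<le>n. \<Sum>j\<le>n-k. (rotation ^^ (k + j)) (f (n - k - j)) * ((rotation ^^ k) (g j) * h k))"
    by (simp add: funpow_rotation_sum sum_distrib_right funpow_add mult.assoc)
  also have "\<dots> = (\<Sum>(k, j)\<in>Sigma {..n} (\<lambda>k. {..n-k}). (rotation ^^ (k + j)) (f (n - k - j)) * ((rotation ^^ k) (g j) * h k))"
    by (rule sum.Sigma) auto
  also have "\<dots> = (\<Sum>(l, k)\<in>Sigma {..n} (\<lambda>l. {..l}). (rotation ^^ l) (f (n - l)) * ((rotation ^^ k) (g (l - k)) * h k))"
    by (rule sum.reindex_bij_witness[where i = "\<lambda>(l, k). (k, l - k)" and j = "\<lambda>(k, j). (k + j, k)"]) auto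
  also have "\<dots> = (\<Sum>l\<le>n. \<Sum>k\<le>l. (rotation ^^ l) (f (n - l)) * ((rotation ^^ k) (g (l - k)) * h k))"
    by (rule sum.Sigma[symmetric]) auto
  finally show ?thesis by (simp add: sum_distrib_left)
qed

lemma skew_convolution_finite:
  fixes f g :: "nat \<Rightarrow> 'g cyclic_var line_poly"
  assumes "\<exists>n. \<forall>m>n. f m = 0" "\<exists>n. \<forall>m>n. g m = 0"
  shows "\<exists>n. \<forall>m>n. (\<Sum>k\<le>m. (rotation ^^ k) (f (m - k)) * g k) = 0"
proof -
  obtain a b where ab: "\<forall>m>a. f m = 0" "\<forall>m>b. g m = 0" using assms by auto
  have "(\<Sum>k\<le>m. (rotation ^^ k) (f (m - k)) * g k) = 0" if "m > a + b" for m
  proof (rule sum.neutral, rule ballI)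
    fix k assume "k \<in> {..m}"
    show "(rotation ^^ k) (f (m - k)) * g k = 0"
    proof (cases "k > b")
      case False
      then have "m - k > a" using that by simp
      then show ?thesis using ab by simp
    qed (use ab in simp)
  qed
  then show ?thesis by blast
qed

instantiation skew_poly :: (type) ring_1
begin

lift_definition zero_skew_poly :: "'g skew_poly" is "\<lambda>_. 0" by auto

lift_definition one_skew_poly :: "'g skew_poly" is "\<lambda>n. of_bool (n = 0)"
  by (intro exI[of _ 0]) auto

lift_definition plus_skew_poly :: "'g skew_poly \<Rightarrow> 'g skew_poly \<Rightarrow> 'g skew_poly"
  is "\<lambda>f g n. f n + g n"
  by (metis add.right_neutral max_less_iff_conj)

lift_definition minus_skew_poly :: "'g skew_poly \<Rightarrow> 'g skew_poly \<Rightarrow> 'g skew_poly"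
  is "\<lambda>f g n. f n - g n"
  by (metis diff_zero max_less_iff_conj)

lift_definition uminus_skew_poly :: "'g skew_poly \<Rightarrow> 'g skew_poly"
  is "\<lambda>f n. - f n" by auto

lift_definition times_skew_poly :: "'g skew_poly \<Rightarrow> 'g skew_poly \<Rightarrow> 'g skew_poly"
  is "\<lambda>f g n. \<Sum>k\<le>n. (rotation ^^ k) (f (n - k)) * g k"
  by (rule skew_convolution_finite)

instance
proof
  fix f g h :: "'a skew_poly"
  show "f * g * h = f * (g * h)"
    by (rule skew_poly_eqI) (simp only: times_skew_poly.rep_eq skew_convolution_assoc)
  show "1 * f = f"
  proof (rule skew_poly_eqI)
    fix n
    have "skew_coeff (1 * f) n = (\<Sum>k\<le>n. if k = n then skew_coeff f n else 0)"
      unfolding times_skew_poly.rep_eq one_skew_poly.rep_eq by (intro sum.cong refl) auto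
    then show "skew_coeff (1 * f) n = skew_coeff f n" by simp
  qed
  show "f * 1 = f"
  proof (rule skew_poly_eqI)
    fix n
    have "skew_coeff (f * 1) n = (\<Sum>k\<le>n. if k = 0 then skew_coeff f n else 0)"
      unfolding times_skew_poly.rep_eq one_skew_poly.rep_eq by (intro sum.cong refl) auto
    then show "skew_coeff (f * 1) n = skew_coeff f n" by simp
  qed
  show "(f + g) * h = f * h + g * h" "f * (g + h) = f * g + f * h"
    by (rule skew_poly_eqI; simp add: times_skew_poly.rep_eq plus_skew_poly.rep_eq sum.distrib distrib_left distrib_right)+
  show "f + g + h = f + (g + h)" "f + g = g + f" "0 + f = f" "- f + f = 0" "f - g = f + - g"
    by (transfer; simp add: fun_eq_iff)+
  show "(0 :: 'a skew_poly) \<noteq> 1" by transfer (auto simp: fun_eq_iff intro!: exI[of _ 0])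
qed

end

lemma skew_coeff_bounded: "\<exists>n. \<forall>m>n. skew_coeff f m = 0"
  using skew_coeff[of f] by simp

lemma skew_top_coeff:
  assumes "f \<noteq> 0"
  obtains n where "skew_coeff f n \<noteq> 0" "\<And>m. m > n \<Longrightarrow> skew_coeff f m = 0"
proof -
  have "\<exists>n. skew_coeff f n \<noteq> 0"
  proof (rule ccontr)
    assume "\<not> ?thesis"
    then have "f = 0" by (intro skew_poly_eqI) (simp add: zero_skew_poly.rep_eq)
    with assms show False by simp
  qed
  moreover obtain b where b: "\<forall>m>b. skew_coeff f m = 0" using skew_coeff_bounded by blast
  then have "\<forall>m. skew_coeff f m \<noteq> 0 \<longrightarrow> m \<le> b" by (meson not_le)
  ultimately have "\<exists>n. skew_coeff f n \<noteq> 0 \<and> (\<forall>m. skew_coeff f m \<noteq> 0 \<longrightarrow> m \<le> n)"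
    using Nat.ex_has_greatest_nat[of "\<lambda>n. skew_coeff f n \<noteq> 0"] by blast
  then show ?thesis using that by (metis not_le)
qed

instance skew_poly :: (type) ring_1_no_zero_divisors
proof
  fix f g :: "'a skew_poly"
  assume "f \<noteq> 0" "g \<noteq> 0"
  obtain a where a: "skew_coeff f a \<noteq> 0" "\<And>m. m > a \<Longrightarrow> skew_coeff f m = 0" using skew_top_coeff[OF \<open>f \<noteq> 0\<close>] by blast
  obtain b where b: "skew_coeff g b \<noteq> 0" "\<And>m. m > b \<Longrightarrow> skew_coeff g m = 0" using skew_top_coeff[OF \<open>g \<noteq> 0\<close>] by blast
  have "skew_coeff (f * g) (a + b) = (\<Sum>k\<le>a + b. if k = b then (rotation ^^ b) (skew_coeff f a) * skew_coeff g b else 0)"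
    unfolding times_skew_poly.rep_eq
  proof (intro sum.cong refl)
    fix k assume "k \<in> {..a + b}"
    then have "k > b \<or> k = b \<or> a + b - k > a" by auto
    then show "(rotation ^^ k) (skew_coeff f (a + b - k)) * skew_coeff g k =
        (if k = b then (rotation ^^ b) (skew_coeff f a) * skew_coeff g b else 0)"
      using a(2) b(2) by auto
  qed
  then have "skew_coeff (f * g) (a + b) \<noteq> 0" using a(1) b(1) by simp
  then show "f * g \<noteq> 0" by (auto simp: zero_skew_poly.rep_eq)
qed

lemma skew_coeff_sum: "skew_coeff (\<Sum>k\<in>K. f k) n = (\<Sum>k\<in>K. skew_coeff (f k) n)"
  by (induction K rule: infinite_finite_induct) (auto simp: zero_skew_poly.rep_eq plus_skew_poly.rep_eq)

text \<open>Multiplication from the right by unknown skew polynomials of degree less than \<open>n\<close> leads to linear equations over the commutative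
coefficient ring. With entries of degree at most \<open>e\<close> and \<open>N = card I\<close> there are \<open>N (e + n)\<close> equations in \<open>(N + 1) n\<close> unknowns,
so \<open>n = N e + 1\<close> suffices.\<close>
theorem skew_poly_right_dependent:
  fixes w :: "nat \<Rightarrow> 'i \<Rightarrow> 'g skew_poly"
  assumes "finite I"
  shows "\<exists>c. (\<exists>k\<le>card I. c k \<noteq> 0) \<and> (\<forall>r\<in>I. (\<Sum>k\<le>card I. w k r * c k) = 0)"
proof -
  define N where "N = card I"
  have "\<forall>k r. \<exists>b. \<forall>m>b. skew_coeff (w k r) m = 0" using skew_coeff_bounded by blast
  then obtain b where b: "\<And>k r m. m > b k r \<Longrightarrow> skew_coeff (w k r) m = 0" by metis
  define e where "e = (\<Sum>k\<le>N. \<Sum>r\<in>I. b k r)"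
  have be: "b k r \<le> e" if "k \<le> N" "r \<in> I" for k r
  proof -
    have "b k r \<le> (\<Sum>r\<in>I. b k r)" using assms that(2) by (simp add: member_le_sum)
    also have "\<dots> \<le> e" unfolding e_def using that(1) by (intro member_le_sum) auto
    finally show ?thesis .
  qed
  have high: "skew_coeff (w k r) m = 0" if "m > e" "k \<le> N" "r \<in> I" for k r m
    using b[of k r m] be[of k r] that by auto
  \<comment> \<open>degree bound for the unknown coefficients, large enough for more unknowns than equations\<close>
  define n where "n = N * e + 1"
  define E where "E = I \<times> {..<e + n}"
  define U where "U = {..N} \<times> {..<n}"
  have "card E < card U"
    using assms by (simp add: E_def U_def card_cartesian_product N_def n_def algebra_simps)
  moreover have "finite E" "finite U" using assms by (auto simp: E_def U_def)
  ultimately obtain x where x0: "\<exists>u\<in>U. x u \<noteq> 0"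
    "\<forall>e\<in>E. (\<Sum>u\<in>U. (case e of (r, l) \<Rightarrow> \<lambda>(k, j). if j \<le> l then (rotation ^^ j) (skew_coeff (w k r) (l - j)) else 0) u * x u) = 0"
    using homogeneous_system_nontrivial[of E U "\<lambda>(r, l) (k, j). if j \<le> l then (rotation ^^ j) (skew_coeff (w k r) (l - j)) else 0"]
    by blast
  have x: "(\<Sum>u\<in>U. (case u of (k, j) \<Rightarrow> if j \<le> l then (rotation ^^ j) (skew_coeff (w k r) (l - j)) else 0) * x u) = 0"
    if "r \<in> I" "l < e + n" for r l
    using x0(2)[rule_format, of "(r, l)"] that by (simp add: E_def)
  define c where "c k = Skew_poly (\<lambda>j. if j < n then x (k, j) else 0)" for k
  have c: "skew_coeff (c k) j = (if j < n then x (k, j) else 0)" for k j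
    unfolding c_def by (subst Skew_poly_inverse) (auto intro!: exI[of _ n])
  have "(\<Sum>k\<le>N. w k r * c k) = 0" if r: "r \<in> I" for r
  proof (rule skew_poly_eqI)
    fix l
    have eq: "skew_coeff (\<Sum>k\<le>N. w k r * c k) l = (\<Sum>k\<le>N. \<Sum>j\<le>l. (rotation ^^ j) (skew_coeff (w k r) (l - j)) * skew_coeff (c k) j)"
      by (simp add: skew_coeff_sum times_skew_poly.rep_eq)
    show "skew_coeff (\<Sum>k\<le>N. w k r * c k) l = skew_coeff 0 l"
    proof (cases "l < e + n")
      case True
      have "(\<Sum>j\<le>l. (rotation ^^ j) (skew_coeff (w k r) (l - j)) * skew_coeff (c k) j) =
        (\<Sum>j<n. (if j \<le> l then (rotation ^^ j) (skew_coeff (w k r) (l - j)) else 0) * x (k, j))" for k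
      proof -
        have "(\<Sum>j\<le>l. (rotation ^^ j) (skew_coeff (w k r) (l - j)) * skew_coeff (c k) j) =
          (\<Sum>j\<in>{..l} \<inter> {..<n}. (rotation ^^ j) (skew_coeff (w k r) (l - j)) * x (k, j))"
          by (rule sum.mono_neutral_cong_right) (auto simp: c)
        also have "\<dots> = (\<Sum>j<n. (if j \<le> l then (rotation ^^ j) (skew_coeff (w k r) (l - j)) else 0) * x (k, j))"
          by (rule sum.mono_neutral_cong_left) auto
        finally show ?thesis .
      qed
      then have "skew_coeff (\<Sum>k\<le>N. w k r * c k) l =
         (\<Sum>(k, j)\<in>U. (if j \<le> l then (rotation ^^ j) (skew_coeff (w k r) (l - j)) else 0) * x (k, j))"
        unfolding eq U_def by (simp add: sum.cartesian_product)
      also have "\<dots> = 0" using x[OF r True] by (simp add: case_prod_beta)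
      finally show ?thesis by (simp add: zero_skew_poly.rep_eq)
    next
      case False
      have "(rotation ^^ j) (skew_coeff (w k r) (l - j)) * skew_coeff (c k) j = 0" if "k \<le> N" for k j
      proof (cases "j < n")
        case True
        then have "l - j > e" using False by simp
        then show ?thesis using high[of "l - j" k r] that r by simp
      qed (simp add: c)
      then show ?thesis unfolding eq by (auto simp: zero_skew_poly.rep_eq intro!: sum.neutral)
    qed
  qed
  moreover have "\<exists>k\<le>N. c k \<noteq> 0"
  proof -
    from x0(1) obtain k j where "k \<le> N" "j < n" "x (k, j) \<noteq> 0" by (auto simp: U_def)
    then have "skew_coeff (c k) j \<noteq> 0" by (simp add: c)
    then show ?thesis using \<open>k \<le> N\<close> by (auto simp: zero_skew_poly.rep_eq intro!: exI[of _ k])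
  qed
  ultimately show ?thesis unfolding N_def by blast
qed

text \<open>Two elements of the ring itself are dependent by the case of rank one.\<close>
lemma skew_poly_right_Ore:
  fixes a b :: "'g skew_poly"
  assumes "a \<noteq> 0" "b \<noteq> 0"
  shows "\<exists>a' b'. a' \<noteq> 0 \<and> b' \<noteq> 0 \<and> a * a' = b * b'"
proof -
  have "\<exists>c. (\<exists>k\<le>card {()}. c k \<noteq> 0) \<and> (\<forall>r\<in>{()}. (\<Sum>k\<le>card {()}. (if k = (0::nat) then a else b) * c k) = 0)"
    by (rule skew_poly_right_dependent) simp
  then obtain c :: "nat \<Rightarrow> 'g skew_poly" where c: "\<exists>k\<le>1. c k \<noteq> 0" "a * c 0 + b * c 1 = 0"
    by auto
  then have eq: "a * c 0 = b * (- c 1)"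
    by (simp add: eq_neg_iff_add_eq_0)
  from c(1) obtain k where "k \<le> 1" "c k \<noteq> 0" by blast
  then have "c 0 \<noteq> 0 \<or> c 1 \<noteq> 0" by (cases k) auto
  then have "c 0 \<noteq> 0 \<and> c 1 \<noteq> 0" using eq assms by (metis mult_eq_0_iff neg_equal_0_iff_equal)
  then show ?thesis using eq by (intro exI[of _ "c 0"] exI[of _ "- c 1"]) auto
qed

section \<open>Linear extension and evaluation at matrices\<close>

lemma poly_mapping_sum_singles:
  fixes f :: "'m \<Rightarrow>\<^sub>0 complex"
  shows "f = (\<Sum>k\<in>keys f. single k (lookup f k))"
  by (rule poly_mapping_eqI) (auto simp: lookup_sum lookup_single when_def in_keys_iff)

lemma poly_mapping_additive_induct [case_names single add]:
  fixes f :: "'m \<Rightarrow>\<^sub>0 complex"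
  assumes "\<And>k c. P (single k c)" "\<And>f g. P f \<Longrightarrow> P g \<Longrightarrow> P (f + g)"
  shows "P f"
proof -
  have "P (\<Sum>k\<in>K. single k (lookup f k))" if "finite K" for K
    using that
  proof (induction K rule: finite_induct)
    case empty
    then show ?case using assms(1)[of undefined 0] by simp
  qed (use assms in auto)
  then show ?thesis by (subst poly_mapping_sum_singles) simp
qed

text \<open>The linear extension of \<open>T\<close> from basis elements to all finitely supported coefficient functions; substitution, evaluation and
differentiation are all of this form.\<close>
definition lin_ext :: "(complex \<Rightarrow> 'v \<Rightarrow> 'v) \<Rightarrow> ('m \<Rightarrow> 'v) \<Rightarrow> ('m \<Rightarrow>\<^sub>0 complex) \<Rightarrow> 'v::ab_group_add" where
  "lin_ext sc T f = (\<Sum>k\<in>keys f. sc (lookup f k) (T k))"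

lemma lin_ext_superset:
  assumes "Modules.module sc" "finite K" "keys f \<subseteq> K"
  shows "lin_ext sc T f = (\<Sum>k\<in>K. sc (lookup f k) (T k))"
proof -
  interpret Modules.module sc by fact
  show ?thesis unfolding lin_ext_def
    using assms(2,3) by (intro sum.mono_neutral_left) (auto simp: in_keys_iff)
qed

lemma lin_ext_add:
  assumes "Modules.module sc"
  shows "lin_ext sc T (f + g) = lin_ext sc T f + lin_ext sc T g"
proof -
  interpret Modules.module sc by fact
  let ?K = "keys f \<union> keys g"
  have "lin_ext sc T h = (\<Sum>k\<in>?K. sc (lookup h k) (T k))" if "keys h \<subseteq> ?K" for h
    using that by (intro lin_ext_superset assms) auto
  then show ?thesis
    using keys_add[of f g] by (simp add: lookup_add scale_left_distrib sum.distrib)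
qed

lemma lin_ext_single:
  assumes "Modules.module sc"
  shows "lin_ext sc T (single k c) = sc c (T k)"
proof -
  interpret Modules.module sc by fact
  show ?thesis by (cases "c = 0") (auto simp: lin_ext_def)
qed

lemma lin_ext_zero: "lin_ext sc T 0 = 0"
  by (simp add: lin_ext_def)

lemma lin_ext_uminus:
  assumes "Modules.module sc"
  shows "lin_ext sc T (- f) = - lin_ext sc T f"
  using lin_ext_add[OF assms, of T "- f" f] by (simp add: lin_ext_zero eq_neg_iff_add_eq_0)

lemma lin_ext_diff:
  assumes "Modules.module sc"
  shows "lin_ext sc T (f - g) = lin_ext sc T f - lin_ext sc T g"
  using lin_ext_add[OF assms, of T "f" "- g"] by (simp add: lin_ext_uminus assms)

lemma lin_ext_sum:
  assumes "Modules.module sc"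
  shows "lin_ext sc T (\<Sum>x\<in>X. f x) = (\<Sum>x\<in>X. lin_ext sc T (f x))"
  by (induction X rule: infinite_finite_induct) (auto simp: lin_ext_zero lin_ext_add assms)

text \<open>The scalar multiplication is a parameter, so that numbers, polynomials, free polynomials and skew polynomials can all serve as
targets of linear extensions.\<close>
locale scalar_algebra = Modules.module sc for sc :: "complex \<Rightarrow> 'r::ring_1 \<Rightarrow> 'r" +
  assumes scale_mult_left: "sc c a * b = sc c (a * b)"
    and scale_mult_right: "a * sc c b = sc c (a * b)"
begin

lemma is_module: "Modules.module sc" ..

lemma lin_ext_mult:
  fixes T :: "'m::monoid_add \<Rightarrow> 'r"
  assumes "\<And>k l. T (k + l) = T k * T l"
  shows "lin_ext sc T (f * g) = lin_ext sc T f * lin_ext sc T g"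
proof (induction f rule: poly_mapping_additive_induct)
  case (single k c)
  show ?case
  proof (induction g rule: poly_mapping_additive_induct)
    case (single l d)
    then show ?case
      by (simp add: mult_single lin_ext_single is_module assms scale_mult_left scale_mult_right mult.commute)
  next
    case (add g h)
    then show ?case by (simp add: distrib_left lin_ext_add is_module)
  qed
next
  case (add f h)
  then show ?case by (simp add: distrib_right lin_ext_add is_module)
qed

end

lemma scalar_algebra_complex: "scalar_algebra ((*) :: complex \<Rightarrow> complex \<Rightarrow> complex)"
  by unfold_locales (auto simp: algebra_simps)

lemma scalar_algebra_poly: "scalar_algebra (smult :: complex \<Rightarrow> complex poly \<Rightarrow> complex poly)"
  by unfold_locales (auto simp: smult_add_left smult_add_right)

definition pm_scale :: "complex \<Rightarrow> ('m::monoid_add \<Rightarrow>\<^sub>0 complex) \<Rightarrow> ('m \<Rightarrow>\<^sub>0 complex)" where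
  "pm_scale c f = single 0 c * f"

lemma lookup_pm_scale [simp]: "lookup (pm_scale c f) k = c * lookup f k"
  unfolding pm_scale_def mult_map_scale_conv_mult[symmetric] by (simp add: map.rep_eq when_def)

lemma scalar_algebra_pm_scale: "scalar_algebra (pm_scale :: complex \<Rightarrow> ('m::monoid_add \<Rightarrow>\<^sub>0 complex) \<Rightarrow> _)"
proof
  fix c d :: complex and f g :: "'m \<Rightarrow>\<^sub>0 complex"
  show "pm_scale c f * g = pm_scale c (f * g)" by (simp add: pm_scale_def mult.assoc)
  have "f * single 0 c = single 0 c * f"
    by (induction f rule: poly_mapping_additive_induct)
       (auto simp: mult_single distrib_left distrib_right mult.commute)
  then show "f * pm_scale c g = pm_scale c (f * g)" by (simp add: pm_scale_def mult.assoc[symmetric])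
qed (auto intro!: poly_mapping_eqI simp: lookup_add algebra_simps)

definition skew_const :: "complex \<Rightarrow> 'g skew_poly" where
  "skew_const c = Skew_poly (\<lambda>n. if n = 0 then line_const c else 0)"

lemma skew_coeff_const: "skew_coeff (skew_const c) n = (if n = 0 then line_const c else 0)"
  unfolding skew_const_def by (subst Skew_poly_inverse) auto

definition skew_scale :: "complex \<Rightarrow> 'g skew_poly \<Rightarrow> 'g skew_poly" where
  "skew_scale c f = skew_const c * f"

lemma skew_coeff_scale [simp]: "skew_coeff (skew_scale c f) n = line_const c * skew_coeff f n"
proof -
  have "skew_coeff (skew_scale c f) n = (\<Sum>k\<le>n. if k = n then line_const c * skew_coeff f n else 0)"
    unfolding skew_scale_def times_skew_poly.rep_eq by (intro sum.cong refl) (auto simp: skew_coeff_const)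
  then show ?thesis by simp
qed

lemma line_const_simps: "line_const (a + b) = line_const a + line_const b"
  "line_const (a * b) = line_const a * line_const b" "line_const 1 = 1"
  by (transfer; simp)+

lemma scalar_algebra_skew: "scalar_algebra (skew_scale :: complex \<Rightarrow> 'g skew_poly \<Rightarrow> 'g skew_poly)"
proof
  fix c d :: complex and f g :: "'g skew_poly"
  show "skew_scale c f * g = skew_scale c (f * g)" by (simp add: skew_scale_def mult.assoc)
  show "f * skew_scale c g = skew_scale c (f * g)"
    by (rule skew_poly_eqI) (simp add: times_skew_poly.rep_eq sum_distrib_left mult_ac)
qed (auto intro!: skew_poly_eqI simp: plus_skew_poly.rep_eq line_const_simps algebra_simps)

text \<open>The value of a free polynomial at a tuple of matrices with entries in a commutative complex algebra; besides \<open>\<complex>\<close>, the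
polynomial ring \<open>\<complex>[t]\<close> will occur.\<close>
definition mat_eval :: "(complex \<Rightarrow> 'k \<Rightarrow> 'k) \<Rightarrow> 'q set \<Rightarrow> ('g \<Rightarrow> 'q \<Rightarrow> 'q \<Rightarrow> 'k::ring_1) \<Rightarrow> 'g free_poly \<Rightarrow> 'q \<Rightarrow> 'q \<Rightarrow> 'k" where
  "mat_eval sc Q Y f b b' = lin_ext sc (\<lambda>w. mat_word Q Y w b b') f"

context scalar_algebra
begin

lemma mat_eval_add: "mat_eval sc Q Y (f + g) b b' = mat_eval sc Q Y f b b' + mat_eval sc Q Y g b b'"
  by (simp add: mat_eval_def lin_ext_add is_module)

lemma mat_eval_sum: "mat_eval sc Q Y (\<Sum>x\<in>X. f x) b b' = (\<Sum>x\<in>X. mat_eval sc Q Y (f x) b b')"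
  by (simp add: mat_eval_def lin_ext_sum is_module)

lemma mat_eval_zero: "mat_eval sc Q Y 0 b b' = 0"
  by (simp add: mat_eval_def lin_ext_zero)

lemma mat_eval_single: "mat_eval sc Q Y (single w c) b b' = sc c (mat_word Q Y w b b')"
  by (simp add: mat_eval_def lin_ext_single is_module)

lemma mat_eval_one: "mat_eval sc Q Y 1 b b' = of_bool (b = b')"
  using mat_eval_single[of Q Y 0 1 b b'] by (simp only: single_one) (simp add: zero_list_def)

lemma mat_eval_mult:
  assumes "finite Q" "b \<in> Q"
  shows "mat_eval sc Q Y (f * g) b b' = (\<Sum>s\<in>Q. mat_eval sc Q Y f b s * mat_eval sc Q Y g s b')"
proof (induction f rule: poly_mapping_additive_induct)
  case (single k c)
  show ?case
  proof (induction g rule: poly_mapping_additive_induct)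
    case (single l d)
    then show ?case using assms
      by (simp add: mult_single mat_eval_single plus_list_def mat_word_append scale_mult_left scale_mult_right scale_sum_right mult.commute)
  next
    case (add g h)
    then show ?case by (simp add: distrib_left mat_eval_add sum.distrib)
  qed
next
  case (add f h)
  then show ?case by (simp add: distrib_right mat_eval_add sum.distrib)
qed

text \<open>Evaluating a matrix over the free algebra gives a block matrix, indexed by \<open>I \<times> Q\<close>.\<close>
lemma mat_eval_mat_word:
  assumes "finite I" "finite Q" "r \<in> I" "b \<in> Q" "s \<in> I" "b' \<in> Q"
  shows "mat_eval sc Q Y (mat_word I A u r s) b b' =
    mat_word (I \<times> Q) (\<lambda>i (r, b) (s, b'). mat_eval sc Q Y (A i r s) b b') u (r, b) (s, b')"
  using assms(3,4)
proof (induction u arbitrary: r b)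
  case Nil
  then show ?case by (auto simp: mat_eval_one mat_eval_zero)
next
  case (Cons i u)
  then show ?case using assms(1,2)
    by (simp add: mat_eval_sum mat_eval_mult sum.cartesian_product case_prod_beta)
qed

end

section \<open>Cyclic representations of the free algebra\<close>

text \<open>The cyclic representation sends the \<open>i\<close>-th indeterminate to \<open>t (m, 0, i)\<close>. A word of length \<open>n\<close> then becomes \<open>t^n\<close> times a
product of weights at consecutive positions modulo \<open>m\<close>, as for a product of weighted cyclic shifts of size \<open>m\<close>.\<close>
definition skew_letter :: "nat \<Rightarrow> 'g \<Rightarrow> 'g skew_poly" where
  "skew_letter m i = Skew_poly (\<lambda>n. if n = 1 then line_var (m, 0, i) else 0)"

lemma skew_coeff_letter: "skew_coeff (skew_letter m i) n = (if n = 1 then line_var (m, 0, i) else 0)"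
  unfolding skew_letter_def by (subst Skew_poly_inverse) (auto intro!: exI[of _ 1])

definition skew_word :: "nat \<Rightarrow> 'g list \<Rightarrow> 'g skew_poly" where
  "skew_word m w = prod_list (map (skew_letter m) w)"

definition cyclic_eval :: "nat \<Rightarrow> 'g free_poly \<Rightarrow> 'g skew_poly" where
  "cyclic_eval m = lin_ext skew_scale (skew_word m)"

primrec cyclic_weight :: "nat \<Rightarrow> ('g cyclic_var \<Rightarrow> complex) \<Rightarrow> 'g list \<Rightarrow> complex" where
  "cyclic_weight m v [] = 1"
| "cyclic_weight m v (i # w) = v (m, length w mod m, i) * cyclic_weight m v w"

lemma line_eval_skew_word:
  assumes "0 < m"
  shows "line_eval (skew_coeff (skew_word m w) n) v = (if n = length w then cyclic_weight m v w else 0)"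
proof (induction w arbitrary: n)
  case Nil
  then show ?case by (simp add: skew_word_def one_skew_poly.rep_eq one_line_poly.rep_eq zero_line_poly.rep_eq)
next
  case (Cons i w)
  show ?case
  proof (cases n)
    case 0
    then show ?thesis
      by (simp add: skew_word_def times_skew_poly.rep_eq skew_coeff_letter zero_line_poly.rep_eq)
  next
    case (Suc l)
    have "skew_coeff (skew_word m (i # w)) n =
      (\<Sum>k\<le>n. if k = l then (rotation ^^ l) (line_var (m, 0, i)) * skew_coeff (skew_word m w) l else 0)"
      unfolding skew_word_def times_skew_poly.rep_eq list.map prod_list.Cons using Suc
      by (intro sum.cong refl) (auto simp: skew_coeff_letter)
    also have "\<dots> = (rotation ^^ l) (line_var (m, 0, i)) * skew_coeff (skew_word m w) l"
      using Suc by simp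
    finally show ?thesis using Suc Cons.IH[of l] assms
      by (simp add: times_line_poly.rep_eq funpow_rotation_eval line_var.rep_eq funpow_rotate_var)
  qed
qed

lemma line_eval_cyclic_eval:
  assumes "0 < m"
  shows "line_eval (skew_coeff (cyclic_eval m f) n) v =
    (\<Sum>w\<in>keys f. if length w = n then lookup f w * cyclic_weight m v w else 0)"
  unfolding cyclic_eval_def lin_ext_def skew_coeff_sum line_eval_sum skew_coeff_scale
    times_line_poly.rep_eq line_eval_skew_word[OF assms]
  by (intro sum.cong refl) (auto simp: line_const.rep_eq)

lemma skew_poly_zeroI: "(\<And>n v. line_eval (skew_coeff f n) v = 0) \<Longrightarrow> f = 0"
  by (intro skew_poly_eqI) (auto simp: zero_skew_poly.rep_eq line_eval_inject[symmetric] zero_line_poly.rep_eq fun_eq_iff)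

lemma mat_word_cyclic_shift:
  assumes "0 < m" "b < m"
  shows "mat_word {..<m} (\<lambda>i b b'. if b = Suc b' mod m then t * v (m, b', i) else 0) w b 0 =
    (if b = length w mod m then t ^ length w * cyclic_weight m v w else 0)"
  using assms(2)
proof (induction w arbitrary: b)
  case (Cons i w)
  let ?l = "length w mod m"
  have "mat_word {..<m} (\<lambda>i b b'. if b = Suc b' mod m then t * v (m, b', i) else 0) (i # w) b 0 =
    (\<Sum>k<m. if k = ?l then (if b = Suc ?l mod m then t * v (m, ?l, i) else 0) * (t ^ length w * cyclic_weight m v w) else 0)"
    unfolding mat_word.simps using Cons.IH by (intro sum.cong refl) auto
  also have "\<dots> = (if b = Suc ?l mod m then t * v (m, ?l, i) else 0) * (t ^ length w * cyclic_weight m v w)"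
    using assms(1) by simp
  finally show ?case by (simp add: mod_Suc_eq)
qed auto

text \<open>Specializing the weights to numbers \<open>v\<close> and \<open>t\<close> to a number gives weighted cyclic shift matrices of size \<open>m\<close>. As a function of
\<open>t\<close> the sum of the entries in their zeroth column is a polynomial whose coefficients are the specialized coefficients of the skew
polynomial.\<close>
lemma cyclic_eval_eq_zeroI:
  assumes "0 < m" and van: "\<And>Y b b'. b < m \<Longrightarrow> b' < m \<Longrightarrow> mat_eval (*) {..<m} Y f b b' = 0"
  shows "cyclic_eval m f = 0"
proof (rule skew_poly_zeroI)
  fix n v
  define P where "P = (\<Sum>w\<in>keys f. monom (lookup f w * cyclic_weight m v w) (length w))"
  have "poly P t = 0" for t
  proof -
    define Y where "Y = (\<lambda>i b b'. if b = Suc b' mod m then t * v (m, b', i) else 0)"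
    have "0 = (\<Sum>b<m. mat_eval (*) {..<m} Y f b 0)" using van assms(1) by simp
    also have "\<dots> = (\<Sum>w\<in>keys f. \<Sum>b<m. lookup f w * mat_word {..<m} Y w b 0)"
      unfolding mat_eval_def lin_ext_def by (rule sum.swap)
    also have "\<dots> = (\<Sum>w\<in>keys f. \<Sum>b<m. if b = length w mod m then lookup f w * (t ^ length w * cyclic_weight m v w) else 0)"
      using assms(1) by (intro sum.cong refl) (auto simp: Y_def mat_word_cyclic_shift)
    also have "\<dots> = poly P t" using assms(1) by (simp add: P_def poly_sum poly_monom mult_ac)
    finally show ?thesis by simp
  qed
  then have "P = 0" using poly_all_0_iff_0 by blast
  then have "coeff P n = 0" by simp
  then show "line_eval (skew_coeff (cyclic_eval m f) n) v = 0"
    unfolding line_eval_cyclic_eval[OF assms(1)] P_def by (simp add: coeff_sum coeff_monom if_distrib cong: if_cong)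
qed

text \<open>At the weights that are \<open>1\<close> along the letters of \<open>w0\<close> and \<open>0\<close> elsewhere, the monomial of \<open>w0\<close> is the only one of its length that
survives, provided that \<open>w0\<close> does not wrap around the cycle.\<close>
lemma cyclic_weight_indicator:
  assumes "length w0 \<le> m" "length w \<le> length w0"
  shows "cyclic_weight m (\<lambda>(_, k, i). of_bool (k < length w0 \<and> i = w0 ! (length w0 - 1 - k))) w =
    of_bool (w = drop (length w0 - length w) w0)"
  using assms(2)
proof (induction w)
  case (Cons i w)
  let ?n = "length w0"
  have "drop (?n - Suc (length w)) w0 = w0 ! (?n - Suc (length w)) # drop (?n - length w) w0"
    using Cons.prems Cons_nth_drop_Suc[of "?n - Suc (length w)" w0] by (simp add: Suc_diff_Suc)
  moreover have "length w mod m = length w" using Cons.prems assms(1) by simp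
  ultimately show ?case using Cons by auto
qed simp

lemma cyclic_eval_faithful:
  assumes "0 < m" "\<And>w. w \<in> keys f \<Longrightarrow> length w \<le> m" "cyclic_eval m f = 0"
  shows "f = 0"
proof (rule ccontr)
  assume "f \<noteq> 0"
  then obtain w0 where w0: "w0 \<in> keys f" by (metis keys_eq_empty ex_in_conv)
  define v where "v = (\<lambda>(_ :: nat, k, i). of_bool (k < length w0 \<and> i = w0 ! (length w0 - 1 - k)) :: complex)"
  have "0 = line_eval (skew_coeff (cyclic_eval m f) (length w0)) v"
    using assms(3) by (simp add: zero_skew_poly.rep_eq zero_line_poly.rep_eq)
  also have "\<dots> = (\<Sum>w\<in>keys f. if w = w0 then lookup f w else 0)"
    unfolding line_eval_cyclic_eval[OF assms(1)]
    using cyclic_weight_indicator[OF assms(2)[OF w0]]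
    by (intro sum.cong refl) (auto simp: v_def)
  also have "\<dots> = lookup f w0" using w0 by simp
  finally show False using w0 by (simp add: in_keys_iff)
qed

lemma cyclic_eval_mat_word:
  fixes A :: "'g \<Rightarrow> 'i \<Rightarrow> 'i \<Rightarrow> 'g free_poly"
  shows "cyclic_eval m (mat_word I A u r s) = mat_word I (\<lambda>i r s. cyclic_eval m (A i r s)) u r s"
proof -
  interpret scalar_algebra "skew_scale :: complex \<Rightarrow> 'g skew_poly \<Rightarrow> _" by (rule scalar_algebra_skew)
  have mult: "cyclic_eval m (f * g) = cyclic_eval m f * cyclic_eval m g" for f g :: "'g free_poly"
    unfolding cyclic_eval_def by (rule lin_ext_mult) (simp add: skew_word_def plus_list_def)
  have sum: "cyclic_eval m (\<Sum>x\<in>X. f x) = (\<Sum>x\<in>X. cyclic_eval m (f x))" for X :: "'i set" and f :: "'i \<Rightarrow> 'g free_poly"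
    by (simp add: cyclic_eval_def lin_ext_sum is_module)
  have one: "cyclic_eval m (1 :: 'g free_poly) = 1"
    using lin_ext_single[OF is_module, of "skew_word m" 0 1]
    by (simp only: single_one) (simp add: cyclic_eval_def skew_word_def zero_list_def)
  show ?thesis
    by (induction u arbitrary: r) (auto simp: sum mult one, simp add: cyclic_eval_def lin_ext_zero)
qed

text \<open>The bound \<open>card I\<close> does not depend on the sizes of the matrices at which the words are known to vanish. This uniformity is the
reason for passing to the skew polynomial ring: matrices of size \<open>m\<close> alone only give the bound \<open>m (card I)\<close>.\<close>
theorem free_matrix_nil_index:
  fixes A :: "'g::finite \<Rightarrow> 'i \<Rightarrow> 'i \<Rightarrow> 'g free_poly"
    and M :: "nat \<Rightarrow> nat"
  assumes fin: "finite I"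
    and van: "\<And>m Y u r s b b'. 0 < m \<Longrightarrow> M m \<le> length u \<Longrightarrow> r \<in> I \<Longrightarrow> s \<in> I \<Longrightarrow> b < m \<Longrightarrow> b' < m \<Longrightarrow>
       mat_eval (*) {..<m} Y (mat_word I A u r s) b b' = 0"
    and u: "card I \<le> length u" "r \<in> I" "s \<in> I"
  shows "mat_word I A u r s = 0"
proof -
  define m where "m = Suc (\<Sum>w\<in>keys (mat_word I A u r s). length w)"
  have m: "0 < m" by (simp add: m_def)
  have "mat_word I (\<lambda>i r s. cyclic_eval m (A i r s)) u r s = 0"
  proof (rule nil_matrix_semigroup_index[OF fin skew_poly_right_Ore skew_poly_right_dependent[OF fin] _ u])
    fix u' :: "'g list" and r' s' assume "M m \<le> length u'" "r' \<in> I" "s' \<in> I"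
    then have "cyclic_eval m (mat_word I A u' r' s') = 0"
      by (intro cyclic_eval_eq_zeroI m van)
    then show "mat_word I (\<lambda>i r s. cyclic_eval m (A i r s)) u' r' s' = 0"
      by (simp add: cyclic_eval_mat_word)
  qed
  then have "cyclic_eval m (mat_word I A u r s) = 0" by (simp add: cyclic_eval_mat_word)
  moreover have "length w \<le> m" if "w \<in> keys (mat_word I A u r s)" for w
    using member_le_sum[OF that, of length] by (simp add: m_def)
  ultimately show ?thesis using cyclic_eval_faithful[OF m] by blast
qed

section \<open>Completely positive maps without nonzero eigenvalues\<close>

text \<open>A linear operator on functions supported on the finite set \<open>E\<close> for which no nonzero number is an eigenvalue.\<close>
locale injective_off_zero =
  fixes E :: "'x set" and \<Phi> :: "('x \<Rightarrow> complex) \<Rightarrow> 'x \<Rightarrow> complex"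
  assumes finite_support: "finite E"
    and outside: "x \<notin> E \<Longrightarrow> \<Phi> f x = 0"
    and additive: "\<Phi> (\<lambda>x. f x + g x) = (\<lambda>x. \<Phi> f x + \<Phi> g x)"
    and homogeneous: "\<Phi> (\<lambda>x. c * f x) = (\<lambda>x. c * \<Phi> f x)"
    and no_eigenvector: "l \<noteq> 0 \<Longrightarrow> \<forall>x. x \<notin> E \<longrightarrow> f x = 0 \<Longrightarrow> \<Phi> f = (\<lambda>x. l * f x) \<Longrightarrow> f = (\<lambda>_. 0)"
begin

definition poly_act :: "complex poly \<Rightarrow> ('x \<Rightarrow> complex) \<Rightarrow> 'x \<Rightarrow> complex" where
  "poly_act c f x = (\<Sum>k\<le>degree c. coeff c k * (\<Phi> ^^ k) f x)"

lemma \<Phi>_zero: "\<Phi> (\<lambda>_. 0) = (\<lambda>_. 0)"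
  using homogeneous[of 0 "\<lambda>_. 0"] by simp

lemma iterate_zero: "(\<Phi> ^^ j) (\<lambda>_. 0) = (\<lambda>_. 0)"
  by (induction j) (simp_all add: \<Phi>_zero)

lemma \<Phi>_sum: "finite K \<Longrightarrow> \<Phi> (\<lambda>x. \<Sum>k\<in>K. c k * f k x) = (\<lambda>x. \<Sum>k\<in>K. c k * \<Phi> (f k) x)"
  by (induction K rule: finite_induct) (simp_all add: \<Phi>_zero additive homogeneous)

lemma poly_act_superset: "degree c \<le> n \<Longrightarrow> poly_act c f x = (\<Sum>k\<le>n. coeff c k * (\<Phi> ^^ k) f x)"
  unfolding poly_act_def by (rule sum.mono_neutral_left) (auto simp: coeff_eq_0)

lemma poly_act_pCons: "poly_act (pCons a c) f = (\<lambda>x. a * f x + \<Phi> (poly_act c f) x)"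
proof
  fix x
  have "poly_act (pCons a c) f x = (\<Sum>k\<le>Suc (degree c). coeff (pCons a c) k * (\<Phi> ^^ k) f x)"
    by (rule poly_act_superset) (simp add: degree_pCons_le)
  also have "\<dots> = a * f x + (\<Sum>k\<le>degree c. coeff c k * \<Phi> ((\<Phi> ^^ k) f) x)"
    by (subst sum.atMost_Suc_shift) simp
  also have "(\<Sum>k\<le>degree c. coeff c k * \<Phi> ((\<Phi> ^^ k) f) x) = \<Phi> (poly_act c f) x"
    unfolding poly_act_def by (simp add: \<Phi>_sum)
  finally show "poly_act (pCons a c) f x = a * f x + \<Phi> (poly_act c f) x" .
qed

lemma poly_act_linear_factor:
  "poly_act ([:- l, 1:] * c) f = (\<lambda>x. \<Phi> (poly_act c f) x - l * poly_act c f x)"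
proof
  fix x
  define n where "n = Suc (degree c)"
  have "[:- l, 1:] * c = pCons 0 c - smult l c" by (simp add: mult.commute)
  moreover have "degree (pCons 0 c - smult l c) \<le> n"
    by (intro degree_diff_le) (simp_all add: n_def degree_pCons_le le_SucI degree_smult_le)
  ultimately have "poly_act ([:- l, 1:] * c) f x = (\<Sum>k\<le>n. coeff (pCons 0 c - smult l c) k * (\<Phi> ^^ k) f x)"
    using poly_act_superset[of "pCons 0 c - smult l c" n] by simp
  also have "\<dots> = (\<Sum>k\<le>n. coeff (pCons 0 c) k * (\<Phi> ^^ k) f x) - l * (\<Sum>k\<le>n. coeff c k * (\<Phi> ^^ k) f x)"
    by (simp add: left_diff_distrib sum_subtractf sum_distrib_left mult.assoc)
  also have "\<dots> = poly_act (pCons 0 c) f x - l * poly_act c f x"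
    using poly_act_superset[of "pCons 0 c" n f x] poly_act_superset[of c n f x]
    by (simp add: n_def degree_pCons_le)
  finally show "poly_act ([:- l, 1:] * c) f x = \<Phi> (poly_act c f) x - l * poly_act c f x"
    by (simp add: poly_act_pCons)
qed

lemma poly_act_commute: "\<Phi> (poly_act c f) = poly_act c (\<Phi> f)"
  unfolding poly_act_def by (simp add: \<Phi>_sum funpow_swap1)

lemma poly_act_outside:
  assumes "\<forall>x. x \<notin> E \<longrightarrow> f x = 0"
  shows "\<forall>x. x \<notin> E \<longrightarrow> poly_act c f x = 0"
proof -
  have "(\<Phi> ^^ k) f x = 0" if "x \<notin> E" for x k
    using that assms outside by (cases k) auto
  then show ?thesis by (simp add: poly_act_def)
qed

text \<open>Split off linear factors \<open>z - l\<close> of the annihilating polynomial. A factor with \<open>l \<noteq> 0\<close> acts injectively and can be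
dropped, so only powers of \<open>z\<close> remain.\<close>
lemma iterate_vanishes_if_annihilated:
  assumes "c \<noteq> 0" "degree c = n" "\<forall>x. x \<notin> E \<longrightarrow> f x = 0" "poly_act c f = (\<lambda>_. 0)"
  shows "\<exists>k\<le>n. (\<Phi> ^^ k) f = (\<lambda>_. 0)"
  using assms
proof (induction n arbitrary: c f)
  case 0
  then obtain a where a: "c = [:a:]" "a \<noteq> 0" by (metis degree_eq_zeroE pCons_eq_0_iff)
  then have "f = (\<lambda>_. 0)" using 0(4) by (auto simp: poly_act_def fun_eq_iff)
  then show ?case by auto
next
  case (Suc n)
  then have "\<not> constant (poly c)" by (simp add: constant_degree)
  then obtain l where "poly c l = 0" using fundamental_theorem_of_algebra by blast
  then obtain d where d: "c = [:- l, 1:] * d" by (metis dvdE poly_eq_0_iff_dvd)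
  have d0: "d \<noteq> 0" using Suc.prems(1) d by auto
  have "degree c = degree [:- l, 1:] + degree d" unfolding d by (rule degree_mult_eq) (use d0 in auto)
  then have deg: "degree d = n" using Suc.prems(2) by simp
  have eig: "\<Phi> (poly_act d f) = (\<lambda>x. l * poly_act d f x)"
    using Suc.prems(4) unfolding d poly_act_linear_factor by (auto simp: fun_eq_iff)
  show ?case
  proof (cases "l = 0")
    case False
    have "poly_act d f = (\<lambda>_. 0)"
      by (rule no_eigenvector[OF False poly_act_outside[OF Suc.prems(3)] eig])
    then show ?thesis using Suc.IH[OF d0 deg Suc.prems(3)] by (meson le_SucI)
  next
    case True
    then have "poly_act d (\<Phi> f) = (\<lambda>_. 0)" using eig by (simp add: poly_act_commute)
    then obtain k where k: "k \<le> n" "(\<Phi> ^^ k) (\<Phi> f) = (\<lambda>_. 0)"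
      using Suc.IH[OF d0 deg, of "\<Phi> f"] outside by auto
    then have "(\<Phi> ^^ Suc k) f = (\<lambda>_. 0)" by (simp add: funpow_swap1)
    then show ?thesis using k(1) by blast
  qed
qed

lemma iterate_vanishes:
  assumes f: "\<forall>x. x \<notin> E \<longrightarrow> f x = 0" and n: "card E \<le> n"
  shows "(\<Phi> ^^ n) f = (\<lambda>_. 0)"
proof -
  obtain y where y: "\<exists>k\<in>{..card E}. y k \<noteq> 0" "\<forall>x\<in>E. (\<Sum>k\<in>{..card E}. (\<Phi> ^^ k) f x * y k) = 0"
    using homogeneous_system_nontrivial[of E "{..card E}" "\<lambda>x k. (\<Phi> ^^ k) f x"] finite_support by auto
  define c where "c = (\<Sum>k\<le>card E. monom (y k) k)"
  have coeff_c: "coeff c k = (if k \<le> card E then y k else 0)" for k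
    by (simp add: c_def coeff_sum coeff_monom)
  have c0: "c \<noteq> 0" using y(1) coeff_c by (metis atMost_iff coeff_0)
  have deg: "degree c \<le> card E" by (rule degree_le) (simp add: coeff_c)
  have "poly_act c f x = 0" for x
  proof (cases "x \<in> E")
    case True
    then show ?thesis using y(2) by (simp add: poly_act_superset[OF deg] coeff_c mult.commute)
  qed (use poly_act_outside[OF f] in auto)
  then obtain k where k: "k \<le> degree c" "(\<Phi> ^^ k) f = (\<lambda>_. 0)"
    using iterate_vanishes_if_annihilated[OF c0 refl f] by (auto simp: fun_eq_iff)
  have "(\<Phi> ^^ n) f = (\<Phi> ^^ (n - k)) ((\<Phi> ^^ k) f)"
    using funpow_add[of "n - k" k \<Phi>] k(1) deg n by simp
  also have "\<dots> = (\<lambda>_. 0)" unfolding k(2) by (rule iterate_zero)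
  finally show ?thesis .
qed

end

lemma sum_lists_length_Suc:
  fixes f :: "'g::finite list \<Rightarrow> 'b::comm_monoid_add"
  shows "(\<Sum>u | length u = Suc k. f u) = (\<Sum>i\<in>UNIV. \<Sum>u | length u = k. f (i # u))"
proof -
  have "(\<Sum>i\<in>UNIV. \<Sum>u | length u = k. f (i # u)) = (\<Sum>(i, u)\<in>UNIV \<times> {u. length u = k}. f (i # u))"
    by (rule sum.cartesian_product)
  also have "\<dots> = (\<Sum>u | length u = Suc k. f u)"
    by (rule sum.reindex_bij_witness[where i = "\<lambda>u. (hd u, tl u)" and j = "\<lambda>(i, u). i # u"]) (auto simp: length_Suc_conv)
  finally show ?thesis by simp
qed

lemma finite_lists_length: "finite {u :: 'g::finite list. length u = k}"
  using finite_lists_length_eq[of "UNIV :: 'g set" k] by simp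

text \<open>The map \<open>\<Phi> T = \<Sum>A i T A i*\<close> has no nonzero eigenvalue, so \<open>\<Phi>^k\<close> vanishes at the identity matrix, for \<open>k\<close> the dimension of the
space of matrices. But \<open>\<Phi>^k 1 = \<Sum>|u| = k. A^u (A^u)*\<close> is a sum of positive semidefinite matrices, so every summand is zero.\<close>
theorem completely_positive_nilpotent:
  fixes a :: "'g::finite \<Rightarrow> 'q \<Rightarrow> 'q \<Rightarrow> complex"
  assumes fin: "finite Q"
    and inj: "\<And>l T. l \<noteq> 0 \<Longrightarrow> (\<And>q q'. q \<notin> Q \<or> q' \<notin> Q \<Longrightarrow> T q q' = 0) \<Longrightarrow>
      (\<And>q q'. q \<in> Q \<Longrightarrow> q' \<in> Q \<Longrightarrow>
        (\<Sum>i\<in>UNIV. \<Sum>s\<in>Q. \<Sum>s'\<in>Q. a i q s * T s s' * cnj (a i q' s')) = l * T q q') \<Longrightarrow>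
      (\<And>q q'. q \<in> Q \<Longrightarrow> q' \<in> Q \<Longrightarrow> T q q' = 0)"
    and u: "card Q * card Q \<le> length u" and q: "q \<in> Q" "q' \<in> Q"
  shows "mat_word Q a u q q' = 0"
proof -
  define \<Phi> where "\<Phi> f = (\<lambda>(q, q'). if q \<in> Q \<and> q' \<in> Q then
     \<Sum>i\<in>UNIV. \<Sum>s\<in>Q. \<Sum>s'\<in>Q. a i q s * f (s, s') * cnj (a i q' s') else 0)" for f
  have \<Phi>_apply: "\<Phi> f (q, q') = (if q \<in> Q \<and> q' \<in> Q then
     \<Sum>i\<in>UNIV. \<Sum>s\<in>Q. \<Sum>s'\<in>Q. a i q s * f (s, s') * cnj (a i q' s') else 0)" for f q q'
    by (simp add: \<Phi>_def)
  interpret injective_off_zero "Q \<times> Q" \<Phi>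
  proof
    fix l and f :: "'q \<times> 'q \<Rightarrow> complex"
    assume l: "l \<noteq> 0" and f: "\<forall>x. x \<notin> Q \<times> Q \<longrightarrow> f x = 0" and eig: "\<Phi> f = (\<lambda>x. l * f x)"
    have "f (q, q') = 0" if "q \<in> Q" "q' \<in> Q" for q q'
    proof (rule inj[OF l, of "\<lambda>q q'. f (q, q')"])
      fix q q' assume "q \<in> Q" "q' \<in> Q"
      then show "(\<Sum>i\<in>UNIV. \<Sum>s\<in>Q. \<Sum>s'\<in>Q. a i q s * f (s, s') * cnj (a i q' s')) = l * f (q, q')"
        using fun_cong[OF eig, of "(q, q')"] by (simp add: \<Phi>_def)
    qed (use f that in auto)
    then show "f = (\<lambda>_. 0)" using f by (auto simp: fun_eq_iff)
  qed (use fin in \<open>auto simp: \<Phi>_def fun_eq_iff sum_distrib_left sum.distrib algebra_simps split: if_splits\<close>)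
  define e where "e = (\<lambda>(q, q'). of_bool (q = q' \<and> q \<in> Q) :: complex)"
  have iter: "(\<Phi> ^^ k) e (q, q') = (\<Sum>u | length u = k. \<Sum>t\<in>Q. mat_word Q a u q t * cnj (mat_word Q a u q' t))"
    if "q \<in> Q" "q' \<in> Q" for k q q'
    using that
  proof (induction k arbitrary: q q')
    case 0
    have "(\<Sum>t\<in>Q. of_bool (q = t) * cnj (of_bool (q' = t))) = (\<Sum>t\<in>Q. if t = q then of_bool (q' = q) else (0::complex))"
      by (intro sum.cong) auto
    then show ?case using 0 fin by (auto simp: e_def)
  next
    case (Suc k)
    let ?m = "mat_word Q a"
    have "(\<Phi> ^^ Suc k) e (q, q') = (\<Sum>i\<in>UNIV. \<Sum>s\<in>Q. \<Sum>s'\<in>Q. a i q s * (\<Sum>u | length u = k. \<Sum>t\<in>Q. ?m u s t * cnj (?m u s' t)) * cnj (a i q' s'))"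
      unfolding funpow.simps comp_apply \<Phi>_apply using Suc by simp
    also have "\<dots> = (\<Sum>i\<in>UNIV. \<Sum>s\<in>Q. \<Sum>s'\<in>Q. \<Sum>u | length u = k. \<Sum>t\<in>Q. (a i q s * ?m u s t) * cnj (a i q' s' * ?m u s' t))"
      by (simp add: sum_distrib_left sum_distrib_right mult_ac)
    also have "\<dots> = (\<Sum>i\<in>UNIV. \<Sum>s\<in>Q. \<Sum>u | length u = k. \<Sum>s'\<in>Q. \<Sum>t\<in>Q. (a i q s * ?m u s t) * cnj (a i q' s' * ?m u s' t))"
      by (intro sum.cong refl sum.swap)
    also have "\<dots> = (\<Sum>i\<in>UNIV. \<Sum>u | length u = k. \<Sum>s\<in>Q. \<Sum>s'\<in>Q. \<Sum>t\<in>Q. (a i q s * ?m u s t) * cnj (a i q' s' * ?m u s' t))"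
      by (intro sum.cong refl sum.swap)
    also have "\<dots> = (\<Sum>i\<in>UNIV. \<Sum>u | length u = k. \<Sum>s\<in>Q. \<Sum>t\<in>Q. \<Sum>s'\<in>Q. (a i q s * ?m u s t) * cnj (a i q' s' * ?m u s' t))"
      by (intro sum.cong refl sum.swap)
    also have "\<dots> = (\<Sum>i\<in>UNIV. \<Sum>u | length u = k. \<Sum>t\<in>Q. \<Sum>s\<in>Q. \<Sum>s'\<in>Q. (a i q s * ?m u s t) * cnj (a i q' s' * ?m u s' t))"
      by (intro sum.cong refl sum.swap)
    also have "\<dots> = (\<Sum>i\<in>UNIV. \<Sum>u | length u = k. \<Sum>t\<in>Q. ?m (i # u) q t * cnj (?m (i # u) q' t))"
      by (simp add: sum_product)
    finally show ?case by (simp add: sum_lists_length_Suc)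
  qed
  have "(\<Phi> ^^ length u) e = (\<lambda>_. 0)"
    by (rule iterate_vanishes) (use u in \<open>auto simp: e_def card_cartesian_product\<close>)
  then have "(\<Sum>w | length w = length u. \<Sum>t\<in>Q. mat_word Q a w q t * cnj (mat_word Q a w q t)) = 0"
    using iter[OF q(1) q(1), of "length u"] by simp
  then have "(\<Sum>w | length w = length u. \<Sum>t\<in>Q. complex_of_real ((cmod (mat_word Q a w q t))\<^sup>2)) = 0"
    by (simp only: complex_norm_square)
  then have "complex_of_real (\<Sum>w | length w = length u. \<Sum>t\<in>Q. (cmod (mat_word Q a w q t))\<^sup>2) = 0"
    by (simp only: of_real_sum)
  then have "(\<Sum>w | length w = length u. \<Sum>t\<in>Q. (cmod (mat_word Q a w q t))\<^sup>2) = 0"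
    by (simp only: of_real_eq_0_iff)
  then have "(\<Sum>t\<in>Q. (cmod (mat_word Q a u q t))\<^sup>2) = 0"
    by (subst (asm) sum_nonneg_eq_0_iff) (auto intro: sum_nonneg simp: finite_lists_length)
  then have "(cmod (mat_word Q a u q q'))\<^sup>2 = 0"
    using q(2) fin by (subst (asm) sum_nonneg_eq_0_iff) auto
  then show ?thesis by simp
qed

section \<open>The tensor square of the free algebra\<close>

text \<open>A pair \<open>(u, v)\<close> of words stands for \<open>u \<otimes> v\<close>, with \<open>v\<close> stored in reversed order. The product of the monoid algebra, which
concatenates in both components, is then that of \<open>S \<otimes> S^op\<close>, as required for the composition of maps \<open>H \<mapsto> a H b\<close>.\<close>
type_synonym 'g bi_poly = "('g list \<times> 'g list) \<Rightarrow>\<^sub>0 complex"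

lemma zero_bi: "(0 :: 'g list \<times> 'g list) = ([], [])"
  by (simp add: zero_prod_def zero_list_def)

lemma single_mult_bi: "single (u, v) c * single (u', v') d =
    single (u @ u', v @ v') (c * d :: complex)"
  by (simp add: mult_single plus_list_def)

lemma module_pm_scale: "Modules.module (pm_scale :: complex \<Rightarrow> ('m::monoid_add \<Rightarrow>\<^sub>0 complex) \<Rightarrow> _)"
  using scalar_algebra.is_module[OF scalar_algebra_pm_scale] .

lemma pm_scale_single [simp]: "pm_scale c (single k d) = single k (c * d)"
  by (simp add: pm_scale_def mult_single)

subsection \<open>Action on matrices\<close>

definition left_op :: "nat \<Rightarrow> (nat \<Rightarrow> nat \<Rightarrow> complex) \<Rightarrow> (nat \<Rightarrow> nat \<Rightarrow> complex) \<Rightarrow> nat \<Rightarrow> nat \<Rightarrow> complex" where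
  "left_op n X h = (\<lambda>a b. if a < n then \<Sum>a'<n. X a a' * h a' b else 0)"

definition right_op :: "nat \<Rightarrow> (nat \<Rightarrow> nat \<Rightarrow> complex) \<Rightarrow> (nat \<Rightarrow> nat \<Rightarrow> complex) \<Rightarrow> nat \<Rightarrow> nat \<Rightarrow> complex" where
  "right_op m Y h = (\<lambda>a b. if b < m then \<Sum>b'<m. Y b b' * h a b' else 0)"

primrec left_word :: "nat \<Rightarrow> ('g \<Rightarrow> nat \<Rightarrow> nat \<Rightarrow> complex) \<Rightarrow> 'g list \<Rightarrow> (nat \<Rightarrow> nat \<Rightarrow> complex) \<Rightarrow> nat \<Rightarrow> nat \<Rightarrow> complex" where
  "left_word n X [] h = h"
| "left_word n X (i # u) h = left_op n (X i) (left_word n X u h)"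

primrec right_word :: "nat \<Rightarrow> ('g \<Rightarrow> nat \<Rightarrow> nat \<Rightarrow> complex) \<Rightarrow> 'g list \<Rightarrow> (nat \<Rightarrow> nat \<Rightarrow> complex) \<Rightarrow> nat \<Rightarrow> nat \<Rightarrow> complex" where
  "right_word m Y [] h = h"
| "right_word m Y (i # u) h = right_op m (Y i) (right_word m Y u h)"

text \<open>The first word acts on the row index of \<open>h\<close> by multiplication from the left, the second on the column index. The second action uses
\<open>Y b b'\<close> with the summation over \<open>b'\<close>, that is, multiplication from the right by the transpose of \<open>Y\<close>.\<close>
definition bi_word :: "nat \<Rightarrow> nat \<Rightarrow> ('g \<Rightarrow> nat \<Rightarrow> nat \<Rightarrow> complex) \<Rightarrow> ('g \<Rightarrow> nat \<Rightarrow> nat \<Rightarrow> complex) \<Rightarrow>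
    'g list \<times> 'g list \<Rightarrow> (nat \<Rightarrow> nat \<Rightarrow> complex) \<Rightarrow> nat \<Rightarrow> nat \<Rightarrow> complex" where
  "bi_word n m X Y k h = left_word n X (fst k) (right_word m Y (snd k) h)"

definition bi_act :: "nat \<Rightarrow> nat \<Rightarrow> ('g \<Rightarrow> nat \<Rightarrow> nat \<Rightarrow> complex) \<Rightarrow> ('g \<Rightarrow> nat \<Rightarrow> nat \<Rightarrow> complex) \<Rightarrow>
    'g bi_poly \<Rightarrow> (nat \<Rightarrow> nat \<Rightarrow> complex) \<Rightarrow> nat \<Rightarrow> nat \<Rightarrow> complex" where
  "bi_act n m X Y F h a b = lin_ext (*) (\<lambda>k. bi_word n m X Y k h a b) F"

definition supported :: "nat \<Rightarrow> nat \<Rightarrow> (nat \<Rightarrow> nat \<Rightarrow> complex) \<Rightarrow> bool" where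
  "supported n m h \<longleftrightarrow> (\<forall>a b. a \<ge> n \<or> b \<ge> m \<longrightarrow> h a b = 0)"

text \<open>Injectivity of \<open>H \<mapsto> J(X, Y) H\<close> at all points, for \<open>n \<times> m\<close> matrices \<open>H j\<close>.\<close>
definition bi_injective :: "('g::finite \<Rightarrow> 'g \<Rightarrow> 'g bi_poly) \<Rightarrow> bool" where
  "bi_injective J \<longleftrightarrow> (\<forall>n m X Y H. (\<forall>j. supported n m (H j)) \<longrightarrow>
     (\<forall>i a b. (\<Sum>j\<in>UNIV. bi_act n m X Y (J i j) (H j) a b) = 0) \<longrightarrow> (\<forall>j a b. H j a b = 0))"

lemma left_word_sum:
  "left_word n X u (\<lambda>a b. \<Sum>x\<in>S. c x * h x a b) = (\<lambda>a b. \<Sum>x\<in>S. c x * left_word n X u (h x) a b)"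
proof (induction u)
  case (Cons i u)
  have "(\<Sum>a'<n. X i a a' * (\<Sum>x\<in>S. c x * left_word n X u (h x) a' b)) =
     (\<Sum>x\<in>S. c x * (\<Sum>a'<n. X i a a' * left_word n X u (h x) a' b))" for a b
    unfolding sum_distrib_left by (subst sum.swap) (simp add: mult_ac)
  then show ?case by (auto simp: Cons left_op_def fun_eq_iff)
qed simp

lemma right_word_sum:
  "right_word m Y u (\<lambda>a b. \<Sum>x\<in>S. c x * h x a b) = (\<lambda>a b. \<Sum>x\<in>S. c x * right_word m Y u (h x) a b)"
proof (induction u)
  case (Cons i u)
  have "(\<Sum>b'<m. Y i b b' * (\<Sum>x\<in>S. c x * right_word m Y u (h x) a b')) =
     (\<Sum>x\<in>S. c x * (\<Sum>b'<m. Y i b b' * right_word m Y u (h x) a b'))" for a b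
    unfolding sum_distrib_left by (subst sum.swap) (simp add: mult_ac)
  then show ?case by (auto simp: Cons right_op_def fun_eq_iff)
qed simp

lemma bi_word_sum:
  "bi_word n m X Y k (\<lambda>a b. \<Sum>x\<in>S. c x * h x a b) = (\<lambda>a b. \<Sum>x\<in>S. c x * bi_word n m X Y k (h x) a b)"
  by (simp add: bi_word_def right_word_sum left_word_sum)

lemma left_right_op_commute: "left_op n X (right_op m Y h) = right_op m Y (left_op n X h)"
proof -
  have "(\<Sum>a'<n. X a a' * (\<Sum>b'<m. Y b b' * h a' b')) = (\<Sum>b'<m. Y b b' * (\<Sum>a'<n. X a a' * h a' b'))" for a b
    unfolding sum_distrib_left by (subst sum.swap) (simp add: mult_ac)
  then show ?thesis by (auto simp: left_op_def right_op_def fun_eq_iff)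
qed

lemma right_op_left_word: "right_op m Z (left_word n X u h) = left_word n X u (right_op m Z h)"
  by (induction u) (simp_all add: left_right_op_commute[symmetric])

lemma right_word_left_word: "right_word m Y v (left_word n X u h) = left_word n X u (right_word m Y v h)"
  by (induction v) (simp_all add: right_op_left_word)

lemma left_word_append: "left_word n X (u @ v) h = left_word n X u (left_word n X v h)"
  by (induction u) auto

lemma right_word_append: "right_word n X (u @ v) h = right_word n X u (right_word n X v h)"
  by (induction u) auto

lemma bi_word_plus: "bi_word n m X Y (k + l) h = bi_word n m X Y k (bi_word n m X Y l h)"
  by (simp add: bi_word_def plus_list_def left_word_append right_word_append right_word_left_word)

lemma module_times: "Modules.module ((*) :: complex \<Rightarrow> complex \<Rightarrow> complex)"
  using scalar_algebra.is_module[OF scalar_algebra_complex] .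

lemma bi_act_add: "bi_act n m X Y (F + G) h = (\<lambda>a b. bi_act n m X Y F h a b + bi_act n m X Y G h a b)"
  by (simp add: bi_act_def lin_ext_add module_times fun_eq_iff)

lemma bi_act_diff: "bi_act n m X Y (F - G) h = (\<lambda>a b. bi_act n m X Y F h a b - bi_act n m X Y G h a b)"
  by (simp add: bi_act_def lin_ext_diff module_times fun_eq_iff)

lemma bi_act_sum: "bi_act n m X Y (\<Sum>x\<in>S. F x) h = (\<lambda>a b. \<Sum>x\<in>S. bi_act n m X Y (F x) h a b)"
  by (simp add: bi_act_def lin_ext_sum module_times fun_eq_iff)

lemma bi_act_single: "bi_act n m X Y (single k c) h = (\<lambda>a b. c * bi_word n m X Y k h a b)"
  by (simp add: bi_act_def lin_ext_single module_times fun_eq_iff)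

lemma bi_act_zero [simp]: "bi_act n m X Y 0 h = (\<lambda>a b. 0)"
  by (simp add: bi_act_def lin_ext_zero fun_eq_iff)

lemma bi_act_one [simp]: "bi_act n m X Y 1 h = h"
  using bi_act_single[of n m X Y 0 1 h] by (simp only: single_one) (simp add: zero_bi bi_word_def)

lemma bi_act_sum_right:
  "bi_act n m X Y F (\<lambda>a b. \<Sum>x\<in>S. h x a b) = (\<lambda>a b. \<Sum>x\<in>S. bi_act n m X Y F (h x) a b)"
proof (induction F rule: poly_mapping_additive_induct)
  case (single k c)
  then show ?case using bi_word_sum[of n m X Y k "\<lambda>_. 1" h S] by (simp add: bi_act_single sum_distrib_left)
next
  case (add F G)
  then show ?case by (simp add: bi_act_add sum.distrib)
qed

lemma bi_act_add_right:
  "bi_act n m X Y F (\<lambda>a b. h a b + g a b) = (\<lambda>a b. bi_act n m X Y F h a b + bi_act n m X Y F g a b)"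
  using bi_act_sum_right[of n m X Y F "\<lambda>x. if x then h else g" "{True, False}"] by simp

lemma bi_act_mult: "bi_act n m X Y (F * G) h = bi_act n m X Y F (bi_act n m X Y G h)"
proof (induction F rule: poly_mapping_additive_induct)
  case (single k c)
  show ?case
  proof (induction G rule: poly_mapping_additive_induct)
    case (single l d)
    have "bi_word n m X Y k (\<lambda>a b. d * bi_word n m X Y l h a b) = (\<lambda>a b. d * bi_word n m X Y (k + l) h a b)"
      using bi_word_sum[of n m X Y k "\<lambda>_. d" "\<lambda>_. bi_word n m X Y l h" "{()}"] by (simp add: bi_word_plus)
    then show ?case by (simp add: mult_single bi_act_single mult_ac)
  next
    case (add G G')
    then show ?case by (simp add: distrib_left bi_act_add bi_act_add_right)
  qed
next
  case (add F F')
  then show ?case by (simp add: distrib_right bi_act_add)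
qed

lemma bi_act_supported:
  assumes "supported n m h"
  shows "supported n m (bi_act n m X Y F h)"
proof -
  have r: "supported n m (right_word m Y v h)" for v
    by (induction v) (use assms in \<open>auto simp: supported_def right_op_def\<close>)
  have "supported n m (left_word n X u (right_word m Y v h))" for u v
    by (induction u) (use r in \<open>auto simp: supported_def left_op_def\<close>)
  then show ?thesis by (auto simp: supported_def bi_act_def bi_word_def lin_ext_def)
qed

subsection \<open>Embeddings and coefficients\<close>

definition embed_right :: "'g free_poly \<Rightarrow> 'g bi_poly" where
  "embed_right = lin_ext pm_scale (\<lambda>v. single ([], v) 1)"

definition embed_left :: "'g free_poly \<Rightarrow> 'g bi_poly" where
  "embed_left = lin_ext pm_scale (\<lambda>u. single (u, []) 1)"

lemma embed_simps [simp]: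
  "embed_right (f + g) = embed_right f + embed_right g" "embed_left (f + g) = embed_left f + embed_left g"
  "embed_right (f - g) = embed_right f - embed_right g" "embed_left (f - g) = embed_left f - embed_left g"
  "embed_right (f * g) = embed_right f * embed_right g" "embed_left (f * g) = embed_left f * embed_left g"
  "embed_right (single v c) = single ([], v) c"
  "embed_left (single u c) = single (u, []) c"
  "embed_right 0 = 0" "embed_left 0 = 0"
  by (simp_all add: embed_right_def embed_left_def lin_ext_add lin_ext_diff lin_ext_single lin_ext_zero module_pm_scale
      scalar_algebra.lin_ext_mult[OF scalar_algebra_pm_scale] mult_single plus_list_def)

lemma embed_one [simp]: "embed_right 1 = 1" "embed_left 1 = 1"
  using embed_simps(7)[of 0 1] embed_simps(8)[of 0 1] by (simp_all only: single_one) (simp_all add: zero_list_def zero_bi[symmetric])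

lemma embed_sum: "embed_right (\<Sum>x\<in>S. f x) = (\<Sum>x\<in>S. embed_right (f x))" "embed_left (\<Sum>x\<in>S. f x) = (\<Sum>x\<in>S. embed_left (f x))"
  by (simp_all add: embed_right_def embed_left_def lin_ext_sum module_pm_scale)

lemma embed_commute: "embed_left f * embed_right g = embed_right g * embed_left f"
proof (induction f rule: poly_mapping_additive_induct)
  case (single u c)
  show ?case
  proof (induction g rule: poly_mapping_additive_induct)
    case (single v d)
    then show ?case by (simp add: single_mult_bi mult.commute)
  next
    case (add g h)
    then show ?case by (simp add: distrib_left distrib_right)
  qed
next
  case (add f h)
  then show ?case by (simp add: distrib_left distrib_right)
qed

text \<open>\<open>slice u F\<close> is the coefficient of \<open>u\<close> in the left variables, a polynomial in the right ones.\<close>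
definition slice :: "'g list \<Rightarrow> 'g bi_poly \<Rightarrow> 'g free_poly" where
  "slice u F = map_key (Pair u) F"

definition strip :: "'g list \<Rightarrow> 'g bi_poly \<Rightarrow> 'g bi_poly" where
  "strip v F = map_key (\<lambda>(z, y). (v @ z, y)) F"

lemma lookup_slice [simp]: "lookup (slice u F) v = lookup F (u, v)"
  by (simp add: slice_def map_key.rep_eq inj_on_def)

lemma lookup_strip [simp]: "lookup (strip v F) (z, y) = lookup F (v @ z, y)"
  by (simp add: strip_def map_key.rep_eq inj_on_def)

lemma slice_simps [simp]: "slice u (F + G) = slice u F + slice u G" "slice u (F - G) = slice u F - slice u G" "slice u 0 = 0"
  by (auto intro!: poly_mapping_eqI simp: lookup_add lookup_minus)

lemma slice_single: "slice u (single (w, v) c) = (if u = w then single v c else 0)"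
  by (auto intro!: poly_mapping_eqI simp: lookup_single when_def)

lemma slice_sum: "slice u (\<Sum>x\<in>S. F x) = (\<Sum>x\<in>S. slice u (F x))"
  by (induction S rule: infinite_finite_induct) auto

lemma slice_eqI: "(\<And>u. slice u F = slice u G) \<Longrightarrow> F = G"
  by (rule poly_mapping_eqI) (metis lookup_slice surj_pair)

lemma slice_mult: "slice u (F * G) = (\<Sum>n\<le>length u. slice (take n u) F * slice (drop n u) G)"
proof (induction F rule: poly_mapping_additive_induct)
  case (single k c)
  show ?case
  proof (induction G rule: poly_mapping_additive_induct)
    case (single l d)
    obtain u1 v1 u2 v2 where kl: "k = (u1, v1)" "l = (u2, v2)" by (metis surj_pair)
    have "(\<Sum>n\<le>length u. slice (take n u) (single k c) * slice (drop n u) (single l d)) =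
       (\<Sum>n\<le>length u. if n = length u1 then (if u = u1 @ u2 then single (v1 @ v2) (c * d) else 0) else 0)"
    proof (intro sum.cong refl)
      fix n assume n: "n \<in> {..length u}"
      have "take n u = u1 \<and> drop n u = u2 \<longleftrightarrow> n = length u1 \<and> u = u1 @ u2"
        using n by (metis append_eq_conv_conj append_take_drop_id atMost_iff length_take min.absorb2)
      have "slice (take n u) (single k c) * slice (drop n u) (single l d) =
          (if take n u = u1 \<and> drop n u = u2 then single (v1 @ v2) (c * d) else 0)"
        by (simp add: kl slice_single mult_single plus_list_def)
      also have "\<dots> = (if n = length u1 then (if u = u1 @ u2 then single (v1 @ v2) (c * d) else 0) else 0)"
        unfolding \<open>take n u = u1 \<and> drop n u = u2 \<longleftrightarrow> n = length u1 \<and> u = u1 @ u2\<close> by simp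
      finally show "slice (take n u) (single k c) * slice (drop n u) (single l d) =
        (if n = length u1 then (if u = u1 @ u2 then single (v1 @ v2) (c * d) else 0) else 0)" .
    qed
    then show ?case by (simp add: kl single_mult_bi slice_single)
  next
    case (add G H)
    then show ?case by (simp add: distrib_left sum.distrib)
  qed
next
  case (add F H)
  then show ?case by (simp add: distrib_right sum.distrib)
qed

lemma slice_embed_right: "slice u (embed_right f) = (if u = [] then f else 0)"
proof (induction f rule: poly_mapping_additive_induct)
  case (single k c)
  then show ?case by (simp add: slice_single)
qed auto

lemma single_Nil_one: "single [] 1 = (1 :: 'g free_poly)"
  by (metis single_one zero_list_def)

lemma single_mult_free: "single u c * single v d = single (u @ v) (c * d :: complex)"
  by (simp add: mult_single plus_list_def)

lemma slice_Nil_mult: "slice [] (F * G) = slice [] F * slice [] G"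
  by (simp add: slice_mult)

lemma slice_Nil_embed_left: "slice [] (embed_left f) = single [] (lookup f [])"
proof (induction f rule: poly_mapping_additive_induct)
  case (single k c)
  then show ?case by (auto simp: slice_single lookup_single)
next
  case (add f g)
  then show ?case by (simp add: lookup_add single_add)
qed

lemma lookup_mult_Nil: "lookup (f * g) [] = lookup f [] * lookup (g :: 'g free_poly) []"
proof -
  have "single [] (lookup (f * g) []) =
      (single [] (lookup f [] * lookup g []) :: 'g free_poly)"
    by (simp add: slice_Nil_embed_left[symmetric] slice_Nil_mult) (simp add: slice_Nil_embed_left single_mult_free)
  then show ?thesis by (metis lookup_single_eq)
qed

lemma slice_left_letters_mult_embed_right:
  "slice u (single (w, []) 1 * embed_right f) = (if u = w then f else 0)"
proof (induction f rule: poly_mapping_additive_induct)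
  case (single k c)
  then show ?case by (simp add: slice_single single_mult_bi)
next
  case (add f g)
  then show ?case by (simp add: distrib_left)
qed

lemma lookup_letter_mult:
  fixes F :: "'g bi_poly"
  shows "lookup (single ([i], []) 1 * F) (u, y) =
     (case u of [] \<Rightarrow> 0 | j # z \<Rightarrow> if i = j then lookup F (z, y) else 0)"
proof (induction F rule: poly_mapping_additive_induct)
  case (single k c)
  obtain u' v' where "k = (u', v')" by (cases k)
  then show ?case by (auto simp: single_mult_bi lookup_single when_def split: list.split)
next
  case (add F G)
  then show ?case by (auto simp: distrib_left lookup_add split: list.split)
qed

text \<open>Sorting the left words that begin with \<open>v\<close> by the letter after \<open>v\<close>.\<close>
lemma strip_decompose:
  fixes F :: "'g::finite bi_poly"
  shows "strip v F = embed_right (slice v F) + (\<Sum>i\<in>UNIV. single ([i], []) 1 * strip (v @ [i]) F)"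
proof (rule poly_mapping_eqI)
  fix k :: "'g list \<times> 'g list"
  obtain u y where k: "k = (u, y)" by (cases k)
  have "lookup (embed_right (slice v F)) (u, y) = lookup (slice u (embed_right (slice v F))) y" by simp
  also have "\<dots> = (if u = [] then lookup F (v, y) else 0)" by (simp add: slice_embed_right del: lookup_slice) simp
  finally have "lookup (embed_right (slice v F)) (u, y) = (if u = [] then lookup F (v, y) else 0)" .
  then show "lookup (strip v F) k = lookup (embed_right (slice v F) + (\<Sum>i\<in>UNIV. single ([i], []) 1 * strip (v @ [i]) F)) k"
    by (cases u) (simp_all add: k lookup_add lookup_sum lookup_letter_mult)
qed

lemma right_word_matrix:
  "b < m \<Longrightarrow> right_word m Y v h a b = (\<Sum>b'<m. mat_word {..<m} Y v b b' * h a b')"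
proof (induction v arbitrary: b)
  case Nil
  then show ?case by (simp add: of_bool_def if_distrib[of "\<lambda>x. x * _"] cong: if_cong)
next
  case (Cons i v)
  have "right_word m Y (i # v) h a b = (\<Sum>t<m. Y i b t * (\<Sum>b'<m. mat_word {..<m} Y v t b' * h a b'))"
    using Cons by (simp add: right_op_def)
  also have "\<dots> = (\<Sum>b'<m. (\<Sum>t<m. Y i b t * mat_word {..<m} Y v t b') * h a b')"
    unfolding sum_distrib_left sum_distrib_right by (subst sum.swap) (simp add: mult_ac)
  finally show ?case by simp
qed

lemma bi_act_embed_right:
  assumes "b < m"
  shows "bi_act n m X Y (embed_right f) h a b = (\<Sum>b'<m. mat_eval (*) {..<m} Y f b b' * h a b')"
proof (induction f rule: poly_mapping_additive_induct)
  case (single v c)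
  then show ?case using assms
    by (simp add: bi_act_single bi_word_def right_word_matrix sum_distrib_left mult.assoc
      scalar_algebra.mat_eval_single[OF scalar_algebra_complex])
next
  case (add f g)
  then show ?case by (simp add: bi_act_add scalar_algebra.mat_eval_add[OF scalar_algebra_complex] distrib_right sum.distrib)
qed

section \<open>Inverting pointwise injective matrices\<close>

text \<open>The normalization says that setting the left variables to zero turns \<open>J\<close> into the identity matrix.\<close>
locale normalized_pencil =
  fixes J :: "'g::finite \<Rightarrow> 'g \<Rightarrow> 'g bi_poly"
  assumes injective: "bi_injective J"
    and slice_Nil: "slice [] (J i j) = of_bool (i = j)"
begin

text \<open>For \<open>v \<noteq> []\<close> these are the coefficients in \<open>J = 1 - \<Sum>v \<otimes> C v\<close>.\<close>
definition C :: "'g list \<Rightarrow> 'g \<Rightarrow> 'g \<Rightarrow> 'g free_poly" where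
  "C v j k = - slice v (J j k)"

definition len_bound :: nat where
  "len_bound = Suc (\<Sum>j\<in>UNIV. \<Sum>k\<in>UNIV. \<Sum>w\<in>keys (J j k). length (fst w))"

lemma lookup_long: "len_bound \<le> length u \<Longrightarrow> lookup (J j k) (u, v) = 0"
proof (rule ccontr)
  assume len_bound: "len_bound \<le> length u" and "lookup (J j k) (u, v) \<noteq> 0"
  then have "(u, v) \<in> keys (J j k)" by (simp add: in_keys_iff)
  then have "length (fst (u, v)) \<le> (\<Sum>w\<in>keys (J j k). length (fst w))"
    by (intro member_le_sum) auto
  also have "\<dots> \<le> (\<Sum>k\<in>UNIV. \<Sum>w\<in>keys (J j k). length (fst w))"
    by (rule member_le_sum) auto
  also have "\<dots> \<le> (\<Sum>j\<in>UNIV. \<Sum>k\<in>UNIV. \<Sum>w\<in>keys (J j k). length (fst w))"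
    by (rule member_le_sum[of j UNIV "\<lambda>j. \<Sum>k\<in>UNIV. \<Sum>w\<in>keys (J j k). length (fst w)"]) auto
  finally show False using len_bound by (simp add: len_bound_def)
qed

lemma C_long: "len_bound \<le> length u \<Longrightarrow> C u j k = 0"
  by (auto intro!: poly_mapping_eqI simp: C_def lookup_long)

lemma strip_long: "len_bound \<le> length u \<Longrightarrow> strip u (J j k) = 0"
  by (rule poly_mapping_eqI) (auto simp: lookup_long)

text \<open>The companion pencil lives on the states \<open>(v, j)\<close>: the entry at \<open>(v, j)\<close> stands for \<open>\<Sum>z. z \<otimes> C (v @ z)\<close> applied to a vector,
which is the part of \<open>J\<close> that remains after the letters of \<open>v\<close> have been read.\<close>
definition I :: "('g list \<times> 'g) set" where
  "I = {(v, j). v \<noteq> [] \<and> length v \<le> len_bound}"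

lemma finite_I: "finite I"
proof -
  have "finite {v :: 'g list. length v \<le> len_bound}"
    using finite_lists_length_le[of "UNIV :: 'g set" len_bound] by simp
  then have "finite ({v :: 'g list. length v \<le> len_bound} \<times> (UNIV :: 'g set))" by simp
  then show ?thesis by (rule rev_finite_subset) (auto simp: I_def)
qed

lemma letter_in_I [simp]: "([i], j) \<in> I"
  by (simp add: I_def len_bound_def)

definition A :: "'g \<Rightarrow> 'g list \<times> 'g \<Rightarrow> 'g list \<times> 'g \<Rightarrow> 'g free_poly" where
  "A i r s = of_bool (s = (fst r @ [i], snd r)) + (if fst s = [i] then C (fst r) (snd r) (snd s) else 0)"

text \<open>A state \<open>(v, j)\<close> either reads one more letter of the word or ends it, applying \<open>C v\<close>, and starts a new word.\<close>
lemma sum_A: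
  fixes F :: "'g free_poly \<Rightarrow> 'g list \<times> 'g \<Rightarrow> 'b::comm_monoid_add"
  assumes F: "\<And>x y s. F (x + y) s = F x s + F y s" "\<And>s. F 0 s = 0" and vj: "(v, j) \<in> I"
  shows "(\<Sum>s\<in>I. F (A i (v, j) s) s) =
    (if length v < len_bound then F 1 (v @ [i], j) else 0) + (\<Sum>k\<in>UNIV. F (C v j k) ([i], k))"
proof -
  have "(\<Sum>s\<in>I. F (A i (v, j) s) s) =
     (\<Sum>s\<in>I. if s = (v @ [i], j) then F 1 (v @ [i], j) else 0) +
     (\<Sum>s\<in>I. F (if fst s = [i] then C v j (snd s) else 0) s)"
    unfolding A_def F(1) sum.distrib by (intro arg_cong2[of _ _ _ _ "(+)"] sum.cong refl) (auto simp: F(2))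
  also have "(\<Sum>s\<in>I. if s = (v @ [i], j) then F 1 (v @ [i], j) else 0) = (if length v < len_bound then F 1 (v @ [i], j) else 0)"
    using finite_I vj by (auto simp: I_def)
  also have "(\<Sum>s\<in>I. F (if fst s = [i] then C v j (snd s) else 0) s) = (\<Sum>s\<in>Pair [i] ` UNIV. F (C v j (snd s)) s)"
    using finite_I by (intro sum.mono_neutral_cong_right) (auto simp: F(2))
  also have "\<dots> = (\<Sum>k\<in>UNIV. F (C v j k) ([i], k))"
    by (subst sum.reindex) (auto simp: inj_on_def)
  finally show ?thesis .
qed

subsection \<open>Injectivity of the pencil\<close>

text \<open>Let \<open>\<xi>\<close> be in the kernel of the pencil and let \<open>\<eta> = \<Sum>x i \<xi> [i]\<close>. Solving the equations of the long states first expresses every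
\<open>\<xi> v\<close> through \<open>\<eta>\<close>. Inserting this into the definition of \<open>\<eta>\<close> gives \<open>J \<eta> = 0\<close>, so \<open>\<eta> = 0\<close> and \<open>\<xi> = 0\<close>.\<close>
lemma pencil_kernel_trivial:
  fixes \<xi> :: "'g list \<times> 'g \<Rightarrow> nat \<Rightarrow> nat \<Rightarrow> complex"
  assumes sup: "\<And>r. supported n m (\<xi> r)" and out: "\<And>r. r \<notin> I \<Longrightarrow> \<xi> r = (\<lambda>_ _. 0)"
    and eq: "\<And>r. r \<in> I \<Longrightarrow> \<xi> r = (\<lambda>a b. \<Sum>i\<in>UNIV. bi_act n m X Y (single ([i], []) 1)
        (\<lambda>a b. \<Sum>s\<in>I. bi_act n m X Y (embed_right (A i r s)) (\<xi> s) a b) a b)"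
  shows "\<xi> r = (\<lambda>_ _. 0)"
proof -
  let ?x = "\<lambda>i. single ([i], []) 1 :: 'g bi_poly"
  let ?act = "bi_act n m X Y"
  have act0: "?act F (\<lambda>_ _. 0) = (\<lambda>_ _. 0)" for F
    using bi_act_sum_right[of n m X Y F "\<lambda>_ _ _. 0" "{}"] by simp
  define \<eta> where "\<eta> k = (\<lambda>a b. \<Sum>i\<in>UNIV. ?act (?x i) (\<xi> ([i], k)) a b)" for k
  have step: "\<xi> (v, j) = (\<lambda>a b. (\<Sum>i\<in>UNIV. ?act (?x i) (\<xi> (v @ [i], j)) a b) +
      (\<Sum>k\<in>UNIV. ?act (embed_right (C v j k)) (\<eta> k) a b))" if vj: "(v, j) \<in> I" for v j
  proof -
    have inner: "(\<lambda>a b. \<Sum>s\<in>I. ?act (embed_right (A i (v, j) s)) (\<xi> s) a b) =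
       (\<lambda>a b. \<xi> (v @ [i], j) a b + (\<Sum>k\<in>UNIV. ?act (embed_right (C v j k)) (\<xi> ([i], k)) a b))" for i
    proof (intro ext)
      fix a b
      have "\<xi> (v @ [i], j) a b = 0" if "\<not> length v < len_bound"
        using out[of "(v @ [i], j)"] that by (auto simp: I_def)
      then show "(\<Sum>s\<in>I. ?act (embed_right (A i (v, j) s)) (\<xi> s) a b) =
        \<xi> (v @ [i], j) a b + (\<Sum>k\<in>UNIV. ?act (embed_right (C v j k)) (\<xi> ([i], k)) a b)"
        using sum_A[of "\<lambda>p s. ?act (embed_right p) (\<xi> s) a b" v j i] vj by (auto simp: bi_act_add)
    qed
    have comm: "?act (?x i) (?act (embed_right p) h) = ?act (embed_right p) (?act (?x i) h)" for i p h
      using embed_commute[of "single [i] 1" p] by (simp add: bi_act_mult[symmetric])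
    show ?thesis
    proof (intro ext)
      fix a b
      have "\<xi> (v, j) a b = (\<Sum>i\<in>UNIV. ?act (?x i) (\<xi> (v @ [i], j)) a b +
          (\<Sum>k\<in>UNIV. ?act (embed_right (C v j k)) (?act (?x i) (\<xi> ([i], k))) a b))"
        by (subst eq[OF vj]) (simp add: inner bi_act_add_right bi_act_sum_right comm)
      also have "\<dots> = (\<Sum>i\<in>UNIV. ?act (?x i) (\<xi> (v @ [i], j)) a b) +
          (\<Sum>k\<in>UNIV. \<Sum>i\<in>UNIV. ?act (embed_right (C v j k)) (?act (?x i) (\<xi> ([i], k))) a b)"
        unfolding sum.distrib by (subst sum.swap) simp
      also have "\<dots> = (\<Sum>i\<in>UNIV. ?act (?x i) (\<xi> (v @ [i], j)) a b) +
          (\<Sum>k\<in>UNIV. ?act (embed_right (C v j k)) (\<eta> k) a b)"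
        by (simp add: \<eta>_def bi_act_sum_right)
      finally show "\<xi> (v, j) a b = (\<Sum>i\<in>UNIV. ?act (?x i) (\<xi> (v @ [i], j)) a b) +
          (\<Sum>k\<in>UNIV. ?act (embed_right (C v j k)) (\<eta> k) a b)" .
    qed
  qed
  have solve: "\<xi> (v, j) = (\<lambda>a b. \<Sum>k\<in>UNIV. ?act (- strip v (J j k)) (\<eta> k) a b)"
    if "v \<noteq> []" "length v + e = Suc len_bound" for v j e
    using that
  proof (induction e arbitrary: v)
    case 0
    then have "(v, j) \<notin> I" by (simp add: I_def)
    then show ?case using out strip_long[of v] 0 by simp
  next
    case (Suc e)
    then have vj: "(v, j) \<in> I" by (simp add: I_def)
    have IH: "\<xi> (v @ [i], j) = (\<lambda>a b. \<Sum>k\<in>UNIV. ?act (- strip (v @ [i]) (J j k)) (\<eta> k) a b)" for i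
      using Suc by simp
    have dec: "- strip v (J j k) = (\<Sum>i\<in>UNIV. ?x i * (- strip (v @ [i]) (J j k))) + embed_right (C v j k)" for k
    proof -
      have "embed_right (C v j k) = - embed_right (slice v (J j k))"
        using embed_simps(3)[of 0 "slice v (J j k)"] by (simp add: C_def)
      then show ?thesis by (subst strip_decompose) (simp add: sum_negf)
    qed
    show ?case
    proof (intro ext)
      fix a b
      have "\<xi> (v, j) a b = (\<Sum>i\<in>UNIV. \<Sum>k\<in>UNIV. ?act (?x i * (- strip (v @ [i]) (J j k))) (\<eta> k) a b) +
          (\<Sum>k\<in>UNIV. ?act (embed_right (C v j k)) (\<eta> k) a b)"
        by (subst step[OF vj]) (simp add: IH bi_act_sum_right bi_act_mult del: mult_minus_right)
      also have "(\<Sum>i\<in>UNIV. \<Sum>k\<in>UNIV. ?act (?x i * (- strip (v @ [i]) (J j k))) (\<eta> k) a b) =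
         (\<Sum>k\<in>UNIV. \<Sum>i\<in>UNIV. ?act (?x i * (- strip (v @ [i]) (J j k))) (\<eta> k) a b)"
        by (rule sum.swap)
      finally show "\<xi> (v, j) a b = (\<Sum>k\<in>UNIV. ?act (- strip v (J j k)) (\<eta> k) a b)"
        unfolding dec by (simp add: bi_act_add bi_act_sum sum.distrib)
    qed
  qed
  have Jx: "J j k = of_bool (j = k) - (\<Sum>i\<in>UNIV. ?x i * (- strip [i] (J j k)))" for j k
  proof -
    have "strip [] (J j k) = J j k" by (rule poly_mapping_eqI) auto
    moreover have "embed_right (slice [] (J j k)) = of_bool (j = k)" by (simp add: slice_Nil of_bool_def)
    ultimately show ?thesis using strip_decompose[of "[]" "J j k"] by (simp add: sum_negf)
  qed
  have \<eta>0: "\<eta> k a b = 0" for k a b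
  proof -
    have "(\<Sum>k\<in>UNIV. ?act (J j k) (\<eta> k) a b) = 0" for j a b
    proof -
      have "\<eta> j a b = (\<Sum>i\<in>UNIV. \<Sum>k\<in>UNIV. ?act (?x i * (- strip [i] (J j k))) (\<eta> k) a b)"
        using solve[of "[_]" len_bound] by (subst \<eta>_def) (simp add: bi_act_sum_right bi_act_mult del: mult_minus_right)
      also have "\<dots> = (\<Sum>k\<in>UNIV. \<Sum>i\<in>UNIV. ?act (?x i * (- strip [i] (J j k))) (\<eta> k) a b)"
        by (rule sum.swap)
      also have "\<dots> = (\<Sum>k\<in>UNIV. ?act (\<Sum>i\<in>UNIV. ?x i * (- strip [i] (J j k))) (\<eta> k) a b)"
        by (simp add: bi_act_sum)
      finally have *: "\<eta> j a b = \<dots>" .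
      have "?act (of_bool (j = k)) (\<eta> k) a b = (if k = j then \<eta> j a b else 0)" for k by auto
      then have "(\<Sum>k\<in>UNIV. ?act (of_bool (j = k)) (\<eta> k) a b) = \<eta> j a b" by simp
      then show ?thesis by (subst Jx) (simp add: bi_act_diff sum_subtractf * [symmetric] del: mult_minus_right)
    qed
    moreover have "supported n m (\<eta> k)" for k
    proof -
      have "supported n m (?act (?x i) (\<xi> ([i], k)))" for i
        by (rule bi_act_supported[OF sup])
      then show ?thesis by (simp add: \<eta>_def supported_def)
    qed
    ultimately show ?thesis using injective unfolding bi_injective_def by blast
  qed
  show ?thesis
  proof (cases "r \<in> I")
    case True
    obtain v j where r: "r = (v, j)" by (cases r)
    have "\<eta> = (\<lambda>_ _ _. 0)" using \<eta>0 by (simp add: fun_eq_iff)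
    then show ?thesis using True solve[of v "Suc len_bound - length v" j] by (simp add: r I_def act0)
  qed (use out in auto)
qed

text \<open>An eigenvector \<open>T\<close> of \<open>T \<mapsto> \<Sum>A i(Y) T A i(Y)*\<close> for the eigenvalue \<open>l \<noteq> 0\<close> is a kernel vector of the pencil at the point whose left
matrices are the conjugates of \<open>A i(Y)\<close> divided by \<open>l\<close>: multiplication by \<open>A i(Y)*\<close> acts on the second index of \<open>T\<close>.\<close>
lemma mat_word_nilpotent_at_points:
  fixes m :: nat
  assumes "card (I \<times> {..<m}) * card (I \<times> {..<m}) \<le> length u" and rs: "r \<in> I" "s \<in> I" and b: "b < m" "b' < m"
  shows "mat_eval (*) {..<m} Y (mat_word I A u r s) b b' = 0"
proof -
  define Q where "Q = I \<times> {..<m}"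
  have finQ: "finite Q" using finite_I by (simp add: Q_def)
  define a where "a i = (\<lambda>(r, b) (s, b'). mat_eval (*) {..<m} Y (A i r s) b b')" for i
  obtain e where e: "bij_betw e {0..<card Q} Q" using ex_bij_betw_nat_finite[OF finQ] by blast
  define n where "n = card Q"
  have e: "bij_betw e {..<n} Q" using e by (simp add: n_def lessThan_atLeast0)
  have "mat_word Q a u (r, b) (s, b') = 0"
  proof (rule completely_positive_nilpotent[OF finQ])
    fix l T q q'
    assume l: "l \<noteq> 0" and T0: "\<And>q q'. q \<notin> Q \<or> q' \<notin> Q \<Longrightarrow> T q q' = (0::complex)"
      and eig: "\<And>q q'. q \<in> Q \<Longrightarrow> q' \<in> Q \<Longrightarrow>
        (\<Sum>i\<in>UNIV. \<Sum>s\<in>Q. \<Sum>s'\<in>Q. a i q s * T s s' * cnj (a i q' s')) = l * T q q'"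
      and q: "q \<in> Q" "q' \<in> Q"
    \<comment> \<open>the left matrices are indexed by numbers, so \<open>Q\<close> is enumerated by \<open>e\<close>\<close>
    define X where "X i k k' = cnj (a i (e k) (e k')) / l" for i k k'
    define \<xi> where "\<xi> r = (\<lambda>k b. if k < n \<and> b < m then T (r, b) (e k) else 0)" for r
    have "\<xi> r = (\<lambda>_ _. 0)" for r
    proof (rule pencil_kernel_trivial[where n = n and m = m and X = X and Y = Y])
      show sup: "supported n m (\<xi> r)" for r by (auto simp: supported_def \<xi>_def)
      show "\<xi> r = (\<lambda>_ _. 0)" if "r \<notin> I" for r
        using that T0 by (auto simp: \<xi>_def Q_def fun_eq_iff)
      fix r assume r: "r \<in> I"
      let ?f = "\<lambda>i k b. \<Sum>s\<in>I. bi_act n m X Y (embed_right (A i r s)) (\<xi> s) k b"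
      have sf: "supported n m (?f i)" for i
      proof -
        have "supported n m (bi_act n m X Y (embed_right (A i r s)) (\<xi> s))" for s
          by (rule bi_act_supported[OF sup])
        then show ?thesis by (simp add: supported_def)
      qed
      have act: "bi_act n m X Y (single ([i], []) 1) h k b = (if k < n then \<Sum>k'<n. X i k k' * h k' b else 0)" for i h k b
        by (simp add: bi_act_single bi_word_def left_op_def)
      show "\<xi> r = (\<lambda>k b. \<Sum>i\<in>UNIV. bi_act n m X Y (single ([i], []) 1) (?f i) k b)"
      proof (intro ext)
        fix k b
        show "\<xi> r k b = (\<Sum>i\<in>UNIV. bi_act n m X Y (single ([i], []) 1) (?f i) k b)"
        proof (cases "k < n \<and> b < m")
          case False
          then have "bi_act n m X Y (single ([i], []) 1) (?f i) k b = 0" for i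
            using bi_act_supported[OF sf[of i], of X Y "single ([i], []) 1"] unfolding supported_def
            by (meson not_le)
          moreover have "\<xi> r k b = 0" using False by (auto simp: \<xi>_def)
          ultimately show ?thesis by simp
        next
          case True
          have ek: "e k \<in> Q" using e True by (auto simp: bij_betw_def)
          have rb: "(r, b) \<in> Q" using r True by (simp add: Q_def)
          have f: "?f i k' b = (\<Sum>s\<in>Q. a i (r, b) s * T s (e k'))" if "k' < n" for i k'
          proof -
            have "?f i k' b = (\<Sum>s\<in>I. \<Sum>b'<m. mat_eval (*) {..<m} Y (A i r s) b b' * T (s, b') (e k'))"
              using True that by (simp add: bi_act_embed_right \<xi>_def)
            then show ?thesis by (simp add: Q_def sum.cartesian_product a_def case_prod_beta)
          qed
          have "(\<Sum>i\<in>UNIV. bi_act n m X Y (single ([i], []) 1) (?f i) k b) =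
             (\<Sum>i\<in>UNIV. \<Sum>k'<n. X i k k' * (\<Sum>s\<in>Q. a i (r, b) s * T s (e k')))"
            using True f by (simp add: act)
          also have "\<dots> = (\<Sum>i\<in>UNIV. \<Sum>s'\<in>Q. cnj (a i (e k) s') / l * (\<Sum>s\<in>Q. a i (r, b) s * T s s'))"
            unfolding X_def by (intro sum.cong refl sum.reindex_bij_betw[OF e])
          also have "\<dots> = (\<Sum>i\<in>UNIV. \<Sum>s'\<in>Q. \<Sum>s\<in>Q. a i (r, b) s * T s s' * cnj (a i (e k) s')) / l"
            by (simp add: sum_distrib_left sum_divide_distrib mult_ac)
          also have "(\<Sum>i\<in>UNIV. \<Sum>s'\<in>Q. \<Sum>s\<in>Q. a i (r, b) s * T s s' * cnj (a i (e k) s')) =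
              (\<Sum>i\<in>UNIV. \<Sum>s\<in>Q. \<Sum>s'\<in>Q. a i (r, b) s * T s s' * cnj (a i (e k) s'))"
            by (intro sum.cong refl sum.swap)
          also have "\<dots> / l = T (r, b) (e k)" using eig[OF rb ek] l by simp
          finally show ?thesis using True by (simp add: \<xi>_def)
        qed
      qed
    qed
    then have \<xi>0: "\<xi> r k b = 0" for r k b by simp
    obtain r b where "q = (r, b)" "b < m" using q(1) by (auto simp: Q_def)
    moreover obtain k where "k < n" "q' = e k" using q(2) e by (auto simp: bij_betw_def)
    ultimately show "T q q' = 0" using \<xi>0[of r k b] by (simp add: \<xi>_def)
  qed (use assms in \<open>auto simp: Q_def\<close>)
  then show ?thesis
    using scalar_algebra.mat_eval_mat_word[OF scalar_algebra_complex finite_I, of "{..<m}" r b s b' Y A u] rs b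
    unfolding a_def[abs_def] Q_def by simp
qed

lemma mat_word_A_nilpotent:
  "card I \<le> length u \<Longrightarrow> r \<in> I \<Longrightarrow> s \<in> I \<Longrightarrow> mat_word I A u r s = 0"
  by (rule free_matrix_nil_index[OF finite_I, where M = "\<lambda>m. card (I \<times> {..<m}) * card (I \<times> {..<m})"])
     (auto intro: mat_word_nilpotent_at_points)

subsection \<open>The inverse\<close>

text \<open>The coefficient of \<open>u\<close> in the formal series \<open>\<Sum>z. z \<otimes> C (v @ z)\<close> times the inverse of \<open>J\<close>; the words in the companion matrices compute
it.\<close>
definition tail_coeff :: "'g list \<Rightarrow> 'g list \<Rightarrow> 'g \<Rightarrow> 'g \<Rightarrow> 'g free_poly" where
  "tail_coeff v u j l = (if length v \<le> len_bound then \<Sum>s\<in>I. mat_word I A u (v, j) s * C (fst s) (snd s) l else 0)"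

primrec inv_coeff :: "'g list \<Rightarrow> 'g \<Rightarrow> 'g \<Rightarrow> 'g free_poly" where
  "inv_coeff [] j l = of_bool (j = l)"
| "inv_coeff (i # u) j l = tail_coeff [i] u j l"

text \<open>For \<open>v = [i]\<close> this is the recursion \<open>k u = \<Sum>u = v @ w. C v k w\<close>, over nonempty \<open>v\<close>, for the coefficients \<open>k u\<close> of the
inverse of \<open>1 - \<Sum>v \<otimes> C v\<close>.\<close>
lemma tail_coeff_expand:
  assumes "v \<noteq> []"
  shows "tail_coeff v u j l = (\<Sum>n\<le>length u. \<Sum>k\<in>UNIV. C (v @ take n u) j k * inv_coeff (drop n u) k l)"
  using assms
proof (induction u arbitrary: v)
  case Nil
  have "(\<Sum>k\<in>UNIV. C v j k * of_bool (k = l)) = (\<Sum>k\<in>UNIV. if k = l then C v j l else 0)"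
    by (intro sum.cong) auto
  moreover have "tail_coeff v [] j l = C v j l"
  proof (cases "length v \<le> len_bound")
    case True
    then have "(v, j) \<in> I" using Nil by (simp add: I_def)
    have "tail_coeff v [] j l = (\<Sum>s\<in>I. if s = (v, j) then C v j l else 0)"
      using True unfolding tail_coeff_def mat_word.simps by (auto intro!: sum.cong)
    then show ?thesis using \<open>(v, j) \<in> I\<close> finite_I by simp
  next
    case False
    then show ?thesis by (simp add: tail_coeff_def C_long)
  qed
  ultimately show ?case by simp
next
  case (Cons i u)
  have "(\<Sum>n\<le>length (i # u). \<Sum>k\<in>UNIV. C (v @ take n (i # u)) j k * inv_coeff (drop n (i # u)) k l) =
     (\<Sum>k\<in>UNIV. C v j k * inv_coeff (i # u) k l) +
     (\<Sum>n\<le>length u. \<Sum>k\<in>UNIV. C ((v @ [i]) @ take n u) j k * inv_coeff (drop n u) k l)"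
    by (simp only: list.size(4) add_0_right add_Suc_right sum.atMost_Suc_shift) simp
  also have "\<dots> = (\<Sum>k\<in>UNIV. C v j k * tail_coeff [i] u k l) + tail_coeff (v @ [i]) u j l"
    using Cons.IH[of "v @ [i]"] by simp
  finally have rhs: "(\<Sum>n\<le>length (i # u). \<Sum>k\<in>UNIV. C (v @ take n (i # u)) j k * inv_coeff (drop n (i # u)) k l) =
     (\<Sum>k\<in>UNIV. C v j k * tail_coeff [i] u k l) + tail_coeff (v @ [i]) u j l" .
  show ?case
  proof (cases "length v \<le> len_bound")
    case True
    then have vj: "(v, j) \<in> I" using Cons by (simp add: I_def)
    let ?g = "\<lambda>t. \<Sum>s\<in>I. mat_word I A u t s * C (fst s) (snd s) l"
    have "tail_coeff v (i # u) j l = (\<Sum>t\<in>I. A i (v, j) t * ?g t)"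
      using True unfolding tail_coeff_def mat_word.simps
      by (simp add: sum_distrib_left sum_distrib_right mult.assoc) (rule sum.swap)
    also have "\<dots> = (if length v < len_bound then ?g (v @ [i], j) else 0) + (\<Sum>k\<in>UNIV. C v j k * ?g ([i], k))"
      using sum_A[of "\<lambda>p t. p * ?g t" v j i] vj by (simp add: distrib_right)
    finally show ?thesis unfolding rhs by (simp add: tail_coeff_def len_bound_def add.commute Suc_le_eq)
  next
    case False
    then show ?thesis unfolding rhs by (simp add: tail_coeff_def C_long)
  qed
qed

lemma inv_coeff_long: "card I < length u \<Longrightarrow> inv_coeff u j l = 0"
proof (cases u)
  case (Cons i w)
  moreover assume "card I < length u"
  ultimately have "mat_word I A w ([i], j) s = 0" if "s \<in> I" for s
    using that by (intro mat_word_A_nilpotent) auto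
  then show ?thesis by (simp add: Cons tail_coeff_def)
qed simp

definition K :: "'g \<Rightarrow> 'g \<Rightarrow> 'g bi_poly" where
  "K j l = (\<Sum>u | length u \<le> card I. single (u, []) 1 * embed_right (inv_coeff u j l))"

lemma slice_K: "slice u (K j l) = inv_coeff u j l"
proof -
  have "finite {u :: 'g list. length u \<le> card I}"
    using finite_lists_length_le[of "UNIV :: 'g set" "card I"] by simp
  then show ?thesis
    by (simp add: K_def slice_sum slice_left_letters_mult_embed_right inv_coeff_long)
qed

lemma slice_of_bool:
  fixes u :: "'g list"
  shows "slice u (of_bool b) = of_bool (u = [] \<and> b)"
proof -
  have "slice u (1 :: 'g bi_poly) = of_bool (u = [])"
    using slice_embed_right[of u "1 :: 'g free_poly"] by simp
  then show ?thesis by auto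
qed

lemma right_inverse: "(\<Sum>j\<in>UNIV. J i j * K j l) = of_bool (i = l)"
proof (rule slice_eqI)
  fix u
  have "slice u (\<Sum>j\<in>UNIV. J i j * K j l) =
      (\<Sum>j\<in>UNIV. \<Sum>n\<le>length u. slice (take n u) (J i j) * inv_coeff (drop n u) j l)"
    by (simp add: slice_sum slice_mult slice_K)
  also have "\<dots> = (\<Sum>n\<le>length u. \<Sum>j\<in>UNIV. slice (take n u) (J i j) * inv_coeff (drop n u) j l)"
    by (rule sum.swap)
  also have "\<dots> = of_bool (u = [] \<and> i = l)"
  proof (cases u)
    case Nil
    have "(\<Sum>j\<in>UNIV. of_bool (i = j) * of_bool (j = l)) = (\<Sum>j\<in>UNIV. if j = l then of_bool (i = l) else (0 :: 'g free_poly))"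
      by (intro sum.cong) auto
    then show ?thesis using Nil by (simp add: slice_Nil)
  next
    case (Cons a w)
    have "(\<Sum>n\<le>length u. \<Sum>j\<in>UNIV. slice (take n u) (J i j) * inv_coeff (drop n u) j l) =
       (\<Sum>j\<in>UNIV. of_bool (i = j) * inv_coeff u j l) - (\<Sum>n\<le>length w. \<Sum>j\<in>UNIV. C ([a] @ take n w) i j * inv_coeff (drop n w) j l)"
      unfolding Cons list.size(4) add_0_right add_Suc_right sum.atMost_Suc_shift
      by (simp add: slice_Nil C_def sum_negf del: inv_coeff.simps)
    also have "(\<Sum>j\<in>UNIV. of_bool (i = j) * inv_coeff u j l) = (\<Sum>j\<in>UNIV. if j = i then inv_coeff u i l else 0)"
      by (intro sum.cong) auto
    also have "(\<Sum>n\<le>length w. \<Sum>j\<in>UNIV. C ([a] @ take n w) i j * inv_coeff (drop n w) j l) = inv_coeff u i l"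
      using tail_coeff_expand[of "[a]" w i l] by (simp add: Cons)
    finally show ?thesis by (simp add: Cons)
  qed
  finally show "slice u (\<Sum>j\<in>UNIV. J i j * K j l) = slice u (of_bool (i = l))"
    by (simp add: slice_of_bool)
qed

text \<open>Since \<open>J\<close> is the identity plus terms that contain left letters, the coefficient of a shortest left word of \<open>E\<close> survives in
\<open>J E\<close>.\<close>
lemma left_cancel:
  assumes "\<And>i. (\<Sum>j\<in>UNIV. J i j * E j) = 0"
  shows "E i = 0"
proof -
  have "slice u (E i) = 0" for u i
  proof (induction "length u" arbitrary: u i rule: less_induct)
    case less
    have "0 = slice u (\<Sum>j\<in>UNIV. J i j * E j)" using assms by simp
    also have "\<dots> = (\<Sum>j\<in>UNIV. \<Sum>n\<le>length u. slice (take n u) (J i j) * slice (drop n u) (E j))"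
      by (simp add: slice_sum slice_mult)
    also have "\<dots> = (\<Sum>j\<in>UNIV. \<Sum>n\<le>length u. if n = 0 then of_bool (i = j) * slice u (E j) else 0)"
    proof (intro sum.cong refl)
      fix j n assume n: "n \<in> {..length u}"
      show "slice (take n u) (J i j) * slice (drop n u) (E j) = (if n = 0 then of_bool (i = j) * slice u (E j) else 0)"
      proof (cases "n = 0")
        case False
        then have "length (drop n u) < length u" using n by auto
        then show ?thesis using less False by simp
      qed (simp add: slice_Nil)
    qed
    also have "\<dots> = (\<Sum>j\<in>UNIV. if j = i then slice u (E i) else 0)"
      by (intro sum.cong) auto
    finally show ?case by simp
  qed
  then show ?thesis by (intro slice_eqI) simp
qed

text \<open>\<open>J (K J - 1) = 0\<close>, and \<open>J\<close> can be cancelled.\<close>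
lemma left_inverse: "(\<Sum>j\<in>UNIV. K i j * J j l) = of_bool (i = l)"
proof -
  define E where "E i = (\<Sum>j\<in>UNIV. K i j * J j l) - of_bool (i = l)" for i
  have "(\<Sum>i\<in>UNIV. J h i * E i) = 0" for h
  proof -
    have "(\<Sum>i\<in>UNIV. J h i * (\<Sum>j\<in>UNIV. K i j * J j l)) = (\<Sum>j\<in>UNIV. (\<Sum>i\<in>UNIV. J h i * K i j) * J j l)"
      unfolding sum_distrib_left sum_distrib_right by (subst sum.swap) (simp add: mult.assoc)
    also have "\<dots> = (\<Sum>j\<in>UNIV. if j = h then J h l else 0)"
      by (intro sum.cong) (auto simp: right_inverse)
    finally have 1: "(\<Sum>i\<in>UNIV. J h i * (\<Sum>j\<in>UNIV. K i j * J j l)) = J h l" by simp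
    have "(\<Sum>i\<in>UNIV. J h i * of_bool (i = l)) = (\<Sum>i\<in>UNIV. if i = l then J h l else 0)"
      by (intro sum.cong) auto
    then show ?thesis using 1 by (simp add: E_def right_diff_distrib sum_subtractf)
  qed
  then have "E i = 0" by (rule left_cancel)
  then show ?thesis by (simp add: E_def)
qed

end

section \<open>Reduction to the normalized case\<close>

definition mat_times :: "('i::finite \<Rightarrow> 'i \<Rightarrow> 'r::ring_1) \<Rightarrow> ('i \<Rightarrow> 'i \<Rightarrow> 'r) \<Rightarrow> 'i \<Rightarrow> 'i \<Rightarrow> 'r" where
  "mat_times A B i j = (\<Sum>k\<in>UNIV. A i k * B k j)"

definition mat_unit :: "'i \<Rightarrow> 'i \<Rightarrow> 'r::ring_1" where
  "mat_unit i j = of_bool (i = j)"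

lemma mat_times_assoc: "mat_times (mat_times A B) C = mat_times A (mat_times B C)"
proof (intro ext)
  fix i j
  show "mat_times (mat_times A B) C i j = mat_times A (mat_times B C) i j"
    unfolding mat_times_def sum_distrib_left sum_distrib_right
    by (subst sum.swap) (simp add: mult.assoc)
qed

lemma mat_times_unit [simp]: "mat_times mat_unit A = A" "mat_times A mat_unit = A"
proof -
  have "of_bool (i = k) * A k j = (if k = i then A i j else 0)" "A i k * of_bool (k = j) = (if k = j then A i j else 0)" for i j k
    by auto
  then show "mat_times mat_unit A = A" "mat_times A mat_unit = A"
    by (simp_all add: mat_times_def mat_unit_def fun_eq_iff)
qed

lemma mat_times_hom:
  assumes "\<And>x y. h (x * y) = h x * h y" "\<And>(f :: 'i::finite \<Rightarrow> _) S. h (\<Sum>k\<in>S. f k) = (\<Sum>k\<in>S. h (f k))"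
  shows "(\<lambda>i j. h (mat_times A B i j)) = mat_times (\<lambda>i j. h (A i j)) (\<lambda>(i::'i) j. h (B i j))"
  by (simp add: mat_times_def assms fun_eq_iff)

lemma mat_unit_hom: "h 1 = 1 \<Longrightarrow> h 0 = 0 \<Longrightarrow> (\<lambda>i j. h (mat_unit i j)) = mat_unit"
  by (auto simp: mat_unit_def fun_eq_iff)

lemma embed_mat_times:
  "(\<lambda>i j. embed_right (mat_times A B i j)) = mat_times (\<lambda>i j. embed_right (A i j)) (\<lambda>i j. embed_right (B i j))"
  "(\<lambda>i j. embed_left (mat_times A B i j)) = mat_times (\<lambda>i j. embed_left (A i j)) (\<lambda>i j. embed_left (B i j))"
  by (rule mat_times_hom; simp add: embed_sum)+

lemma embed_mat_unit: "(\<lambda>i j. embed_right (mat_unit i j)) = mat_unit" "(\<lambda>i j. embed_left (mat_unit i j)) = mat_unit"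
  by (rule mat_unit_hom; simp)+

text \<open>Multiplying \<open>J\<close> from the left by a matrix that has a left inverse does not change the kernels.\<close>
lemma bi_injective_left_times:
  assumes J: "bi_injective J" and LM: "mat_times L M = mat_unit"
  shows "bi_injective (mat_times M J)"
  unfolding bi_injective_def
proof (intro allI impI)
  fix n m X Y H j a b
  assume sup: "\<forall>j. supported n m (H j)"
    and eq: "\<forall>i a b. (\<Sum>j\<in>UNIV. bi_act n m X Y (mat_times M J i j) (H j) a b) = 0"
  let ?act = "bi_act n m X Y"
  have act0: "?act F (\<lambda>_ _. 0) = (\<lambda>_ _. 0)" for F
    using bi_act_sum_right[of n m X Y F "\<lambda>_ _ _. 0" "{}"] by simp
  define G where "G k = (\<lambda>a b. \<Sum>j\<in>UNIV. ?act (J k j) (H j) a b)" for k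
  have MG: "(\<lambda>a b. \<Sum>k\<in>UNIV. ?act (M i k) (G k) a b) = (\<lambda>a b. 0)" for i
  proof (intro ext)
    fix a b
    have "0 = (\<Sum>j\<in>UNIV. \<Sum>k\<in>UNIV. ?act (M i k) (?act (J k j) (H j)) a b)"
      using eq by (simp add: mat_times_def bi_act_sum bi_act_mult)
    also have "\<dots> = (\<Sum>k\<in>UNIV. \<Sum>j\<in>UNIV. ?act (M i k) (?act (J k j) (H j)) a b)"
      by (rule sum.swap)
    also have "\<dots> = (\<Sum>k\<in>UNIV. ?act (M i k) (G k) a b)"
      by (simp add: G_def bi_act_sum_right)
    finally show "(\<Sum>k\<in>UNIV. ?act (M i k) (G k) a b) = 0" by simp
  qed
  have "G l a b = 0" for l a b
  proof -
    have "0 = (\<Sum>i\<in>UNIV. ?act (L l i) (\<lambda>a b. \<Sum>k\<in>UNIV. ?act (M i k) (G k) a b) a b)"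
      by (simp add: MG act0)
    also have "\<dots> = (\<Sum>i\<in>UNIV. \<Sum>k\<in>UNIV. ?act (L l i * M i k) (G k) a b)"
      by (simp add: bi_act_sum_right bi_act_mult)
    also have "\<dots> = (\<Sum>k\<in>UNIV. \<Sum>i\<in>UNIV. ?act (L l i * M i k) (G k) a b)"
      by (rule sum.swap)
    also have "\<dots> = (\<Sum>k\<in>UNIV. ?act (mat_times L M l k) (G k) a b)"
      by (simp add: mat_times_def bi_act_sum)
    also have "\<dots> = (\<Sum>k\<in>UNIV. if k = l then G l a b else 0)"
      unfolding LM by (intro sum.cong) (auto simp: mat_unit_def)
    finally show ?thesis by simp
  qed
  then have "\<forall>i a b. (\<Sum>j\<in>UNIV. ?act (J i j) (H j) a b) = 0" by (simp add: G_def)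
  with J sup show "H j a b = 0" unfolding bi_injective_def by blast
qed

theorem normalized_bi_inverse:
  assumes "bi_injective J" "\<And>i j. slice [] (J i j) = of_bool (i = j)"
  shows "\<exists>K. mat_times J K = mat_unit \<and> mat_times K J = mat_unit"
proof -
  interpret normalized_pencil J by unfold_locales (use assms in auto)
  have "mat_times J K = mat_unit" "mat_times K J = mat_unit"
    by (auto simp: mat_times_def mat_unit_def right_inverse left_inverse fun_eq_iff)
  then show ?thesis by blast
qed

lemma pm_scale_zero [simp]: "pm_scale c 0 = 0"
  by (simp add: pm_scale_def)

text \<open>Setting the right variables to zero is a ring homomorphism.\<close>
definition project_left :: "'g bi_poly \<Rightarrow> 'g free_poly" where
  "project_left = lin_ext pm_scale (\<lambda>(u, v). if v = [] then single u 1 else 0)"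

lemma project_left_simps [simp]:
  "project_left (F + G) = project_left F + project_left G"
  "project_left (F * G) = project_left F * project_left G"
  "project_left (single (u, v) c) = (if v = [] then single u c else 0)"
  "project_left 0 = 0"
proof -
  show "project_left (F * G) = project_left F * project_left G"
    unfolding project_left_def
    by (rule scalar_algebra.lin_ext_mult[OF scalar_algebra_pm_scale]) (auto simp: plus_list_def mult_single)
qed (simp_all add: project_left_def lin_ext_add lin_ext_single lin_ext_zero module_pm_scale)

lemma project_left_one [simp]: "project_left 1 = 1"
proof -
  have "project_left (single ([], []) 1) = single [] 1" by simp
  then show ?thesis by (metis single_one zero_bi zero_list_def)
qed

lemma project_left_sum: "project_left (\<Sum>x\<in>S. F x) = (\<Sum>x\<in>S. project_left (F x))"
  by (induction S rule: infinite_finite_induct) auto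

lemma project_embed_left [simp]: "project_left (embed_left f) = f"
  by (induction f rule: poly_mapping_additive_induct) auto

text \<open>At left matrices of size one that are all zero, only the slice at the empty left word acts, and it acts on a single row. Transposing
this row into the \<open>c\<close>-th column turns the right variables into left ones.\<close>
lemma bi_act_at_zero:
  "bi_act 1 n (\<lambda>_ _ _. 0) X F (\<lambda>a b. if a = 0 then h b c else 0) 0 b =
     bi_act n m X Y (embed_left (slice [] F)) h b c"
proof (induction F rule: poly_mapping_additive_induct)
  case (single k d)
  obtain u v where k: "k = (u, v)" by (cases k)
  show ?case
  proof (cases u)
    case Nil
    have "right_word n X v (\<lambda>a b. if a = 0 then h b c else 0) 0 b = left_word n X v h b c" for b
      by (induction v arbitrary: b) (auto simp: right_op_def left_op_def)
    then show ?thesis by (simp add: k Nil bi_act_single slice_single bi_word_def)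
  next
    case (Cons i u')
    then show ?thesis by (simp add: k bi_act_single slice_single bi_word_def left_op_def)
  qed
next
  case (add F G)
  then show ?case by (simp add: bi_act_add)
qed

text \<open>The normalized case is used twice. At left variables zero \<open>J\<close> becomes a matrix \<open>J0\<close> over the free algebra, which is normalized when its
variables are regarded as left ones, because its constant term is the identity; let \<open>B\<close> be its inverse. The matrix \<open>B J\<close> is then
normalized with respect to the left variables of \<open>J\<close>, and \<open>J = J0 (B J)\<close>.\<close>
theorem bi_inverse:
  fixes J :: "'g::finite \<Rightarrow> 'g \<Rightarrow> 'g bi_poly"
  assumes J: "bi_injective J" and const: "\<And>i j. lookup (J i j) ([], []) = of_bool (i = j)"
  obtains K B where "mat_times J K = mat_unit" "mat_times B (\<lambda>i j. slice [] (J i j)) = mat_unit"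
proof -
  define J0 where "J0 i j = slice [] (J i j)" for i j
  have "bi_injective (\<lambda>i j. embed_left (J0 i j))"
    unfolding bi_injective_def
  proof (intro allI impI)
    fix n m X Y H j a b
    assume sup: "\<forall>j. supported n m (H j)"
      and eq: "\<forall>i a b. (\<Sum>j\<in>UNIV. bi_act n m X Y (embed_left (J0 i j)) (H j) a b) = 0"
    define H' where "H' j = (\<lambda>(a' :: nat) b'. if a' = 0 then H j b' b else (0 :: complex))" for j
    have supH: "supported 1 n (H' j)" for j
      using sup by (auto simp: supported_def H'_def)
    have zero: "bi_act 1 n (\<lambda>_ _ _. 0) X (J i j) (H' j) 0 b' = bi_act n m X Y (embed_left (J0 i j)) (H j) b' b" for i j b'
      unfolding H'_def J0_def by (rule bi_act_at_zero)
    have "(\<Sum>j\<in>UNIV. bi_act 1 n (\<lambda>_ _ _. 0) X (J i j) (H' j) a' b') = 0" for i a' b'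
    proof (cases "a' = 0")
      case True
      then show ?thesis using eq by (simp add: zero del: One_nat_def)
    next
      case False
      then have "bi_act 1 n (\<lambda>_ _ _. 0) X (J i j) (H' j) a' b' = 0" for j
        using bi_act_supported[OF supH[of j], of "\<lambda>_ _ _. 0" X "J i j"] by (auto simp: supported_def)
      then show ?thesis by simp
    qed
    then have "H' j 0 a = 0" using J supH unfolding bi_injective_def by blast
    then show "H j a b = 0" by (simp add: H'_def)
  qed
  moreover have "slice [] (embed_left (J0 i j)) = of_bool (i = j)" for i j
  proof -
show ?thesis by (simp add: slice_Nil_embed_left J0_def const single_Nil_one)
  qed
  ultimately obtain K1 where K1: "mat_times (\<lambda>i j. embed_left (J0 i j)) K1 = mat_unit"
      "mat_times K1 (\<lambda>i j. embed_left (J0 i j)) = mat_unit"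
    using normalized_bi_inverse[of "\<lambda>i j. embed_left (J0 i j)"] by blast
  define B where "B i j = project_left (K1 i j)" for i j
  have proj: "(\<lambda>i j. project_left (mat_times P Q i j)) = mat_times (\<lambda>i j. project_left (P i j)) (\<lambda>i j. project_left (Q i j))" for P Q :: "'g \<Rightarrow> 'g \<Rightarrow> 'g bi_poly"
    by (rule mat_times_hom) (simp_all add: project_left_sum)
  have pu: "(\<lambda>(i :: 'g) j. project_left (mat_unit i j)) = mat_unit" by (rule mat_unit_hom) simp_all
  have J0B: "mat_times J0 B = mat_unit" and BJ0: "mat_times B J0 = mat_unit"
    using arg_cong[OF K1(1), of "\<lambda>M i j. project_left (M i j)"] arg_cong[OF K1(2), of "\<lambda>M i j. project_left (M i j)"]
    by (simp_all add: proj pu B_def[abs_def])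
  define J2 where "J2 = mat_times (\<lambda>i j. embed_right (B i j)) J"
  have "bi_injective J2"
    unfolding J2_def
  proof (rule bi_injective_left_times[OF J])
    show "mat_times (\<lambda>i j. embed_right (J0 i j)) (\<lambda>i j. embed_right (B i j)) = mat_unit"
      using J0B by (simp add: embed_mat_times(1)[symmetric] embed_mat_unit)
  qed
  moreover have "slice [] (J2 i j) = of_bool (i = j)" for i j
  proof -
    have "slice [] (J2 i j) = mat_times B J0 i j"
      by (simp add: J2_def mat_times_def slice_sum slice_mult slice_embed_right J0_def)
    then show ?thesis by (simp add: BJ0 mat_unit_def)
  qed
  ultimately obtain K2 where K2: "mat_times J2 K2 = mat_unit" using normalized_bi_inverse[of J2] by blast
  define K where "K = mat_times K2 (\<lambda>i j. embed_right (B i j))"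
  have "mat_times (\<lambda>i j. embed_right (J0 i j)) J2 = J"
    using J0B by (simp add: J2_def mat_times_assoc[symmetric] embed_mat_times(1)[symmetric] embed_mat_unit)
  then have "mat_times J K = mat_times (mat_times (\<lambda>i j. embed_right (J0 i j)) J2) K" by simp
  also have "\<dots> = mat_times (\<lambda>i j. embed_right (J0 i j)) (mat_times (mat_times J2 K2) (\<lambda>i j. embed_right (B i j)))"
    by (simp only: K_def mat_times_assoc)
  also have "\<dots> = mat_unit"
    using J0B by (simp add: K2 embed_mat_times(1)[symmetric] embed_mat_unit)
  finally show ?thesis using that[of K B] BJ0 by (simp add: J0_def[abs_def])
qed

section \<open>The Jacobian of an injective map\<close>

text \<open>The free difference quotient: the sum of \<open>u \<otimes> v\<close> over all factorizations \<open>w = u @ [j] @ v\<close>.\<close>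
primrec word_deriv :: "'g \<Rightarrow> 'g list \<Rightarrow> 'g bi_poly" where
  "word_deriv j [] = 0"
| "word_deriv j (i # w) = (if i = j then single ([], rev w) 1 else 0) +
     single ([i], []) 1 * word_deriv j w"

definition free_deriv :: "'g \<Rightarrow> 'g free_poly \<Rightarrow> 'g bi_poly" where
  "free_deriv j = lin_ext pm_scale (word_deriv j)"

lemma sum_lessThan_add: "(\<Sum>t<n + m. f t) = (\<Sum>t<n. f t) + (\<Sum>t<m. f (n + t :: nat) :: 'a::comm_monoid_add)"
  by (induction m) (simp_all add: add.assoc)

lemma mat_word_transpose:
  fixes Y :: "'g \<Rightarrow> 'q \<Rightarrow> 'q \<Rightarrow> complex"
  assumes "finite Q" "b \<in> Q" "b' \<in> Q"
  shows "mat_word Q Y (rev w) b b' = mat_word Q (\<lambda>i b b'. Y i b' b) w b' b"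
  using assms(3)
proof (induction w arbitrary: b')
  case (Cons i w)
  then show ?case using assms by (simp add: mat_word_snoc mult.commute)
qed auto

text \<open>The indices of \<open>Y\<close> are exchanged because right matrices act through their transposes.\<close>
definition block_tuple :: "nat \<Rightarrow> nat \<Rightarrow> ('g \<Rightarrow> nat \<Rightarrow> nat \<Rightarrow> complex) \<Rightarrow> ('g \<Rightarrow> nat \<Rightarrow> nat \<Rightarrow> complex) \<Rightarrow>
    ('g \<Rightarrow> nat \<Rightarrow> nat \<Rightarrow> complex) \<Rightarrow> 'g \<Rightarrow> complex mat" where
  "block_tuple n m X H Y i = mat (n + m) (n + m) (\<lambda>(r, c).
     if r < n then (if c < n then X i r c else H i r (c - n)) else (if c < n then 0 else Y i (c - n) (r - n)))"

lemma block_tuple_corner: "a < n \<Longrightarrow> b < m \<Longrightarrow> block_tuple n m X H Y j $$ (a, n + b) = H j a b"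
  by (simp add: block_tuple_def)

lemma word_eval_carrier: "(\<And>i. Z i \<in> carrier_mat n n) \<Longrightarrow> word_eval n Z w \<in> carrier_mat n n"
  by (induction w) (auto simp: word_eval_def intro!: mult_carrier_mat)

text \<open>Words are multiplicative on block triangular matrices, and in the corner each term takes exactly one factor \<open>H j\<close>, at an
occurrence of the letter \<open>j\<close> in \<open>w\<close>.\<close>
lemma word_eval_block:
  fixes H :: "'g::finite \<Rightarrow> nat \<Rightarrow> nat \<Rightarrow> complex"
  assumes "r < n + m" "c < n + m"
  shows "word_eval (n + m) (block_tuple n m X H Y) w $$ (r, c) =
    (if r < n then (if c < n then mat_word {..<n} X w r c
                    else \<Sum>j\<in>UNIV. bi_act n m X Y (word_deriv j w) (H j) r (c - n))
     else (if c < n then 0 else mat_word {..<m} (\<lambda>i b b'. Y i b' b) w (r - n) (c - n)))"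
  using assms(1)
proof (induction w arbitrary: r)
  case Nil
  then show ?case using assms by (auto simp: word_eval_def)
next
  case (Cons i w)
  let ?Z = "block_tuple n m X H Y" and ?W = "word_eval (n + m) (block_tuple n m X H Y) w"
  have carr: "?Z i \<in> carrier_mat (n + m) (n + m)" "?W \<in> carrier_mat (n + m) (n + m)"
    using word_eval_carrier[of ?Z "n + m" w] by (auto simp: block_tuple_def)
  have "word_eval (n + m) ?Z (i # w) $$ (r, c) = (?Z i * ?W) $$ (r, c)"
    by (simp add: word_eval_def)
  also have "\<dots> = (\<Sum>t<n + m. ?Z i $$ (r, t) * ?W $$ (t, c))"
    using carr Cons.prems assms(2) by (simp add: times_mat_def scalar_prod_def lessThan_atLeast0)
  also have "\<dots> = (\<Sum>t<n. ?Z i $$ (r, t) * ?W $$ (t, c)) + (\<Sum>t<m. ?Z i $$ (r, n + t) * ?W $$ (n + t, c))"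
    by (rule sum_lessThan_add)
  finally have split: "word_eval (n + m) ?Z (i # w) $$ (r, c) = \<dots>" .
  have Zl: "?Z i $$ (r, t) = (if r < n then X i r t else 0)" if "t < n" for t
    using that Cons.prems by (simp add: block_tuple_def)
  have Zr: "?Z i $$ (r, n + t) = (if r < n then H i r t else Y i t (r - n))" if "t < m" for t
    using that Cons.prems by (simp add: block_tuple_def)
  have W1: "?W $$ (t, c) = (if c < n then mat_word {..<n} X w t c
      else \<Sum>j\<in>UNIV. bi_act n m X Y (word_deriv j w) (H j) t (c - n))" if "t < n" for t
    using Cons.IH[of t] that by simp
  have W2: "?W $$ (n + t, c) = (if c < n then 0 else mat_word {..<m} (\<lambda>i b b'. Y i b' b) w t (c - n))" if "t < m" for t
    using Cons.IH[of "n + t"] that by simp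
  show ?case
  proof (cases "r < n")
    case False
    then show ?thesis unfolding split using Zl Zr W2 by simp
  next
    case r: True
    show ?thesis
    proof (cases "c < n")
      case True
      then show ?thesis unfolding split using r Zl W1 W2 by simp
    next
      case False
      define b where "b = c - n"
      have b: "b < m" using False assms(2) by (simp add: b_def)
      have "bi_act n m X Y (word_deriv j (i # w)) (H j) r b =
          (if j = i then \<Sum>t<m. H i r t * mat_word {..<m} (\<lambda>i b b'. Y i b' b) w t b else 0) +
          (\<Sum>t<n. X i r t * bi_act n m X Y (word_deriv j w) (H j) t b)" for j
      proof -
        have "bi_act n m X Y (single ([], rev w) 1) (H i) r b =
           (\<Sum>t<m. H i r t * mat_word {..<m} (\<lambda>i b b'. Y i b' b) w t b)"
          using b by (simp add: bi_act_single bi_word_def right_word_matrix mat_word_transpose mult.commute)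
        moreover have "bi_act n m X Y (single ([i], []) 1 * word_deriv j w) (H j) r b =
           (\<Sum>t<n. X i r t * bi_act n m X Y (word_deriv j w) (H j) t b)"
          using r by (simp add: bi_act_mult bi_act_single bi_word_def left_op_def)
        ultimately show ?thesis by (auto simp: bi_act_add)
      qed
      then have "(\<Sum>j\<in>UNIV. bi_act n m X Y (word_deriv j (i # w)) (H j) r b) =
         (\<Sum>t<m. H i r t * mat_word {..<m} (\<lambda>i b b'. Y i b' b) w t b) +
         (\<Sum>j\<in>UNIV. \<Sum>t<n. X i r t * bi_act n m X Y (word_deriv j w) (H j) t b)"
        by (simp add: sum.distrib)
      also have "(\<Sum>j\<in>UNIV. \<Sum>t<n. X i r t * bi_act n m X Y (word_deriv j w) (H j) t b) =
         (\<Sum>t<n. X i r t * (\<Sum>j\<in>UNIV. bi_act n m X Y (word_deriv j w) (H j) t b))"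
        unfolding sum_distrib_left by (rule sum.swap)
      finally show ?thesis unfolding split using r False Zl Zr W1 W2 by (simp add: b_def)
    qed
  qed
qed

lemma bi_act_scale: "bi_act n m X Y (pm_scale c F) h = (\<lambda>a b. c * bi_act n m X Y F h a b)"
proof -
  have "bi_act n m X Y (single 0 c) h' = (\<lambda>a b. c * h' a b)" for h'
    by (simp add: bi_act_single zero_bi bi_word_def)
  then show ?thesis by (simp add: pm_scale_def bi_act_mult)
qed

text \<open>If \<open>J(X, Y) H = 0\<close>, then \<open>p\<close> takes the same value at the block tuples with corners \<open>H\<close> and \<open>0\<close>, so \<open>H = 0\<close>.\<close>
theorem derivative_bi_injective:
  fixes p :: "'g::finite free_map"
  assumes "free_injective p"
  shows "bi_injective (\<lambda>i j. free_deriv j (p i))"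
  unfolding bi_injective_def
proof (intro allI impI)
  fix n m X Y H j a b
  assume sup: "\<forall>j. supported n m (H j)"
    and eq: "\<forall>i a b. (\<Sum>j\<in>UNIV. bi_act n m X Y (free_deriv j (p i)) (H j) a b) = 0"
  show "H j a b = 0"
  proof (cases "a < n \<and> b < m")
    case False
    then show ?thesis using sup by (auto simp: supported_def)
  next
    case True
    let ?Z = "block_tuple n m X H Y" and ?W = "block_tuple n m X (\<lambda>_ _ _. 0) Y"
    have act0: "bi_act n m X Y F (\<lambda>_ _. 0) = (\<lambda>_ _. 0)" for F
      using bi_act_sum_right[of n m X Y F "\<lambda>_ _ _. 0" "{}"] by simp
    have "poly_eval (n + m) (p i) ?Z = poly_eval (n + m) (p i) ?W" for i
    proof (rule eq_matI)
      fix r c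
      assume "r < dim_row (poly_eval (n + m) (p i) ?W)" "c < dim_col (poly_eval (n + m) (p i) ?W)"
      then have rc: "r < n + m" "c < n + m" by (simp_all add: poly_eval_def)
      have "(\<Sum>w\<in>keys (p i). lookup (p i) w * (\<Sum>j\<in>UNIV. bi_act n m X Y (word_deriv j w) (H j) r b)) =
        (\<Sum>j\<in>UNIV. bi_act n m X Y (free_deriv j (p i)) (H j) r b)" for b
        unfolding free_deriv_def lin_ext_def bi_act_sum bi_act_scale sum_distrib_left by (rule sum.swap)
      then have "(\<Sum>w\<in>keys (p i). lookup (p i) w * (\<Sum>j\<in>UNIV. bi_act n m X Y (word_deriv j w) (H j) r b)) = 0" for b
        using eq by simp
      then show "poly_eval (n + m) (p i) ?Z $$ (r, c) = poly_eval (n + m) (p i) ?W $$ (r, c)"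
        using rc by (cases "r < n"; cases "c < n") (simp_all add: poly_eval_def word_eval_block act0)
    qed (simp_all add: poly_eval_def)
    then have "map_eval (n + m) p ?Z = map_eval (n + m) p ?W" by (simp add: map_eval_def)
    moreover have "?Z \<in> mat_tuples (n + m)" "?W \<in> mat_tuples (n + m)"
      by (auto simp: mat_tuples_def block_tuple_def)
    moreover have "inj_on (map_eval (n + m) p) (mat_tuples (n + m))"
      using assms True by (auto simp: free_injective_def)
    ultimately have "?Z = ?W" by (simp add: inj_on_def)
    then have "?Z j $$ (a, n + b) = ?W j $$ (a, n + b)" by simp
    then show ?thesis using True by (simp only: block_tuple_corner)
  qed
qed

section \<open>Substitution and reversal of words\<close>

lemma subst_eq_lin_ext: "subst q f = lin_ext pm_scale (\<lambda>w. prod_list (map q w)) f"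
  by (simp add: subst_def lin_ext_def pm_scale_def zero_list_def)

lemma pm_scale_eq_mult: "pm_scale c (f :: 'g free_poly) = single [] c * f"
  by (simp add: pm_scale_def zero_list_def)

lemma subst_simps [simp]:
  "subst q (f + g) = subst q f + subst q g" "subst q (f - g) = subst q f - subst q g"
  "subst q (f * g) = subst q f * subst q g" "subst q 0 = 0"
  "subst q (single w c) = pm_scale c (prod_list (map q w))"
  by (simp_all add: subst_eq_lin_ext lin_ext_add lin_ext_diff lin_ext_zero lin_ext_single module_pm_scale
      scalar_algebra.lin_ext_mult[OF scalar_algebra_pm_scale] plus_list_def)

lemma subst_one [simp]: "subst q 1 = 1"
  using subst_simps(5)[of q "[]" 1] by (simp add: single_Nil_one pm_scale_eq_mult)

lemma subst_sum: "subst q (\<Sum>x\<in>X. f x) = (\<Sum>x\<in>X. subst q (f x))"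
  by (induction X rule: infinite_finite_induct) auto

lemma subst_indet [simp]: "subst q (indet i) = q i"
  by (simp add: indet_def pm_scale_eq_mult single_Nil_one)

lemma subst_const [simp]: "subst q (single [] c) = single [] c"
  by (simp add: pm_scale_eq_mult)

lemma subst_pm_scale [simp]: "subst q (pm_scale c f) = pm_scale c (subst q f)"
  by (simp add: pm_scale_eq_mult pm_scale_def zero_list_def)

lemma subst_prod_list: "subst q (prod_list xs) = prod_list (map (subst q) xs)"
  by (induction xs) auto

lemma subst_subst: "subst q (subst p f) = subst (\<lambda>i. subst q (p i)) f"
proof (induction f rule: poly_mapping_additive_induct)
  case (single w c)
  then show ?case by (simp add: subst_prod_list o_def)
qed auto

lemma prod_list_indet: "prod_list (map indet w) = single w 1"
  by (induction w) (simp_all add: single_Nil_one indet_def single_mult_free)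

lemma subst_identity: "subst indet f = f"
  by (induction f rule: poly_mapping_additive_induct) (simp_all add: prod_list_indet)

text \<open>Reversal of words translates between the free algebra and the reversed second component of the tensor square.\<close>
definition rev_poly :: "'g free_poly \<Rightarrow> 'g free_poly" where
  "rev_poly = lin_ext pm_scale (\<lambda>w. single (rev w) 1)"

lemma rev_poly_simps [simp]:
  "rev_poly (f + g) = rev_poly f + rev_poly g" "rev_poly (f - g) = rev_poly f - rev_poly g"
  "rev_poly (single w c) = single (rev w) c" "rev_poly 0 = 0"
  by (simp_all add: rev_poly_def lin_ext_add lin_ext_diff lin_ext_single lin_ext_zero module_pm_scale)

lemma rev_poly_sum: "rev_poly (\<Sum>x\<in>X. f x) = (\<Sum>x\<in>X. rev_poly (f x))"
  by (induction X rule: infinite_finite_induct) auto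

lemma rev_poly_one [simp]: "rev_poly 1 = 1"
  using rev_poly_simps(3)[of "[]" 1] by (simp add: single_Nil_one)

lemma rev_poly_mult [simp]: "rev_poly (f * g) = rev_poly g * rev_poly f"
proof (induction f rule: poly_mapping_additive_induct)
  case (single u c)
  show ?case
  proof (induction g rule: poly_mapping_additive_induct)
    case (single v d)
    then show ?case by (simp add: single_mult_free mult.commute)
  next
    case (add g h)
    then show ?case by (simp add: distrib_left distrib_right)
  qed
next
  case (add f h)
  then show ?case by (simp add: distrib_left distrib_right)
qed

lemma rev_poly_rev_poly [simp]: "rev_poly (rev_poly f) = f"
  by (induction f rule: poly_mapping_additive_induct) auto

lemma lookup_rev_poly [simp]: "lookup (rev_poly f) w = lookup f (rev w)"
  by (induction f rule: poly_mapping_additive_induct) (auto simp: lookup_add lookup_single when_def)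

lemma rev_poly_pm_scale [simp]: "rev_poly (pm_scale c f) = pm_scale c (rev_poly f)"
  by (rule poly_mapping_eqI) simp

subsection \<open>The Leibniz rule\<close>

lemma free_deriv_simps [simp]:
  "free_deriv j (f + g) = free_deriv j f + free_deriv j g"
  "free_deriv j (f - g) = free_deriv j f - free_deriv j g"
  "free_deriv j (single w c) = pm_scale c (word_deriv j w)"
  "free_deriv j 0 = 0"
  by (simp_all add: free_deriv_def lin_ext_add lin_ext_diff lin_ext_single lin_ext_zero module_pm_scale)

lemma pm_scale_simps: "pm_scale c (f + g) = pm_scale c f + pm_scale c g"
  "pm_scale (c + d) f = pm_scale c f + pm_scale d f"
  "pm_scale c f * g = pm_scale c (f * g)" "f * pm_scale c g = pm_scale c (f * g)"
  "pm_scale c (pm_scale d f) = pm_scale (c * d) f" "pm_scale 1 f = f" "pm_scale 0 f = 0"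
  "pm_scale c (f - g) = pm_scale c f - pm_scale c g"
proof -
  interpret scalar_algebra "pm_scale :: complex \<Rightarrow> ('a \<Rightarrow>\<^sub>0 complex) \<Rightarrow> _" by (rule scalar_algebra_pm_scale)
  show "pm_scale c (f + g) = pm_scale c f + pm_scale c g"
  "pm_scale (c + d) f = pm_scale c f + pm_scale d f"
  "pm_scale c f * g = pm_scale c (f * g)" "f * pm_scale c g = pm_scale c (f * g)"
  "pm_scale c (pm_scale d f) = pm_scale (c * d) f" "pm_scale 1 f = f" "pm_scale 0 f = 0"
  "pm_scale c (f - g) = pm_scale c f - pm_scale c g"
    by (simp_all add: scale_right_distrib scale_left_distrib scale_mult_left scale_mult_right scale_right_diff_distrib)
qed

lemma pm_scale_sum: "pm_scale c (\<Sum>x\<in>X. f x) = (\<Sum>x\<in>X. pm_scale c (f x))"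
  by (simp add: pm_scale_def sum_distrib_left)

lemma embed_pm_scale [simp]: "embed_right (pm_scale c f) = pm_scale c (embed_right f)" "embed_left (pm_scale c f) = pm_scale c (embed_left f)"
  by (simp_all add: pm_scale_def zero_bi zero_list_def)

lemma word_deriv_append:
  "word_deriv j (w @ w') = single ([], rev w') 1 * word_deriv j w + single (w, []) 1 * word_deriv j w'"
proof (induction w)
  case Nil
  have "single ([], []) 1 = (1 :: 'a bi_poly)" by (metis single_one zero_bi)
  then show ?case by simp
next
  case (Cons i w)
  have c: "single ([i], []) 1 * (single ([], rev w') 1 * F) =
      single ([], rev w') 1 * (single ([i], []) 1 * F)" for F :: "'a bi_poly"
    by (simp add: mult.assoc[symmetric] single_mult_bi)
  have d: "single ([i], []) 1 * (single (w, []) 1 * F) =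
      single (i # w, []) 1 * F" for F :: "'a bi_poly"
    by (simp add: mult.assoc[symmetric] single_mult_bi)
  show ?case by (simp add: Cons distrib_left c d single_mult_bi)
qed

text \<open>The second component is reversed, so multiplying it by \<open>g\<close> from the right is multiplication by the reversal of \<open>g\<close> from the left.\<close>
lemma free_deriv_mult:
  "free_deriv j (f * g) = embed_right (rev_poly g) * free_deriv j f + embed_left f * free_deriv j g"
proof (induction f rule: poly_mapping_additive_induct)
  case (single u c)
  show ?case
  proof (induction g rule: poly_mapping_additive_induct)
    case (single v d)
    have e: "single k a = pm_scale a (single k 1)" for k :: "'a list \<times> 'a list" and a by simp
    show ?case
      by (simp add: single_mult_free word_deriv_append pm_scale_simps)
        (subst e[of _ c], subst e[of _ d], simp add: pm_scale_simps mult.commute del: pm_scale_single)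
  next
    case (add g h)
    then show ?case by (simp add: distrib_left distrib_right)
  qed
next
  case (add f h)
  then show ?case by (simp add: distrib_left distrib_right)
qed

lemma slice_pm_scale [simp]: "slice u (pm_scale c F) = pm_scale c (slice u F)"
  by (rule poly_mapping_eqI) simp

lemma slice_word_deriv_Cons: "slice [] (word_deriv j (i # w)) = (if i = j then single (rev w) 1 else 0)"
  by (simp add: slice_Nil_mult slice_single)

text \<open>Sorting the words of \<open>f\<close> by their first letter.\<close>
lemma left_decomposition:
  fixes f :: "'g::finite free_poly"
  shows "f = single [] (lookup f []) + (\<Sum>j\<in>UNIV. indet j * rev_poly (slice [] (free_deriv j f)))"
proof (induction f rule: poly_mapping_additive_induct)
  case (single w c)
  show ?case
  proof (cases w)
    case Nil
    then show ?thesis by simp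
  next
    case (Cons i v)
    have "(\<Sum>j\<in>UNIV. indet j * rev_poly (slice [] (free_deriv j (single w c)))) =
      (\<Sum>j\<in>UNIV. if j = i then single w c else 0)"
      unfolding Cons by (intro sum.cong refl) (auto simp: slice_word_deriv_Cons indet_def single_mult_free simp del: word_deriv.simps)
    then show ?thesis by (simp add: Cons lookup_single)
  qed
next
  case (add f g)
  have "f + g = (single [] (lookup f []) + (\<Sum>j\<in>UNIV. indet j * rev_poly (slice [] (free_deriv j f)))) +
     (single [] (lookup g []) + (\<Sum>j\<in>UNIV. indet j * rev_poly (slice [] (free_deriv j g))))"
    using add by simp
  also have "\<dots> = single [] (lookup (f + g) []) + (\<Sum>j\<in>UNIV. indet j * rev_poly (slice [] (free_deriv j (f + g))))"
    by (simp add: lookup_add single_add distrib_left sum.distrib)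
  finally show ?case .
qed

lemma lookup_free_deriv_Nil: "lookup (free_deriv j f) ([], []) = lookup f [j]"
proof (induction f rule: poly_mapping_additive_induct)
  case (single w c)
  show ?case
  proof (cases w)
    case (Cons i v)
    have "lookup (word_deriv j w) ([], []) = lookup (slice [] (word_deriv j w)) []" by simp
    also have "\<dots> = of_bool (w = [j])"
      unfolding Cons slice_word_deriv_Cons by (auto simp: lookup_single when_def)
    finally show ?thesis by (auto simp: lookup_single when_def)
  qed (simp add: lookup_single)
qed (simp add: lookup_add)

section \<open>Derivations dual to a free map\<close>

text \<open>The two one-sided inverses serve different purposes: \<open>K\<close> yields derivations that are dual to \<open>p\<close>, and \<open>B\<close> shows that the
\<open>p i\<close> generate the right ideal of all polynomials with constant term zero.\<close>
locale normalized_free_map =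
  fixes p :: "'g::finite free_map" and K :: "'g \<Rightarrow> 'g \<Rightarrow> 'g bi_poly" and B :: "'g \<Rightarrow> 'g \<Rightarrow> 'g free_poly"
  assumes const: "lookup (p i) [] = 0"
    and linear_part: "lookup (p i) [j] = of_bool (i = j)"
    and JK: "mat_times (\<lambda>i j. free_deriv j (p i)) K = mat_unit"
    and BJ: "mat_times B (\<lambda>i j. slice [] (free_deriv j (p i))) = mat_unit"
begin

text \<open>The derivation that maps the indeterminate \<open>j\<close> to \<open>K j i\<close>.\<close>
definition D :: "'g \<Rightarrow> 'g free_poly \<Rightarrow> 'g bi_poly" where
  "D i f = (\<Sum>j\<in>UNIV. free_deriv j f * K j i)"

lemma D_simps [simp]: "D i (f + g) = D i f + D i g" "D i (f - g) = D i f - D i g" "D i 0 = 0"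
  "D i (single [] c) = 0" "D i 1 = 0"
  by (simp_all add: D_def distrib_right left_diff_distrib sum.distrib sum_subtractf single_Nil_one[symmetric])

lemma D_mult: "D i (f * g) = embed_right (rev_poly g) * D i f + embed_left f * D i g"
  by (simp add: D_def free_deriv_mult distrib_right sum.distrib sum_distrib_left mult.assoc)

lemma D_scale [simp]: "D i (pm_scale c f) = pm_scale c (D i f)"
  by (simp add: pm_scale_eq_mult D_mult) (simp add: pm_scale_def zero_bi)

lemma D_sum: "D i (\<Sum>x\<in>X. f x) = (\<Sum>x\<in>X. D i (f x))"
  by (induction X rule: infinite_finite_induct) auto

lemma D_p: "D i (p k) = of_bool (k = i)"
  using fun_cong[OF fun_cong[OF JK, of k], of i] by (simp add: mat_times_def mat_unit_def D_def)

lemma D_indet: "D i (indet j) = K j i"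
proof -
  have "single ([], []) 1 = (1 :: 'g bi_poly)" by (metis single_one zero_bi)
  then have "free_deriv k (indet j) = of_bool (k = j)" for k
    by (simp add: indet_def pm_scale_simps)
  then have "D i (indet j) = (\<Sum>k\<in>UNIV. if k = j then K j i else 0)"
    unfolding D_def by (intro sum.cong) auto
  then show ?thesis by simp
qed

text \<open>Left variables are set to zero in \<open>D i f\<close>. In terms of an expansion in words in \<open>p\<close>, the operator \<open>L i\<close> removes the first letter \<open>i\<close> and
kills the words that begin with another letter.\<close>
definition L :: "'g \<Rightarrow> 'g free_poly \<Rightarrow> 'g free_poly" where
  "L i f = rev_poly (slice [] (D i f))"

lemma L_simps [simp]: "L i (f + g) = L i f + L i g" "L i (f - g) = L i f - L i g" "L i 0 = 0"
  "L i (single [] c) = 0" "L i 1 = 0" "L i (pm_scale c f) = pm_scale c (L i f)"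
  by (simp_all add: L_def)

lemma L_mult: "L i (f * g) = L i f * g + pm_scale (lookup f []) (L i g)"
  by (simp add: L_def D_mult slice_Nil_mult slice_embed_right slice_Nil_embed_left pm_scale_eq_mult[symmetric])

lemma L_p_mult: "L i (p k * g) = (if k = i then g else 0)"
proof -
  have "slice [] (1 :: 'g bi_poly) = 1"
    using slice_embed_right[of "[]" "1 :: 'g free_poly"] by simp
  then show ?thesis by (simp add: L_mult const pm_scale_simps) (simp add: L_def D_p)
qed

lemma D_p_mult: "D i (p k * g) = (if k = i then embed_right (rev_poly g) else 0) + embed_left (p k) * D i g"
  by (simp add: D_mult D_p)

text \<open>The matrix \<open>B\<close> shows that the \<open>p k\<close> generate the same right ideal as the indeterminates, namely all polynomials with constant term
zero.\<close>
lemma vanishes_if_vanishes_on_right_ideal: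
  fixes T :: "'g free_poly \<Rightarrow> 'v::ab_group_add"
  assumes add: "\<And>f g. T (f + g) = T f + T g" and c: "\<And>c. T (single [] c) = 0"
    and p: "\<And>k g. T (p k * g) = 0"
  shows "T f = 0"
proof -
  have T0: "T 0 = 0" using add[of 0 0] by simp
  have Tsum: "T (\<Sum>x\<in>X. h x) = (\<Sum>x\<in>X. T (h x))" for h and X :: "'g set"
    by (induction X rule: infinite_finite_induct) (auto simp: T0 add)
  have ind: "indet l = (\<Sum>k\<in>UNIV. p k * rev_poly (B l k))" for l
  proof -
    let ?J = "\<lambda>k j. slice [] (free_deriv j (p k))"
    have pk: "p k = (\<Sum>j\<in>UNIV. indet j * rev_poly (?J k j))" for k
      using left_decomposition[of "p k"] by (simp add: const)
    have "(\<Sum>k\<in>UNIV. p k * rev_poly (B l k)) = (\<Sum>k\<in>UNIV. \<Sum>j\<in>UNIV. indet j * rev_poly (?J k j) * rev_poly (B l k))"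
      by (subst pk) (simp add: sum_distrib_right)
    also have "\<dots> = (\<Sum>j\<in>UNIV. \<Sum>k\<in>UNIV. indet j * rev_poly (?J k j) * rev_poly (B l k))"
      by (rule sum.swap)
    also have "\<dots> = (\<Sum>j\<in>UNIV. indet j * rev_poly (mat_times B ?J l j))"
      by (simp add: mat_times_def rev_poly_sum sum_distrib_left mult.assoc)
    also have "\<dots> = (\<Sum>j\<in>UNIV. if j = l then indet l else 0)"
      unfolding BJ by (intro sum.cong) (auto simp: mat_unit_def)
    finally show ?thesis by simp
  qed
  have "T (indet l * g) = 0" for l g
    by (subst ind) (simp add: sum_distrib_right mult.assoc Tsum p)
  then show ?thesis by (subst left_decomposition) (simp add: add c Tsum)
qed

lemma left_expansion: "f = single [] (lookup f []) + (\<Sum>i\<in>UNIV. p i * L i f)"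
proof -
  define T where "T f = f - single [] (lookup f []) - (\<Sum>i\<in>UNIV. p i * L i f)" for f
  have "T f = 0"
  proof (rule vanishes_if_vanishes_on_right_ideal[where T = T])
    fix k and g :: "'g free_poly"
    have "lookup (p k * g) [] = 0" by (simp add: lookup_mult_Nil const)
    moreover have "(\<Sum>i\<in>UNIV. p i * L i (p k * g)) = (\<Sum>i\<in>UNIV. if i = k then p k * g else 0)"
      by (intro sum.cong) (auto simp: L_p_mult)
    ultimately show "T (p k * g) = 0" by (simp add: T_def)
  qed (simp_all add: T_def lookup_add single_add distrib_left sum.distrib)
  then show ?thesis by (simp add: T_def diff_diff_eq)
qed

text \<open>\<open>L k\<close> applied to the first tensor factor.\<close>
definition L_left :: "'g \<Rightarrow> 'g bi_poly \<Rightarrow> 'g bi_poly" where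
  "L_left k = lin_ext pm_scale (\<lambda>(u, v). embed_left (L k (single u 1)) * single ([], v) 1)"

lemma L_left_simps [simp]: "L_left k (F + G) = L_left k F + L_left k G" "L_left k 0 = 0"
  "L_left k (F - G) = L_left k F - L_left k G"
  by (simp_all add: L_left_def lin_ext_add lin_ext_diff lin_ext_zero module_pm_scale)

lemma L_left_tensor: "L_left k (embed_left a * embed_right b) = embed_left (L k a) * embed_right b"
proof (induction a rule: poly_mapping_additive_induct)
  case (single u c)
  show ?case
  proof (induction b rule: poly_mapping_additive_induct)
    case (single v d)
    have "L k (single u c) = pm_scale c (L k (single u 1))"
      by (metis L_simps(6) mult.right_neutral pm_scale_single)
    moreover have "single ([], v) d = pm_scale d (single ([], v) 1 :: 'g bi_poly)" by simp
    moreover have "L_left k (embed_left (single u c) * embed_right (single v d)) =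
        pm_scale (c * d) (embed_left (L k (single u 1)) * single ([], v) 1)"
      by (simp add: single_mult_bi L_left_def lin_ext_single module_pm_scale)
    ultimately show ?case
      by (simp only: embed_simps embed_pm_scale pm_scale_simps mult.commute)
  next
    case (add f g)
    then show ?case by (simp add: distrib_left)
  qed
next
  case (add f g)
  then show ?case by (simp add: distrib_right)
qed

lemma tensor_induct:
  assumes "\<And>a b. P (embed_left a * embed_right b)" "\<And>F G. P F \<Longrightarrow> P G \<Longrightarrow> P (F + G)"
  shows "P (F :: 'g bi_poly)"
proof (induction F rule: poly_mapping_additive_induct)
  case (single k c)
  obtain u v where "k = (u, v)" by (cases k)
  then show ?case using assms(1)[of "single u c" "single v 1"] by (simp add: single_mult_bi)
qed (use assms in auto)

lemma L_left_embed_left_mult: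
  "L_left k (embed_left f * F) = embed_left (L k f) * F + pm_scale (lookup f []) (L_left k F)"
proof (induction F rule: tensor_induct)
  case (1 a b)
  have "embed_left f * (embed_left a * embed_right b) = embed_left (f * a) * embed_right b"
    by (simp add: mult.assoc)
  then show ?case by (simp only: L_left_tensor L_mult) (simp add: distrib_right mult.assoc pm_scale_simps L_left_tensor)
next
  case (2 F G)
  then show ?case by (simp add: distrib_left pm_scale_simps)
qed

lemma L_left_embed_right: "L_left k (embed_right g) = 0"
  using L_left_tensor[of k 1 g] by simp

text \<open>In words in \<open>p\<close>, removing the first letter and then splitting at a letter \<open>i\<close> is the same as splitting at \<open>i\<close> and then removing the first
letter of the left factor. The two sides agree on constants and on multiples of the \<open>p l\<close>, hence everywhere.\<close>
lemma D_L: "D i (L k f) = L_left k (D i f)"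
proof -
  have "D i (L k f) - L_left k (D i f) = 0"
  proof (rule vanishes_if_vanishes_on_right_ideal[where T = "\<lambda>f. D i (L k f) - L_left k (D i f)"])
    fix l g
    show "D i (L k (p l * g)) - L_left k (D i (p l * g)) = 0"
      using L_p_mult[of k l 1]
      by (auto simp: L_p_mult D_p_mult L_left_embed_right L_left_embed_left_mult const pm_scale_simps)
  qed simp_all
  then show ?thesis by simp
qed

subsection \<open>A finite-dimensional invariant subspace\<close>

definition right_degree_le :: "nat \<Rightarrow> 'g bi_poly \<Rightarrow> bool" where
  "right_degree_le e F \<longleftrightarrow> (\<forall>u v. e < length v \<longrightarrow> lookup F (u, v) = 0)"

lemma right_degree_le_sum: "(\<And>x. x \<in> X \<Longrightarrow> right_degree_le e (F x)) \<Longrightarrow> right_degree_le e (\<Sum>x\<in>X. F x)"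
  by (simp add: right_degree_le_def lookup_sum)

lemma right_degree_le_L_left:
  assumes "right_degree_le e F"
  shows "right_degree_le e (L_left k F)"
  unfolding L_left_def lin_ext_def
proof (rule right_degree_le_sum)
  fix x assume x: "x \<in> keys F"
  obtain u v where uv: "x = (u, v)" by (cases x)
  have v: "length v \<le> e"
  proof (rule ccontr)
    assume "\<not> ?thesis"
    then have "lookup F (u, v) = 0" using assms by (simp add: right_degree_le_def)
    then show False using x by (simp add: uv in_keys_iff)
  qed
  have "right_degree_le e (embed_left a * single ([], v) 1)" for a
  proof (induction a rule: poly_mapping_additive_induct)
    case (single w c)
    then show ?case using v by (auto simp: single_mult_bi right_degree_le_def lookup_single when_def)
  next
    case (add f g)
    then show ?case by (simp add: distrib_right right_degree_le_def lookup_add)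
  qed
  then show "right_degree_le e (pm_scale (lookup F x)
      (case x of (u, v) \<Rightarrow> embed_left (L k (single u 1)) * single ([], v) 1))"
    by (simp add: uv right_degree_le_def)
qed

definition deg_bound :: nat where
  "deg_bound = Suc (\<Sum>i\<in>UNIV. \<Sum>j\<in>UNIV. \<Sum>k\<in>keys (K i j). length (snd k))"

lemma right_degree_K: "right_degree_le deg_bound (K i j)"
  unfolding right_degree_le_def
proof (intro allI impI, rule ccontr)
  fix u v assume ev: "deg_bound < length v" and "lookup (K i j) (u, v) \<noteq> 0"
  then have "(u, v) \<in> keys (K i j)" by (simp add: in_keys_iff)
  then have "length (snd (u, v)) \<le> (\<Sum>k\<in>keys (K i j). length (snd k))"
    by (intro member_le_sum) auto
  also have "\<dots> \<le> (\<Sum>j\<in>UNIV. \<Sum>k\<in>keys (K i j). length (snd k))"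
    by (rule member_le_sum[of j UNIV "\<lambda>j. \<Sum>k\<in>keys (K i j). length (snd k)"]) auto
  also have "\<dots> \<le> (\<Sum>i\<in>UNIV. \<Sum>j\<in>UNIV. \<Sum>k\<in>keys (K i j). length (snd k))"
    by (rule member_le_sum[of i UNIV "\<lambda>i. \<Sum>j\<in>UNIV. \<Sum>k\<in>keys (K i j). length (snd k)"]) auto
  finally show False using ev by (simp add: deg_bound_def)
qed

inductive_set orbit :: "'g free_poly set" where
  indet: "indet j \<in> orbit"
| L: "f \<in> orbit \<Longrightarrow> L k f \<in> orbit"

text \<open>This is where \<open>K\<close> being a polynomial enters: \<open>L k\<close> changes only the left factor of \<open>D i f\<close>, so along the orbit of the indeterminates the
right degrees never exceed those of \<open>K\<close>.\<close>
lemma orbit_right_degree: "f \<in> orbit \<Longrightarrow> right_degree_le deg_bound (D i f)"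
  by (induction f rule: orbit.induct) (simp_all add: D_indet right_degree_K D_L right_degree_le_L_left)

definition W :: "'g free_poly set" where
  "W = Modules.module.span pm_scale orbit"

lemma vector_space_pm_scale: "vector_space (pm_scale :: complex \<Rightarrow> 'g free_poly \<Rightarrow> _)"
  by unfold_locales (simp_all add: pm_scale_simps)

sublocale vs: vector_space "pm_scale :: complex \<Rightarrow> 'g free_poly \<Rightarrow> _"
  by (rule vector_space_pm_scale)

sublocale vsp: vector_space_pair "pm_scale :: complex \<Rightarrow> 'g free_poly \<Rightarrow> _" "pm_scale :: complex \<Rightarrow> 'g free_poly \<Rightarrow> _"
  ..

lemma orbit_W: "f \<in> orbit \<Longrightarrow> f \<in> W"
  unfolding W_def by (rule vs.span_base)

lemma L_W: "f \<in> W \<Longrightarrow> L k f \<in> W"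
  unfolding W_def
proof (induction f rule: vs.span_induct_alt)
  case base
  then show ?case by (simp add: vs.span_zero)
next
  case (step c x y)
  then show ?case by (simp add: vs.span_add vs.span_scale vs.span_base orbit.L)
qed

lemma W_degree: "f \<in> W \<Longrightarrow> deg_bound < length v \<Longrightarrow> lookup f v = 0"
  unfolding W_def
proof (induction f rule: vs.span_induct_alt)
  case (step c x y)
  have "lookup x v = 0"
    using \<open>x \<in> orbit\<close>
  proof cases
    case (indet j)
    have "v \<noteq> [j]" using step.prems by (auto simp: deg_bound_def)
    then show ?thesis by (simp add: indet indet_def lookup_single when_def)
  next
    case (L f k)
    then show ?thesis using orbit_right_degree[of f k] step.prems
      by (simp add: L_def right_degree_le_def)
  qed
  then show ?case using step by (simp add: lookup_add)
qed simp

text \<open>A linear projection onto \<open>W\<close>. The images of the words of bounded length are generators of \<open>W\<close>; although they can be linearly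
dependent, the coordinates of \<open>f \<in> W\<close> with respect to words provide canonical coefficients.\<close>
definition \<pi> :: "'g free_poly \<Rightarrow> 'g free_poly" where
  "\<pi> = (SOME h. range h \<subseteq> W \<and> Vector_Spaces.linear pm_scale pm_scale h \<and> (\<forall>f\<in>W. h f = f))"

lemma \<pi>: "\<pi> f \<in> W" "Vector_Spaces.linear pm_scale pm_scale \<pi>" "f \<in> W \<Longrightarrow> \<pi> f = f"
proof -
  have "\<exists>h. range h \<subseteq> W \<and> Vector_Spaces.linear pm_scale pm_scale h \<and> (\<forall>f\<in>W. h (id f) = f)"
    by (rule vsp.linear_exists_left_inverse_on) (simp_all add: vs.linear_ident W_def)
  then have "range \<pi> \<subseteq> W \<and> Vector_Spaces.linear pm_scale pm_scale \<pi> \<and> (\<forall>f\<in>W. \<pi> f = f)"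
    unfolding \<pi>_def id_apply by (rule someI_ex)
  then show "\<pi> f \<in> W" "Vector_Spaces.linear pm_scale pm_scale \<pi>" "f \<in> W \<Longrightarrow> \<pi> f = f" by auto
qed

definition words :: "'g list set" where
  "words = {v. length v \<le> deg_bound}"

lemma finite_words: "finite words"
  using finite_lists_length_le[of "UNIV :: 'g set" deg_bound] by (simp add: words_def)

definition gen :: "'g list \<Rightarrow> 'g free_poly" where
  "gen v = \<pi> (single v 1)"

lemma W_expand: "f \<in> W \<Longrightarrow> f = (\<Sum>v\<in>words. pm_scale (lookup f v) (gen v))"
proof -
  assume f: "f \<in> W"
  interpret \<pi>: Vector_Spaces.linear pm_scale pm_scale \<pi> by (rule \<pi>(2))
  have "f = (\<Sum>v\<in>words. pm_scale (lookup f v) (single v 1))"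
    using finite_words W_degree[OF f]
    by (intro poly_mapping_eqI) (auto simp: lookup_sum lookup_single when_def words_def not_le)
  then have "\<pi> f = (\<Sum>v\<in>words. pm_scale (lookup f v) (gen v))"
    using \<pi>.sum[of "\<lambda>v. pm_scale (lookup f v) (single v 1)" words] \<pi>.scale
    by (simp only: gen_def)
  then show ?thesis using \<pi>(3)[OF f] by simp
qed

definition A :: "'g \<Rightarrow> 'g list \<Rightarrow> 'g list \<Rightarrow> complex" where
  "A i v v' = lookup (L i (gen v)) v'"

lemma L_gen: "L i (gen v) = (\<Sum>v'\<in>words. pm_scale (A i v v') (gen v'))"
  unfolding A_def by (rule W_expand) (simp add: gen_def L_W \<pi>)

lemma gen_expand: "gen v = single [] (lookup (gen v) []) +
    (\<Sum>i\<in>UNIV. p i * (\<Sum>v'\<in>words. pm_scale (A i v v') (gen v')))"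
  using left_expansion[of "gen v"] by (simp only: L_gen)

lemma gen_letter: "gen [j] = indet j"
  using \<pi>(3)[OF orbit_W[OF orbit.indet]] by (simp add: gen_def indet_def)

definition right_coeff :: "'g list \<Rightarrow> 'g bi_poly \<Rightarrow> 'g free_poly" where
  "right_coeff v F = map_key (\<lambda>u. (u, rev v)) F"

lemma lookup_right_coeff [simp]: "lookup (right_coeff v F) u = lookup F (u, rev v)"
  by (simp add: right_coeff_def map_key.rep_eq inj_on_def)

lemma right_coeff_simps [simp]: "right_coeff v (F + G) = right_coeff v F + right_coeff v G" "right_coeff v 0 = 0"
  "right_coeff v (pm_scale c F) = pm_scale c (right_coeff v F)"
  by (auto intro!: poly_mapping_eqI simp: lookup_add)

lemma right_coeff_sum: "right_coeff v (\<Sum>x\<in>X. F x) = (\<Sum>x\<in>X. right_coeff v (F x))"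
  by (induction X rule: infinite_finite_induct) auto

lemma right_coeff_single: "right_coeff v (single (u, v') c) = (if v' = rev v then single u c else 0)"
  by (auto intro!: poly_mapping_eqI simp: lookup_single when_def)

lemma right_coeff_embed_left_mult: "right_coeff v (embed_left f * F) = f * right_coeff v F"
proof (induction f rule: poly_mapping_additive_induct)
  case (single u c)
  show ?case
  proof (induction F rule: poly_mapping_additive_induct)
    case (single k d)
    obtain u' v' where "k = (u', v')" by (cases k)
    then show ?case by (simp add: single_mult_bi right_coeff_single single_mult_free)
  next
    case (add F G)
    then show ?case by (simp add: distrib_left)
  qed
next
  case (add f g)
  then show ?case by (simp add: distrib_right)
qed

lemma right_coeff_embed_right: "right_coeff v (embed_right (rev_poly f)) = single [] (lookup f v)"
proof (induction f rule: poly_mapping_additive_induct)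
  case (single u c)
  then show ?case by (auto simp: right_coeff_single lookup_single)
next
  case (add f g)
  then show ?case by (simp add: lookup_add single_add)
qed

text \<open>\<open>\<psi> k v v'\<close> is the coefficient of \<open>v'\<close> in the right factor of \<open>D k (gen v)\<close>.\<close>
definition \<psi> :: "'g \<Rightarrow> 'g list \<Rightarrow> 'g list \<Rightarrow> 'g free_poly" where
  "\<psi> k v v' = right_coeff v' (D k (gen v))"

text \<open>Apply \<open>D k\<close> to the expansion of \<open>gen v\<close> and take coefficients in the right factor.\<close>
lemma \<psi>_equation: "\<psi> k v v' = single [] (A k v v') +
    (\<Sum>i\<in>UNIV. p i * (\<Sum>v''\<in>words. pm_scale (A i v v'') (\<psi> k v'' v')))"
proof -
  have DL: "D k (L i (gen v)) = (\<Sum>v''\<in>words. pm_scale (A i v v'') (D k (gen v'')))" for i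
    by (simp only: L_gen D_sum D_scale)
  have "D k (gen v) = D k (\<Sum>i\<in>UNIV. p i * L i (gen v))"
    by (subst left_expansion[of "gen v"]) simp
  also have "\<dots> = (\<Sum>i\<in>UNIV. (if i = k then embed_right (rev_poly (L k (gen v))) else 0) + embed_left (p i) * D k (L i (gen v)))"
    unfolding D_sum by (intro sum.cong) (auto simp: D_p_mult)
  also have "\<dots> = embed_right (rev_poly (L k (gen v))) + (\<Sum>i\<in>UNIV. embed_left (p i) * (\<Sum>v''\<in>words. pm_scale (A i v v'') (D k (gen v''))))"
    unfolding sum.distrib by (simp add: DL)
  finally have "D k (gen v) = \<dots>" .
  then show ?thesis
    by (simp add: \<psi>_def[of k v] right_coeff_embed_right right_coeff_sum right_coeff_embed_left_mult A_def[of k])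
       (simp add: \<psi>_def)
qed

text \<open>In matrix form \<open>gen_expand\<close> reads \<open>\<Lambda> gen = gen(0)\<close>.\<close>
definition \<Lambda> :: "'g list \<Rightarrow> 'g list \<Rightarrow> 'g free_poly" where
  "\<Lambda> v v' = of_bool (v = v') - (\<Sum>i\<in>UNIV. pm_scale (A i v v') (p i))"

definition \<Psi> :: "'g list \<Rightarrow> 'g list \<Rightarrow> 'g free_poly" where
  "\<Psi> v v' = of_bool (v = v') + (\<Sum>k\<in>UNIV. \<psi> k v v' * p k)"

lemma \<Lambda>_\<psi>:
  assumes "v \<in> words"
  shows "(\<Sum>v''\<in>words. \<Lambda> v v'' * \<psi> k v'' v') = single [] (A k v v')"
proof -
  have "(\<Sum>v''\<in>words. \<Lambda> v v'' * \<psi> k v'' v') =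
     (\<Sum>v''\<in>words. if v'' = v then \<psi> k v v' else 0) - (\<Sum>v''\<in>words. \<Sum>i\<in>UNIV. p i * pm_scale (A i v v'') (\<psi> k v'' v'))"
    unfolding \<Lambda>_def left_diff_distrib sum_subtractf sum_distrib_right
    by (intro arg_cong2[of _ _ _ _ "(-)"] sum.cong refl) (auto simp: pm_scale_simps)
  also have "\<dots> = \<psi> k v v' - (\<Sum>i\<in>UNIV. p i * (\<Sum>v''\<in>words. pm_scale (A i v v'') (\<psi> k v'' v')))"
    using assms finite_words by (subst sum.swap) (simp add: sum_distrib_left)
  finally show ?thesis using \<psi>_equation[of k v v'] by (simp add: algebra_simps)
qed

text \<open>By \<open>\<Lambda>_\<psi>\<close>, \<open>\<Lambda> (1 + \<Sum>\<psi> k p k) = \<Lambda> + \<Sum>A k p k = 1\<close>.\<close>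
lemma \<Lambda>_\<Psi>:
  assumes "v \<in> words" "v' \<in> words"
  shows "(\<Sum>v''\<in>words. \<Lambda> v v'' * \<Psi> v'' v') = of_bool (v = v')"
proof -
  have "(\<Sum>v''\<in>words. \<Lambda> v v'' * \<Psi> v'' v') =
     (\<Sum>v''\<in>words. if v'' = v' then \<Lambda> v v' else 0) + (\<Sum>v''\<in>words. \<Sum>k\<in>UNIV. \<Lambda> v v'' * \<psi> k v'' v' * p k)"
    unfolding \<Psi>_def distrib_left sum.distrib sum_distrib_left
    by (intro arg_cong2[of _ _ _ _ "(+)"] sum.cong refl) (auto simp: mult.assoc)
  also have "\<dots> = \<Lambda> v v' + (\<Sum>k\<in>UNIV. single [] (A k v v') * p k)"
    using assms finite_words by (subst sum.swap) (simp add: sum_distrib_right[symmetric] \<Lambda>_\<psi>)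
  also have "\<dots> = of_bool (v = v')" by (simp add: \<Lambda>_def pm_scale_eq_mult)
  finally show ?thesis .
qed

end

section \<open>A determinantal criterion for joint nilpotency\<close>

lemma det_cong_dvd:
  fixes P Q :: "complex poly mat"
  assumes P: "P \<in> carrier_mat n n" and Q: "Q \<in> carrier_mat n n"
    and d: "\<And>i j. i < n \<Longrightarrow> j < n \<Longrightarrow> m dvd P $$ (i, j) - Q $$ (i, j)"
  shows "m dvd det P - det Q"
proof -
  have prod: "m dvd (\<Prod>i\<in>S. f i) - (\<Prod>i\<in>S. g i)"
    if "finite S" "\<And>i. i \<in> S \<Longrightarrow> m dvd f i - g i" for S :: "nat set" and f g :: "nat \<Rightarrow> complex poly"
    using that
  proof (induction S rule: finite_induct)
    case (insert x S)
    have "f x * (\<Prod>i\<in>S. f i) - g x * (\<Prod>i\<in>S. g i) =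
        f x * ((\<Prod>i\<in>S. f i) - (\<Prod>i\<in>S. g i)) + (f x - g x) * (\<Prod>i\<in>S. g i)"
      by (simp add: algebra_simps)
    moreover have "m dvd \<dots>" using insert by (intro dvd_add dvd_mult dvd_mult2) auto
    ultimately show ?case using insert by simp
  qed simp
  have "det P - det Q = (\<Sum>\<pi> | \<pi> permutes {0..<n}. signof \<pi> * ((\<Prod>i = 0..<n. P $$ (i, \<pi> i)) - (\<Prod>i = 0..<n. Q $$ (i, \<pi> i))))"
    unfolding det_def'[OF P] det_def'[OF Q] by (simp add: sum_subtractf right_diff_distrib)
  also have "m dvd \<dots>"
  proof (intro dvd_sum dvd_mult prod)
    fix \<pi> i assume "\<pi> \<in> {\<pi>. \<pi> permutes {0..<n}}" "i \<in> {0..<n}"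
    then have "i < n" "\<pi> i < n" using permutes_in_image[of \<pi> "{0..<n}" i] by auto
    then show "m dvd P $$ (i, \<pi> i) - Q $$ (i, \<pi> i)" by (rule d)
  qed simp
  finally show ?thesis .
qed

lemma det_poly_eval: "det (map_mat (\<lambda>f. poly f x) G) = poly (det G) (x :: complex)"
proof -
  have "Ring_Hom.comm_ring_hom (\<lambda>f :: complex poly. poly f x)" by unfold_locales auto
  then show ?thesis by (rule comm_ring_hom.hom_det)
qed

lemma poly_of_bool: "poly (of_bool b) x = of_bool b"
  by (cases b) auto

text \<open>The hypothesis provides, for every \<open>k\<close>, an invertible matrix over \<open>\<complex>[t]\<close> that is congruent to \<open>G = 1 - t M\<close> modulo \<open>t^(k + 1)\<close>,
where \<open>M = \<Sum>A i \<otimes> cnj (A i)\<close>. Its determinant is a unit of \<open>\<complex>[t]\<close>, so it is constant, and the constant is \<open>det G\<close> at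
\<open>t = 0\<close>, which is \<open>1\<close>. Thus \<open>det G - 1\<close> is divisible by all powers of \<open>t\<close> and \<open>det (1 - t M) = 1\<close> for all numbers \<open>t\<close>. So \<open>M\<close>, which is the
completely positive map of \<open>A\<close>, has no nonzero eigenvalue.\<close>
theorem nilpotent_if_locally_invertible:
  fixes A :: "'g::finite \<Rightarrow> 'w \<Rightarrow> 'w \<Rightarrow> complex"
  assumes fin: "finite V"
    and inv: "\<And>k. \<exists>P Q :: 'w \<times> 'w \<Rightarrow> 'w \<times> 'w \<Rightarrow> complex poly.
      (\<forall>x\<in>V \<times> V. \<forall>y\<in>V \<times> V. (\<Sum>z\<in>V \<times> V. P x z * Q z y) = of_bool (x = y)) \<and>
      (\<forall>x\<in>V \<times> V. \<forall>y\<in>V \<times> V. monom 1 (Suc k) dvd P x y -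
         (of_bool (x = y) - monom (\<Sum>i\<in>UNIV. A i (fst x) (fst y) * cnj (A i (snd x) (snd y))) 1))"
    and u: "card V * card V \<le> length u" "q \<in> V" "q' \<in> V"
  shows "mat_word V A u q q' = 0"
proof (rule completely_positive_nilpotent[OF fin _ u])
  fix l T q q'
  assume l: "l \<noteq> 0" and T0: "\<And>q q'. q \<notin> V \<or> q' \<notin> V \<Longrightarrow> T q q' = (0::complex)"
    and eig: "\<And>q q'. q \<in> V \<Longrightarrow> q' \<in> V \<Longrightarrow>
        (\<Sum>i\<in>UNIV. \<Sum>s\<in>V. \<Sum>s'\<in>V. A i q s * T s s' * cnj (A i q' s')) = l * T q q'"
    and q: "q \<in> V" "q' \<in> V"
  define R where "R = V \<times> V"
  define M where "M x y = (\<Sum>i\<in>UNIV. A i (fst x) (fst y) * cnj (A i (snd x) (snd y)))" for x y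
  define N where "N = card R"
  have finR: "finite R" using fin by (simp add: R_def)
  obtain h where "bij_betw h {0..<card R} R" using ex_bij_betw_nat_finite[OF finR] by blast
  then have h: "bij_betw h {0..<N} R" by (simp add: N_def)
  have hR: "h i \<in> R" if "i < N" for i using h that by (auto simp: bij_betw_def)
  have hinj: "h i = h j \<longleftrightarrow> i = j" if "i < N" "j < N" for i j
    using h that by (auto simp: bij_betw_def inj_on_def)
  define G where "G = mat N N (\<lambda>(i, j). of_bool (i = j) - monom (M (h i) (h j)) 1 :: complex poly)"
  have G: "G \<in> carrier_mat N N" by (simp add: G_def)
  have G0: "poly (det G) 0 = 1"
  proof -
    have "map_mat (\<lambda>f. poly f 0) G = 1\<^sub>m N"
      by (rule eq_matI) (auto simp: G_def poly_monom)
    moreover have "det (map_mat (\<lambda>f. poly f 0) G) = poly (det G) 0" by (rule det_poly_eval)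
    ultimately show ?thesis by simp
  qed
  have dvd: "monom 1 (Suc k) dvd 1 - det G" for k
  proof -
    from inv[of k] obtain P Q :: "'w \<times> 'w \<Rightarrow> 'w \<times> 'w \<Rightarrow> complex poly" where
      PQ: "\<And>x y. x \<in> R \<Longrightarrow> y \<in> R \<Longrightarrow> (\<Sum>z\<in>R. P x z * Q z y) = of_bool (x = y)" and
      PG: "\<And>x y. x \<in> R \<Longrightarrow> y \<in> R \<Longrightarrow> monom 1 (Suc k) dvd P x y - (of_bool (x = y) - monom (M x y) 1)"
      unfolding R_def M_def by blast
    define P' where "P' = mat N N (\<lambda>(i, j). P (h i) (h j))"
    define Q' where "Q' = mat N N (\<lambda>(i, j). Q (h i) (h j))"
    have carr: "P' \<in> carrier_mat N N" "Q' \<in> carrier_mat N N" by (simp_all add: P'_def Q'_def)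
    have "P' * Q' = 1\<^sub>m N"
    proof (rule eq_matI)
      fix i j assume "i < dim_row (1\<^sub>m N :: complex poly mat)" "j < dim_col (1\<^sub>m N :: complex poly mat)"
      then have ij: "i < N" "j < N" by auto
      have "(P' * Q') $$ (i, j) = (\<Sum>t\<in>{0..<N}. P (h i) (h t) * Q (h t) (h j))"
        using ij carr by (simp add: times_mat_def scalar_prod_def) (simp add: P'_def Q'_def)
      also have "\<dots> = (\<Sum>z\<in>R. P (h i) z * Q z (h j))"
        by (rule sum.reindex_bij_betw[OF h])
      finally show "(P' * Q') $$ (i, j) = 1\<^sub>m N $$ (i, j)" using ij hR hinj by (simp add: PQ)
    qed (use carr in auto)
    then have "det P' * det Q' = 1" using det_mult[OF carr] by simp
    then have "is_unit (det P')" by (metis dvdI)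
    then obtain c where c: "det P' = [:c:]" by (metis is_unit_poly_iff)
    have "monom 1 (Suc k) dvd det P' - det G"
    proof (rule det_cong_dvd[OF carr(1) G])
      fix i j assume ij: "i < N" "j < N"
      then show "monom 1 (Suc k) dvd P' $$ (i, j) - G $$ (i, j)"
        using PG[OF hR hR, OF ij] hinj by (simp add: P'_def G_def)
    qed
    then obtain r where r: "[:c:] - det G = monom 1 (Suc k) * r" by (auto simp: c)
    have "poly ([:c:] - det G) 0 = 0" unfolding r by (simp add: poly_monom)
    then have "c = 1" using G0 by simp
    then show ?thesis using r by (metis dvdI one_pCons)
  qed
  have "1 - det G = 0"
  proof (rule ccontr)
    assume nz: "1 - det G \<noteq> 0"
    have "degree (monom (1::complex) (Suc (degree (1 - det G)))) \<le> degree (1 - det G)"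
      by (rule dvd_imp_degree_le[OF dvd nz])
    then show False by (simp add: degree_monom_eq)
  qed
  then have det1: "det G = 1" by simp
  define G' where "G' = map_mat (\<lambda>f. poly f (1 / l)) G"
  have G': "G' \<in> carrier_mat N N" using G by (simp add: G'_def)
  have "det G' = poly (det G) (1 / l)" unfolding G'_def by (rule det_poly_eval)
  then have detG': "det G' \<noteq> 0" by (simp add: det1)
  define t where "t = vec N (\<lambda>i. T (fst (h i)) (snd (h i)))"
  have t: "t \<in> carrier_vec N" by (simp add: t_def)
  have "G' *\<^sub>v t = 0\<^sub>v N"
  proof (rule eq_vecI)
    fix i assume "i < dim_vec (0\<^sub>v N :: complex vec)"
    then have i: "i < N" by simp
    obtain a b where ab: "h i = (a, b)" "a \<in> V" "b \<in> V" using hR[OF i] by (auto simp: R_def)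
    let ?t = "\<lambda>x. T (fst x) (snd x)"
    have "(G' *\<^sub>v t) $ i = (\<Sum>j\<in>{0..<N}. (of_bool (i = j) - M (h i) (h j) / l) * ?t (h j))"
      using i G G' t by (simp add: scalar_prod_def) (simp add: G'_def t_def G_def poly_monom poly_of_bool)
    also have "\<dots> = (\<Sum>j\<in>{0..<N}. if j = i then ?t (h i) else 0) - (\<Sum>j\<in>{0..<N}. M (h i) (h j) / l * ?t (h j))"
      unfolding left_diff_distrib sum_subtractf by (intro arg_cong2[of _ _ _ _ "(-)"] sum.cong) auto
    also have "(\<Sum>j\<in>{0..<N}. M (h i) (h j) / l * ?t (h j)) = (\<Sum>x\<in>R. M (h i) x / l * ?t x)"
      by (rule sum.reindex_bij_betw[OF h])
    also have "\<dots> = (\<Sum>s\<in>V. \<Sum>s'\<in>V. M (a, b) (s, s') / l * T s s')"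
      by (simp add: R_def ab(1) sum.cartesian_product case_prod_beta)
    also have "\<dots> = (\<Sum>s\<in>V. \<Sum>s'\<in>V. \<Sum>i\<in>UNIV. A i a s * T s s' * cnj (A i b s')) / l"
      by (simp add: M_def sum_divide_distrib sum_distrib_right sum_distrib_left mult_ac)
    also have "(\<Sum>s\<in>V. \<Sum>s'\<in>V. \<Sum>i\<in>UNIV. A i a s * T s s' * cnj (A i b s')) =
        (\<Sum>s\<in>V. \<Sum>i\<in>UNIV. \<Sum>s'\<in>V. A i a s * T s s' * cnj (A i b s'))"
      by (intro sum.cong refl sum.swap)
    also have "\<dots> = (\<Sum>i\<in>UNIV. \<Sum>s\<in>V. \<Sum>s'\<in>V. A i a s * T s s' * cnj (A i b s'))"
      by (rule sum.swap)
    also have "\<dots> = l * T a b" using ab by (intro eig)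
    finally show "(G' *\<^sub>v t) $ i = 0\<^sub>v N $ i" using i l ab by simp
  qed (use G' in simp)
  then have "t = 0\<^sub>v N" using det_0_iff_vec_prod_zero_field[OF G'] detG' t by blast
  moreover obtain i where "i < N" "h i = (q, q')" using h q by (force simp: bij_betw_def R_def)
  ultimately have "t $ i = 0" by simp
  then show "T q q' = 0" using \<open>i < N\<close> \<open>h i = (q, q')\<close> by (simp add: t_def)
qed

lemma pm_scale_one [simp]: "pm_scale c 1 = (single [] c :: 'g free_poly)"
  by (simp add: pm_scale_eq_mult)

lemma lookup_one_Nil [simp]: "lookup (1 :: 'g free_poly) [] = 1"
  by (simp add: single_Nil_one[symmetric])

section \<open>Truncated compositional inverses\<close>

text \<open>The filtration by the powers of the ideal of polynomials without constant term.\<close>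
definition order_ge :: "nat \<Rightarrow> 'g free_poly \<Rightarrow> bool" where
  "order_ge n f \<longleftrightarrow> (\<forall>w. length w < n \<longrightarrow> lookup f w = 0)"

lemma order_ge_add: "order_ge n f \<Longrightarrow> order_ge n g \<Longrightarrow> order_ge n (f + g)"
  by (simp add: order_ge_def lookup_add)

lemma order_ge_diff: "order_ge n f \<Longrightarrow> order_ge n g \<Longrightarrow> order_ge n (f - g)"
  by (simp add: order_ge_def lookup_minus)

lemma order_ge_sum: "(\<And>x. x \<in> X \<Longrightarrow> order_ge n (f x)) \<Longrightarrow> order_ge n (\<Sum>x\<in>X. f x)"
  by (simp add: order_ge_def lookup_sum)

lemma order_ge_scale: "order_ge n f \<Longrightarrow> order_ge n (pm_scale c f)"
  by (simp add: order_ge_def)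

lemma order_ge_mono: "order_ge n f \<Longrightarrow> m \<le> n \<Longrightarrow> order_ge m f"
  by (simp add: order_ge_def)

lemma order_ge_mult:
  assumes "order_ge m f" "order_ge n g"
  shows "order_ge (m + n) (f * g)"
proof -
  have key: "f * g = (\<Sum>u\<in>keys f. \<Sum>v\<in>keys g. single (u @ v) (lookup f u * lookup g v))"
    by (subst (1) poly_mapping_sum_singles[of f], subst (1) poly_mapping_sum_singles[of g])
       (simp add: sum_product single_mult_free)
  have "order_ge (m + n) (single (u @ v) c)"
    if "u \<in> keys f" "v \<in> keys g" for u v c
  proof -
    have "m \<le> length u" "n \<le> length v"
      using that assms by (auto simp: order_ge_def in_keys_iff not_less[symmetric])
    then show ?thesis by (auto simp: order_ge_def lookup_single when_def)
  qed
  then show ?thesis unfolding key by (intro order_ge_sum)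
qed

lemma order_ge_prod_list:
  "(\<And>i. order_ge 1 (q i)) \<Longrightarrow> order_ge (length w) (prod_list (map q w))"
proof (induction w)
  case (Cons i w)
  then show ?case using order_ge_mult[of 1 "q i" "length w" "prod_list (map q w)"] by simp
qed (simp add: order_ge_def)

lemma order_ge_prod_list_diff:
  assumes "\<And>i. order_ge 1 (q i)" "\<And>i. order_ge 1 (q' i)" "\<And>i. order_ge (Suc k) (q i - q' i)"
  shows "order_ge (k + length w) (prod_list (map q w) - prod_list (map q' w))"
proof (induction w)
  case (Cons i w)
  have "prod_list (map q (i # w)) - prod_list (map q' (i # w)) =
     q i * (prod_list (map q w) - prod_list (map q' w)) + (q i - q' i) * prod_list (map q' w)"
    by (simp add: algebra_simps)
  moreover have "order_ge (k + length (i # w)) (q i * (prod_list (map q w) - prod_list (map q' w)))"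
    using order_ge_mult[OF assms(1) Cons, of i] by simp
  moreover have "order_ge (k + length (i # w)) ((q i - q' i) * prod_list (map q' w))"
    using order_ge_mult[OF assms(3) order_ge_prod_list[of q' w], of i] assms(2) by simp
  ultimately show ?case by (simp add: order_ge_add)
qed (simp add: order_ge_def)

text \<open>A word of length \<open>l \<ge> 2\<close> has one factor \<open>q i - q' i\<close> and \<open>l - 1\<close> further factors of order at least \<open>1\<close> in each term of the telescoping
difference.\<close>
lemma order_ge_subst_diff:
  assumes "\<And>i. order_ge 1 (q i)" "\<And>i. order_ge 1 (q' i)" "\<And>i. order_ge (Suc k) (q i - q' i)" "order_ge 2 f"
  shows "order_ge (Suc (Suc k)) (subst q f - subst q' f)"
proof -
  have "subst q f - subst q' f = (\<Sum>w\<in>keys f. pm_scale (lookup f w) (prod_list (map q w) - prod_list (map q' w)))"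
    by (simp add: subst_eq_lin_ext lin_ext_def pm_scale_simps sum_subtractf)
  also have "order_ge (Suc (Suc k)) \<dots>"
  proof (rule order_ge_sum, rule order_ge_scale)
    fix w assume "w \<in> keys f"
    then have "2 \<le> length w" using assms(4) by (auto simp: order_ge_def in_keys_iff not_less[symmetric])
    then show "order_ge (Suc (Suc k)) (prod_list (map q w) - prod_list (map q' w))"
      using order_ge_mono[OF order_ge_prod_list_diff[OF assms(1-3), of w], of "Suc (Suc k)"] by simp
  qed
  finally show ?thesis .
qed

lemma order_ge_subst:
  assumes "\<And>i. order_ge 1 (q i)" "order_ge n f"
  shows "order_ge n (subst q f)"
  unfolding subst_eq_lin_ext lin_ext_def
proof (rule order_ge_sum, rule order_ge_scale)
  fix w assume "w \<in> keys f"
  then have "n \<le> length w" using assms(2) by (auto simp: order_ge_def in_keys_iff not_less[symmetric])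
  then show "order_ge n (prod_list (map q w))"
    using order_ge_mono[OF order_ge_prod_list[of q w]] assms(1) by blast
qed

text \<open>Fixed point iteration for \<open>q = x - h(q)\<close>, where \<open>p = x + h\<close> with \<open>h\<close> of order at least two; every step gains one order.\<close>
primrec truncated_inverse :: "'g free_map \<Rightarrow> nat \<Rightarrow> 'g free_map" where
  "truncated_inverse p 0 = (\<lambda>i. 0)"
| "truncated_inverse p (Suc k) = (\<lambda>i. indet i - subst (truncated_inverse p k) (p i - indet i))"

lemma truncated_inverse:
  assumes p: "\<And>i. order_ge 2 (p i - indet i)"
  shows "order_ge (Suc k) (subst (truncated_inverse p k) (p i) - indet i)"
proof -
  have ind: "order_ge 1 (indet i)" for i :: 'a by (simp add: order_ge_def indet_def lookup_single when_def)
  have ord1: "order_ge 1 (truncated_inverse p k i)" for k i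
  proof (induction k arbitrary: i)
    case (Suc k)
    have "order_ge 1 (subst (truncated_inverse p k) (p i - indet i))"
      by (rule order_ge_subst[OF Suc]) (rule order_ge_mono[OF p], simp)
    then show ?case using ind by (simp add: order_ge_diff del: subst_simps)
  qed (simp add: order_ge_def)
  have step: "order_ge (Suc k) (truncated_inverse p (Suc k) i - truncated_inverse p k i)" for k i
  proof (induction k arbitrary: i)
    case 0
    then show ?case using ord1[of "Suc 0" i] by simp
  next
    case (Suc k)
    have "order_ge (Suc (Suc k)) (subst (truncated_inverse p k) (p i - indet i) - subst (truncated_inverse p (Suc k)) (p i - indet i))"
    proof (rule order_ge_subst_diff[OF ord1 ord1 _ p])
      fix i
      show "order_ge (Suc k) (truncated_inverse p k i - truncated_inverse p (Suc k) i)"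
        using Suc[of i] by (simp add: order_ge_def lookup_minus)
    qed
    moreover have "truncated_inverse p (Suc (Suc k)) i - truncated_inverse p (Suc k) i =
      subst (truncated_inverse p k) (p i - indet i) - subst (truncated_inverse p (Suc k)) (p i - indet i)"
      by simp
    ultimately show ?case by metis
  qed
  have "subst (truncated_inverse p k) (p i) - indet i = truncated_inverse p k i - truncated_inverse p (Suc k) i"
    by simp
  moreover have "order_ge (Suc k) (truncated_inverse p k i - truncated_inverse p (Suc k) i)"
    using step[of k i] by (simp add: order_ge_def lookup_minus)
  ultimately show ?thesis by simp
qed

lemma mat_word_monom:
  fixes a :: "'g \<Rightarrow> 'q \<Rightarrow> 'q \<Rightarrow> complex"
  shows "mat_word Q (\<lambda>i q q'. monom (a i q q') 1) u q q' = monom (mat_word Q a u q q') (length u)"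
proof (induction u arbitrary: q)
  case Nil
  then show ?case by (simp add: monom_0 one_pCons)
next
  case (Cons i u)
  have "monom (\<Sum>t\<in>Q. f t) n = (\<Sum>t\<in>Q. monom (f t) n)" for f :: "'q \<Rightarrow> complex" and n
    by (induction Q rule: infinite_finite_induct) (auto simp: add_monom[symmetric])
  then show ?case using Cons by (simp add: mult_monom)
qed

lemma order_ge_dvd:
  assumes "order_ge n f"
  shows "monom 1 n dvd mat_eval smult Q (\<lambda>i q q'. monom (a i q q') 1) f q q'"
  unfolding mat_eval_def lin_ext_def mat_word_monom
proof (rule dvd_sum)
  fix w assume "w \<in> keys f"
  then have "n \<le> length w" using assms by (auto simp: order_ge_def in_keys_iff not_less[symmetric])
  then have "monom (mat_word Q a w q q') (length w) = monom 1 n * monom (mat_word Q a w q q') (length w - n)"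
    by (simp add: mult_monom)
  then show "monom 1 n dvd smult (lookup f w) (monom (mat_word Q a w q q') (length w))"
    by (metis dvd_smult dvd_triv_left)
qed

section \<open>The inverse of a normalized map\<close>

context normalized_free_map
begin

lemma order_ge_p: "order_ge 2 (p i - indet i)"
  unfolding order_ge_def
proof (intro allI impI)
  fix v :: "'g list" assume "length v < 2"
  then consider "v = []" | j where "v = [j]" by (cases v; cases "tl v") auto
  then show "lookup (p i - indet i) v = 0"
    by cases (auto simp: lookup_minus const linear_part indet_def lookup_single when_def)
qed

text \<open>Substituting a truncated inverse of \<open>p\<close> into \<open>\<Lambda> \<Psi> = 1\<close> turns \<open>\<Lambda>\<close> into \<open>1 - \<Sum>x i A i\<close> up to terms of high order. Evaluation at
\<open>x i = t cnj (A i)\<close> gives the matrices that the determinantal criterion asks for.\<close>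
lemma A_nilpotent:
  assumes "card words * card words \<le> length u" "v \<in> words" "v' \<in> words"
  shows "mat_word words A u v v' = 0"
proof (rule nilpotent_if_locally_invertible[OF finite_words _ assms])
  fix k
  interpret sp: scalar_algebra "smult :: complex \<Rightarrow> complex poly \<Rightarrow> complex poly" by (rule scalar_algebra_poly)
  let ?q = "truncated_inverse p k"
  define ev where "ev f = mat_eval smult words (\<lambda>i s s'. monom (cnj (A i s s')) 1) f" for f
  define P where "P x y = ev (subst ?q (\<Lambda> (fst x) (fst y))) (snd x) (snd y)" for x y
  define Q where "Q x y = ev (subst ?q (\<Psi> (fst x) (fst y))) (snd x) (snd y)" for x y
  have "(\<Sum>z\<in>words \<times> words. P x z * Q z y) = of_bool (x = y)"
    if xy: "x \<in> words \<times> words" "y \<in> words \<times> words" for x y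
  proof -
    obtain v s v' s' where x: "x = (v, s)" "v \<in> words" "s \<in> words" and y: "y = (v', s')" "v' \<in> words" "s' \<in> words"
      using xy by auto
    have "(\<Sum>z\<in>words \<times> words. P x z * Q z y) =
       (\<Sum>v''\<in>words. \<Sum>s''\<in>words. ev (subst ?q (\<Lambda> v v'')) s s'' * ev (subst ?q (\<Psi> v'' v')) s'' s')"
      by (simp add: P_def Q_def x y sum.cartesian_product case_prod_beta)
    also have "\<dots> = (\<Sum>v''\<in>words. ev (subst ?q (\<Lambda> v v'' * \<Psi> v'' v')) s s')"
      using x finite_words by (simp add: ev_def sp.mat_eval_mult)
    also have "\<dots> = ev (subst ?q (\<Sum>v''\<in>words. \<Lambda> v v'' * \<Psi> v'' v')) s s'"
      by (simp only: ev_def sp.mat_eval_sum subst_sum)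
    also have "\<dots> = of_bool (x = y)"
      using x y by (auto simp: \<Lambda>_\<Psi> ev_def sp.mat_eval_one sp.mat_eval_zero)
    finally show ?thesis .
  qed
  moreover have "monom 1 (Suc k) dvd P x y -
      (of_bool (x = y) - monom (\<Sum>i\<in>UNIV. A i (fst x) (fst y) * cnj (A i (snd x) (snd y))) 1)"
    if xy: "x \<in> words \<times> words" "y \<in> words \<times> words" for x y
  proof -
    obtain v s v' s' where x: "x = (v, s)" "v \<in> words" "s \<in> words" and y: "y = (v', s')" "v' \<in> words" "s' \<in> words"
      using xy by auto
    define \<Lambda>0 where "\<Lambda>0 = (of_bool (v = v') :: 'g free_poly) - (\<Sum>i\<in>UNIV. pm_scale (A i v v') (indet i))"
    have "subst ?q (\<Lambda> v v') - \<Lambda>0 = - (\<Sum>i\<in>UNIV. pm_scale (A i v v') (subst ?q (p i) - indet i))"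
      by (simp add: \<Lambda>_def \<Lambda>0_def subst_sum pm_scale_simps sum_subtractf of_bool_def)
    moreover have "order_ge (Suc k) (\<Sum>i\<in>UNIV. pm_scale (A i v v') (subst ?q (p i) - indet i))"
      by (intro order_ge_sum order_ge_scale truncated_inverse order_ge_p)
    ultimately have "order_ge (Suc k) (subst ?q (\<Lambda> v v') - \<Lambda>0)" by (simp add: order_ge_def)
    then have "monom 1 (Suc k) dvd ev (subst ?q (\<Lambda> v v') - \<Lambda>0) s s'"
      unfolding ev_def by (rule order_ge_dvd)
    moreover have "ev (subst ?q (\<Lambda> v v') - \<Lambda>0) s s' = ev (subst ?q (\<Lambda> v v')) s s' - ev \<Lambda>0 s s'"
      by (simp add: ev_def mat_eval_def lin_ext_diff sp.is_module)
    moreover have "ev \<Lambda>0 s s' = of_bool (x = y) - monom (\<Sum>i\<in>UNIV. A i v v' * cnj (A i s s')) 1"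
    proof -
      have "ev (pm_scale c (indet i)) s s' = monom (c * cnj (A i s s')) 1" for c i
        using x finite_words mat_word_monom[of words "\<lambda>i s s'. cnj (A i s s')" "[i]" s s'] y
        by (simp add: indet_def ev_def sp.mat_eval_single smult_monom of_bool_def if_distrib[of "\<lambda>x. _ * x"] cong: if_cong del: mat_word.simps)
           (simp add: if_distrib[of "\<lambda>x. _ * x"] of_bool_def smult_monom cong: if_cong)
      moreover have "ev (\<Sum>i\<in>UNIV. f i) s s' = (\<Sum>i\<in>UNIV. ev (f i) s s')" for f :: "'g \<Rightarrow> _"
        by (simp add: ev_def sp.mat_eval_sum)
      moreover have "monom (\<Sum>i\<in>UNIV. f i) 1 = (\<Sum>i\<in>UNIV. monom (f i) 1)" for f :: "'g \<Rightarrow> complex"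
        by (induction "UNIV :: 'g set" rule: infinite_finite_induct) (auto simp: poly_eq_iff coeff_sum)
      moreover have "ev (of_bool (v = v')) s s' = of_bool (x = y)"
        by (auto simp: x y ev_def sp.mat_eval_one sp.mat_eval_zero)
      moreover have "ev \<Lambda>0 s s' = ev (of_bool (v = v')) s s' - ev (\<Sum>i\<in>UNIV. pm_scale (A i v v') (indet i)) s s'"
        by (simp add: \<Lambda>0_def ev_def mat_eval_def lin_ext_diff sp.is_module)
      ultimately show ?thesis by simp
    qed
    ultimately show ?thesis by (simp add: P_def x y)
  qed
  ultimately show "\<exists>P Q :: 'g list \<times> 'g list \<Rightarrow> 'g list \<times> 'g list \<Rightarrow> complex poly.
      (\<forall>x\<in>words \<times> words. \<forall>y\<in>words \<times> words. (\<Sum>z\<in>words \<times> words. P x z * Q z y) = of_bool (x = y)) \<and>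
      (\<forall>x\<in>words \<times> words. \<forall>y\<in>words \<times> words. monom 1 (Suc k) dvd P x y -
         (of_bool (x = y) - monom (\<Sum>i\<in>UNIV. A i (fst x) (fst y) * cnj (A i (snd x) (snd y))) 1))"
    by blast
qed

text \<open>Iterating \<open>gen = gen(0) + \<Sum>p i A i gen\<close>; the remainder after \<open>n\<close> steps contains the words of length \<open>n\<close> in the \<open>A i\<close>.\<close>
lemma gen_in_image:
  "\<exists>h. gen v = subst p h + (\<Sum>u | length u = n. \<Sum>v'\<in>words. pm_scale (mat_word words A u v v') (prod_list (map p u) * gen v'))"
  if "v \<in> words"
  using that
proof (induction n arbitrary: v)
  case 0
  have "(\<Sum>v'\<in>words. pm_scale (of_bool (v = v')) (gen v')) = (\<Sum>v'\<in>words. if v' = v then gen v else 0)"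
    by (intro sum.cong) (auto simp: pm_scale_simps)
  then show ?case using 0 finite_words by (intro exI[of _ 0]) simp
next
  case (Suc n)
  let ?R = "\<lambda>v. \<Sum>u | length u = n. \<Sum>v'\<in>words. pm_scale (mat_word words A u v v') (prod_list (map p u) * gen v')"
  from Suc.IH have "\<forall>v\<in>words. \<exists>h. gen v = subst p h + ?R v" by blast
  from bchoice[OF this] obtain h where h: "\<forall>v\<in>words. gen v = subst p (h v) + ?R v" ..
  define g where "g = single [] (lookup (gen v) []) +
     (\<Sum>i\<in>UNIV. indet i * (\<Sum>v''\<in>words. pm_scale (A i v v'') (h v'')))"
  have inner: "(\<Sum>v''\<in>words. pm_scale (A i v v'') (gen v'')) = (\<Sum>v''\<in>words. pm_scale (A i v v'') (subst p (h v'') + ?R v''))" for i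
    by (rule sum.cong[OF refl], rule arg_cong[where f = "pm_scale _"], rule bspec[OF h])
  have "gen v = single [] (lookup (gen v) []) +
     (\<Sum>i\<in>UNIV. p i * (\<Sum>v''\<in>words. pm_scale (A i v v'') (subst p (h v'') + ?R v'')))"
    by (rule trans[OF gen_expand]) (simp only: inner)
  also have "\<dots> = subst p g + (\<Sum>i\<in>UNIV. p i * (\<Sum>v''\<in>words. pm_scale (A i v v'') (?R v'')))"
    by (simp add: g_def subst_sum pm_scale_simps(1) sum.distrib distrib_left add.assoc)
  also have "(\<Sum>i\<in>UNIV. p i * (\<Sum>v''\<in>words. pm_scale (A i v v'') (?R v''))) =
     (\<Sum>i\<in>UNIV. \<Sum>u | length u = n. \<Sum>v'\<in>words. pm_scale (mat_word words A (i # u) v v') (prod_list (map p (i # u)) * gen v'))"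
  proof (rule sum.cong[OF refl])
    fix i
    have "p i * (\<Sum>v''\<in>words. pm_scale (A i v v'') (?R v'')) =
       (\<Sum>v''\<in>words. \<Sum>u | length u = n. \<Sum>v'\<in>words. pm_scale (A i v v'' * mat_word words A u v'' v') (p i * (prod_list (map p u) * gen v')))"
      by (simp add: sum_distrib_left pm_scale_sum pm_scale_simps)
    also have "\<dots> = (\<Sum>u | length u = n. \<Sum>v''\<in>words. \<Sum>v'\<in>words. pm_scale (A i v v'' * mat_word words A u v'' v') (p i * (prod_list (map p u) * gen v')))"
      by (rule sum.swap)
    also have "\<dots> = (\<Sum>u | length u = n. \<Sum>v'\<in>words. \<Sum>v''\<in>words. pm_scale (A i v v'' * mat_word words A u v'' v') (p i * (prod_list (map p u) * gen v')))"
      by (intro sum.cong refl sum.swap)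
    also have "\<dots> = (\<Sum>u | length u = n. \<Sum>v'\<in>words. pm_scale (mat_word words A (i # u) v v') (prod_list (map p (i # u)) * gen v'))"
      by (intro sum.cong refl) (simp add: vs.scale_sum_left mult.assoc)
    finally show "p i * (\<Sum>v''\<in>words. pm_scale (A i v v'') (?R v'')) = \<dots>" .
  qed
  finally show ?case unfolding sum_lists_length_Suc by (intro exI[of _ g])
qed

lemma left_inverse_exists: "\<exists>q. free_comp q p = indet"
proof -
  have "\<exists>h. subst p h = indet j" for j
  proof -
    have j: "[j] \<in> words" by (simp add: words_def deg_bound_def)
    obtain h where "gen [j] = subst p h + (\<Sum>u | length u = card words * card words.
        \<Sum>v'\<in>words. pm_scale (mat_word words A u [j] v') (prod_list (map p u) * gen v'))"
      using gen_in_image[OF j] by blast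
    then show ?thesis using j by (auto simp: A_nilpotent pm_scale_simps gen_letter)
  qed
  then show ?thesis by (simp add: free_comp_def fun_eq_iff) metis
qed

lemma L_subst: "L i (subst p h) = subst p (map_key ((#) i) h)"
proof (induction h rule: poly_mapping_additive_induct)
  case (single v c)
  show ?case
  proof (cases v)
    case Nil
    have "map_key ((#) i) (single [] c) = 0"
      by (rule poly_mapping_eqI) (simp add: map_key.rep_eq inj_on_def lookup_single)
    then show ?thesis by (simp add: Nil)
  next
    case (Cons j u)
    have "map_key ((#) i) (single (j # u) c) = (if i = j then single u c else 0)"
      by (rule poly_mapping_eqI) (auto simp: map_key.rep_eq inj_on_def lookup_single when_def)
    then show ?thesis by (simp add: Cons L_p_mult pm_scale_simps)
  qed
next
  case (add f g)
  then show ?case by (simp add: map_key_plus inj_on_def)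
qed

lemma lookup_subst_Nil: "lookup (subst p h) [] = lookup h []"
proof (induction h rule: poly_mapping_additive_induct)
  case (single v c)
  then show ?case by (cases v) (auto simp: lookup_mult_Nil const lookup_single)
qed (simp add: lookup_add)

text \<open>The operators \<open>L i\<close> shift the coefficients of \<open>h\<close> (\<open>L_subst\<close>), so all of them can be recovered from \<open>subst p h\<close>.\<close>
lemma subst_p_injective:
  assumes "subst p h = 0"
  shows "h = 0"
proof -
  have "lookup h v = 0" if "subst p h = 0" for h v
    using that
  proof (induction v arbitrary: h)
    case Nil
    then show ?case using lookup_subst_Nil[of h] by simp
  next
    case (Cons i v)
    have "subst p (map_key ((#) i) h) = 0" using L_subst[of i h] Cons.prems by simp
    then have "lookup (map_key ((#) i) h) v = 0" by (rule Cons.IH)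
    then show ?case by (simp add: map_key.rep_eq inj_on_def)
  qed
  then show ?thesis using assms by (intro poly_mapping_eqI) simp
qed

text \<open>From \<open>q \<circ> p = x\<close> one gets \<open>(p \<circ> q) \<circ> p = p = x \<circ> p\<close>, and substituting \<open>p\<close> is injective.\<close>
lemma inverse_exists: "\<exists>q. free_comp p q = indet \<and> free_comp q p = indet"
proof -
  obtain q where q: "free_comp q p = indet" using left_inverse_exists by blast
  have "subst q (p i) = indet i" for i
  proof -
    have "subst p (subst q (p i)) = subst indet (p i)"
      using q by (simp add: subst_subst free_comp_def)
    then have "subst p (subst q (p i) - indet i) = 0" by (simp add: subst_identity)
    then have "subst q (p i) - indet i = 0" by (rule subst_p_injective)
    then show ?thesis by simp
  qed
  then have "free_comp p q = indet" by (simp add: free_comp_def fun_eq_iff)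
  then show ?thesis using q by blast
qed

end

section \<open>The inverse of an injective map\<close>

lemma injective_complex_matrix_inverse:
  fixes l :: "'g::finite \<Rightarrow> 'g \<Rightarrow> complex"
  assumes inj: "\<And>h. (\<And>i. (\<Sum>j\<in>UNIV. l i j * h j) = 0) \<Longrightarrow> h = (\<lambda>_. 0)"
  obtains \<mu> where "mat_times l \<mu> = mat_unit" "mat_times \<mu> l = mat_unit"
proof -
  have "\<exists>y. \<forall>i. (\<Sum>j\<in>UNIV. l i j * y j) = of_bool (i = k)" for k
  proof -
    \<comment> \<open>the extra unknown \<open>None\<close> is the scalar in front of the \<open>k\<close>-th unit vector\<close>
    define F where "F i u = (case u of None \<Rightarrow> - of_bool (i = k) | Some j \<Rightarrow> l i j)" for i u
    have "card (UNIV :: 'g set) < card (UNIV :: 'g option set)"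
      unfolding UNIV_option_conv by (simp add: card_image)
    then obtain x where x: "\<exists>u\<in>UNIV. x u \<noteq> 0" "\<forall>i\<in>UNIV. (\<Sum>u\<in>UNIV. F i u * x u) = 0"
      using homogeneous_system_nontrivial[of "UNIV :: 'g set" "UNIV :: 'g option set" F] by auto
    have sum: "(\<Sum>j\<in>UNIV. l i j * x (Some j)) = of_bool (i = k) * x None" for i
    proof -
      have "(\<Sum>u\<in>UNIV. F i u * x u) = F i None * x None + (\<Sum>j\<in>UNIV. F i (Some j) * x (Some j))"
        unfolding UNIV_option_conv by (simp add: sum.reindex)
      then show ?thesis using x(2) by (simp add: F_def)
    qed
    have "x None \<noteq> 0"
    proof
      assume 0: "x None = 0"
      then have "(\<lambda>j. x (Some j)) = (\<lambda>_. 0)" using sum by (intro inj) simp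
      then have "x u = 0" for u using 0 by (cases u) (auto simp: fun_eq_iff)
      then show False using x(1) by simp
    qed
    then have "(\<Sum>j\<in>UNIV. l i j * (x (Some j) / x None)) = of_bool (i = k)" for i
      using sum[of i] by (simp add: sum_divide_distrib[symmetric])
    then show ?thesis by (intro exI[of _ "\<lambda>j. x (Some j) / x None"]) blast
  qed
  then obtain y where y: "\<And>k i. (\<Sum>j\<in>UNIV. l i j * y k j) = of_bool (i = k)" by metis
  define \<mu> where "\<mu> j k = y k j" for j k
  have l\<mu>: "mat_times l \<mu> = mat_unit" by (simp add: mat_times_def \<mu>_def y mat_unit_def fun_eq_iff)
  have "(\<lambda>j. mat_times \<mu> l j k - mat_unit j k) = (\<lambda>_. 0)" for k
  proof (rule inj)
    fix i
    have "(\<Sum>j\<in>UNIV. l i j * (mat_times \<mu> l j k - mat_unit j k)) = mat_times l (mat_times \<mu> l) i k - mat_times l mat_unit i k"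
      unfolding mat_times_def[of l] by (simp only: right_diff_distrib sum_subtractf)
    also have "\<dots> = 0" by (simp add: mat_times_assoc[symmetric] l\<mu>)
    finally show "(\<Sum>j\<in>UNIV. l i j * (mat_times \<mu> l j k - mat_unit j k)) = 0" .
  qed
  then have "mat_times \<mu> l = mat_unit" by (auto simp: fun_eq_iff)
  with l\<mu> show ?thesis using that by blast
qed

text \<open>The linear part of \<open>p\<close> is the Jacobian at the zero matrices of size one.\<close>
lemma linear_part_injective:
  fixes p :: "'g::finite free_map"
  assumes "bi_injective (\<lambda>i j. free_deriv j (p i))" "\<And>i. (\<Sum>j\<in>UNIV. lookup (p i) [j] * h j) = 0"
  shows "h = (\<lambda>_. 0)"
proof -
  define H where "H j = (\<lambda>a b. if a = (0::nat) \<and> b = (0::nat) then h j else 0)" for j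
  have lw: "left_word 1 (\<lambda>_ _ _. 0) u (H j) a b = (if u = [] then H j a b else 0)" for u :: "'g list" and j a b
    by (cases u) (auto simp: left_op_def)
  have rw: "right_word 1 (\<lambda>_ _ _. 0) v (H j) = (if v = [] then H j else (\<lambda>_ _. 0))" for v :: "'g list" and j
    by (cases v) (auto simp: right_op_def fun_eq_iff)
  have lz: "left_word 1 (\<lambda>_ _ _. 0) u (\<lambda>_ _. 0) = (\<lambda>_ _. 0)" for u :: "'g list"
    by (induction u) (auto simp: left_op_def)
  have act: "bi_act 1 1 (\<lambda>_ _ _. 0) (\<lambda>_ _ _. 0) F (H j) a b = lookup F ([], []) * H j a b" for F :: "'g bi_poly" and j a b
  proof (induction F rule: poly_mapping_additive_induct)
    case (single k c)
    obtain u v where "k = (u, v)" by (cases k)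
    then show ?case using lw[of u j a b] lz[of u] rw[of v j]
      by (auto simp: bi_act_single bi_word_def lookup_single when_def)
  next
    case (add F G)
    then show ?case by (simp add: bi_act_add lookup_add distrib_right)
  qed
  have "(\<Sum>j\<in>UNIV. bi_act 1 1 (\<lambda>_ _ _. 0) (\<lambda>_ _ _. 0) (free_deriv j (p i)) (H j) a b) = 0" for i a b
  proof -
    have "(\<Sum>j\<in>UNIV. bi_act 1 1 (\<lambda>_ _ _. 0) (\<lambda>_ _ _. 0) (free_deriv j (p i)) (H j) a b) =
        (\<Sum>j\<in>UNIV. lookup (p i) [j] * H j a b)"
      by (simp only: act lookup_free_deriv_Nil)
    then show ?thesis using assms(2)[of i] by (cases "a = 0 \<and> b = 0") (simp_all add: H_def)
  qed
  moreover have "supported 1 1 (H j)" for j by (auto simp: supported_def H_def)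
  ultimately have "H j 0 0 = 0" for j using assms(1) unfolding bi_injective_def by blast
  then show ?thesis by (auto simp: H_def)
qed

text \<open>With \<open>l\<close> the matrix of the linear part and \<open>\<mu>\<close> its inverse, \<open>p' = \<mu> (p - p(0))\<close> is normalized. If \<open>r\<close> inverts \<open>p'\<close>, then
\<open>r (\<mu> (x - p(0)))\<close> inverts \<open>p\<close>.\<close>
theorem polynomial_inverse_if_bi_injective:
  fixes p :: "'g::finite free_map"
  assumes J: "bi_injective (\<lambda>i j. free_deriv j (p i))"
  shows "\<exists>q. free_comp p q = indet \<and> free_comp q p = indet"
proof -
  define l where "l i j = lookup (p i) [j]" for i j
  define c :: "'g \<Rightarrow> 'g free_poly" where "c i = single [] (lookup (p i) []) " for i
  have inj: "h = (\<lambda>_. 0)" if "\<And>i. (\<Sum>j\<in>UNIV. l i j * h j) = 0" for h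
    by (rule linear_part_injective[OF J]) (use that in \<open>simp add: l_def\<close>)
  obtain \<mu> where \<mu>: "mat_times l \<mu> = mat_unit" "mat_times \<mu> l = mat_unit"
    using injective_complex_matrix_inverse[of l, OF inj] by blast
  define p' where "p' i = (\<Sum>j\<in>UNIV. pm_scale (\<mu> i j) (p j - c j))" for i
  define J' where "J' i j = free_deriv j (p' i)" for i j
  have sc: "pm_scale c F = single ([], []) c * F" for c and F :: "'g bi_poly"
    by (simp add: pm_scale_def zero_bi)
  have dc: "free_deriv j (pm_scale a f) = pm_scale a (free_deriv j f)" for a j and f :: "'g free_poly"
    by (simp add: pm_scale_eq_mult free_deriv_mult sc)
  have ds: "free_deriv j (\<Sum>x\<in>UNIV. f x) = (\<Sum>x\<in>UNIV. free_deriv j (f x))" for j and f :: "'g \<Rightarrow> 'g free_poly"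
    by (simp add: free_deriv_def lin_ext_sum module_pm_scale)
  have "J' i j = mat_times (\<lambda>i j. single ([], []) (\<mu> i j)) (\<lambda>i j. free_deriv j (p i)) i j" for i j
    by (simp add: J'_def p'_def c_def mat_times_def sc[symmetric] dc ds pm_scale_simps)
  then have J'_eq: "J' = mat_times (\<lambda>i j. single ([], []) (\<mu> i j)) (\<lambda>i j. free_deriv j (p i))"
    by (simp add: fun_eq_iff)
  have "bi_injective J'"
    unfolding J'_eq
  proof (rule bi_injective_left_times[OF J])
    have "single ([], []) (\<Sum>x\<in>X. f x) = (\<Sum>x\<in>X. single ([], []) (f x) :: 'g bi_poly)" for X and f :: "'g \<Rightarrow> complex"
      by (induction X rule: infinite_finite_induct) (auto simp: single_add)
    then have "mat_times (\<lambda>i j. single ([], []) (l i j)) (\<lambda>i j. single ([], []) (\<mu> i j)) =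
        (\<lambda>i j. single ([], []) (mat_times l \<mu> i j) :: 'g bi_poly)"
      by (intro ext) (simp add: mat_times_def single_mult_bi)
    also have "\<dots> = mat_unit" unfolding \<mu>(1)
      by (auto simp: mat_unit_def fun_eq_iff) (metis single_one zero_bi)
    finally show "mat_times (\<lambda>i j. single ([], []) (l i j)) (\<lambda>i j. single ([], []) (\<mu> i j)) = (mat_unit :: _ \<Rightarrow> _ \<Rightarrow> 'g bi_poly)" .
  qed
  moreover have lin: "lookup (p' i) [j] = of_bool (i = j)" for i j
    using fun_cong[OF fun_cong[OF \<mu>(2), of i], of j]
    by (simp add: p'_def lookup_sum lookup_minus c_def lookup_single mat_times_def mat_unit_def l_def)
  moreover have "lookup (J' i j) ([], []) = of_bool (i = j)" for i j
    by (simp add: J'_def lookup_free_deriv_Nil lin)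
  ultimately obtain K B where KB: "mat_times J' K = mat_unit" "mat_times B (\<lambda>i j. slice [] (J' i j)) = mat_unit"
    using bi_inverse[of J'] by blast
  interpret normalized_free_map p' K B
    by unfold_locales (use KB lin in \<open>simp_all add: J'_def[abs_def] p'_def lookup_sum lookup_minus c_def\<close>)
  obtain r where r: "free_comp p' r = indet" "free_comp r p' = indet" using inverse_exists by blast
  define a where "a j = (\<Sum>k\<in>UNIV. pm_scale (\<mu> j k) (indet k - c k))" for j
  define q where "q i = subst a (r i)" for i
  have pa: "subst p (a j) = p' j" for j
    by (simp add: a_def p'_def subst_sum c_def)
  have "subst p (q i) = indet i" for i
    using fun_cong[OF r(2), of i] by (simp add: q_def subst_subst pa free_comp_def)
  moreover have "subst q (p i) = indet i" for i
  proof -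
    have qp': "subst q (p' j) = a j" for j
    proof -
      have "subst q (p' j) = subst a (subst r (p' j))" by (simp add: subst_subst q_def[abs_def])
      then show ?thesis using fun_cong[OF r(1), of j] by (simp add: free_comp_def)
    qed
    have collapse: "(\<Sum>j\<in>UNIV. pm_scale (l i j) (\<Sum>k\<in>UNIV. pm_scale (\<mu> j k) (f k))) = f i" for f :: "'g \<Rightarrow> 'g free_poly"
    proof -
      have "(\<Sum>j\<in>UNIV. pm_scale (l i j) (\<Sum>k\<in>UNIV. pm_scale (\<mu> j k) (f k))) =
         (\<Sum>k\<in>UNIV. \<Sum>j\<in>UNIV. pm_scale (l i j * \<mu> j k) (f k))"
        by (subst sum.swap) (simp add: pm_scale_sum pm_scale_simps)
      also have "\<dots> = (\<Sum>k\<in>UNIV. pm_scale (mat_times l \<mu> i k) (f k))"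
        by (simp add: mat_times_def vs.scale_sum_left)
      also have "\<dots> = (\<Sum>k\<in>UNIV. if k = i then f i else 0)"
        unfolding \<mu>(1) by (intro sum.cong) (auto simp: mat_unit_def pm_scale_simps)
      finally show ?thesis by simp
    qed
    have "p i = c i + (\<Sum>j\<in>UNIV. pm_scale (l i j) (p' j))"
      unfolding p'_def collapse by simp
    then have "subst q (p i) = subst q (c i + (\<Sum>j\<in>UNIV. pm_scale (l i j) (p' j)))"
      by (rule arg_cong)
    also have "\<dots> = c i + (\<Sum>j\<in>UNIV. pm_scale (l i j) (subst q (p' j)))"
      by (simp add: subst_sum c_def)
    also have "\<dots> = indet i" unfolding qp' a_def collapse by simp
    finally show ?thesis .
  qed
  ultimately show ?thesis by (intro exI[of _ q]) (simp add: free_comp_def fun_eq_iff)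
qed

theorem theorem6p22:
  fixes p :: "'g::finite free_map"
  assumes "free_injective p"
  shows "\<exists>q :: 'g free_map. free_comp p q = indet \<and> free_comp q p = indet"
  by (rule polynomial_inverse_if_bi_injective[OF derivative_bi_injective[OF assms]])

end
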